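(* Let $d,k,l\in\mathbb{N}$, $1\le p<\infty$, let $\Omega\subset\mathbb{R}^d$ be a bounded domain with Lipschitz boundary $\partial\Omega$, and let $\{f_i\}_{i=1}^l$ be a set of seminorms on $W^{k,p}(\Omega)$ such that: (i) for each $i=1,\dots,l$ there exists $C_i\ge 0$ with $f_i(v)\le C_i\|v\|_{k,p}$ for all $v\in W^{k,p}(\Omega)$; (ii) for every $v\in P_{k-1}$, $\sum_{i=1}^l f_i(v)^p=0$ implies $v=0$. Then $$u\mapsto \|u\|_{k,p}':=\Big(\sum_{i=1}^l f_i(u)^p+|u|_{k,p}^p\Big)^{1/p},\qquad |u|_{k,p}:=\Big(\sum_{|\alpha|=k}\int_\Omega|\partial^\alpha u(x)|^p\,dx\Big)^{1/p},$$ is a norm on $W^{k,p}(\Omega)$ which is equivalent to the standard norm $\|\cdot\|_{k,p}$.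
   Context: $\mathbb{N}=\{1,2,\dots\}$, $\mathbb{N}_0=\mathbb{N}\cup\{0\}$. A domain is an open connected subset of $\mathbb{R}^d$. $W^{k,p}(\Omega)$ is the space of complex-valued $u\in L^p(\Omega)$ whose weak derivatives $\partial^\alpha u$, $\alpha\in\mathbb{N}_0^d$, $|\alpha|\le k$, belong to $L^p(\Omega)$, with standard norm $\|u\|_{k,p}=\big(\sum_{|\alpha|\le k}\int_\Omega|\partial^\alpha u(x)|^p\,dx\big)^{1/p}$. $P_{k-1}$ is the space of polynomial functions $x\mapsto\sum_{|\alpha|\le k-1}C_\alpha x^\alpha$ with coefficients $C_\alpha\in\mathbb{C}$, regarded as elements of $W^{k,p}(\Omega)$. Lipschitz boundary: there exist $a,b>0$, finitely many local (Cartesian, i.e. obtained by rigid motion) coordinate systems $(x_r',x_r^d)=(x_r^1,\dots,x_r^{d-1},x_r^d)$, $r=1,\dots,m$, and Lipschitz continuous functions $a_r:\overline{\Delta_r}\to\mathbb{R}$, where $\Delta_r=\{x_r'\in\mathbb{R}^{d-1}:|x_r^j|<a,\ j=1,\dots,d-1\}$, such that each point of $\partial\Omega$ has an open neighborhood $V$ for which, for some $r$, $V\cap\partial\Omega=\{(x_r',a_r(x_r')):x_r'\in\Delta_r\}$, $V\cap\Omega=\{(x_r',x_r^d):x_r'\in\Delta_r,\ a_r(x_r')<x_r^d<a_r(x_r')+b\}$ and $V\cap(\mathbb{R}^d\setminus\overline\Omega)=\{(x_r',x_r^d):x_r'\in\Delta_r,\ a_r(x_r')-b<x_r^d<a_r(x_r')\}$.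 *)

theory Defs
  imports "HOL-Analysis.Analysis"
begin

text \<open>The space \<open>\<real>\<^sup>d\<close> is \<^typ>\<open>real^'d\<close> with \<open>d = CARD('d)\<close>; multi-indices are functions
  \<^typ>\<open>'d \<Rightarrow> nat\<close>.\<close>

definition order_mi :: "('d::finite \<Rightarrow> nat) \<Rightarrow> nat" where
  "order_mi \<alpha> = (\<Sum>j\<in>UNIV. \<alpha> j)"

lemma finite_order_mi_le: "finite {\<alpha> :: 'd::finite \<Rightarrow> nat. order_mi \<alpha> \<le> k}"
proof (rule finite_subset)
  show "{\<alpha> :: 'd \<Rightarrow> nat. order_mi \<alpha> \<le> k} \<subseteq> PiE UNIV (\<lambda>_. {..k})"
  proof
    fix \<alpha> :: "'d \<Rightarrow> nat"
    assume "\<alpha> \<in> {\<alpha>. order_mi \<alpha> \<le> k}"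
    then have le: "(\<Sum>j\<in>UNIV. \<alpha> j) \<le> k" by (simp add: order_mi_def)
    have "\<alpha> i \<le> k" for i
      using member_le_sum[of i UNIV \<alpha>] le by simp
    then show "\<alpha> \<in> PiE UNIV (\<lambda>_. {..k})" by auto
  qed
qed (simp add: finite_PiE)

lemma finite_order_mi_eq: "finite {\<alpha> :: 'd::finite \<Rightarrow> nat. order_mi \<alpha> = k}"
  by (rule finite_subset[OF _ finite_order_mi_le[of k]]) auto


subsection \<open>Classical derivatives and test functions\<close>

definition partial_deriv :: "'d::finite \<Rightarrow> (real^'d \<Rightarrow> complex) \<Rightarrow> real^'d \<Rightarrow> complex" where
  "partial_deriv j \<phi> x = frechet_derivative \<phi> (at x) (axis j 1)"

text \<open>A fixed enumeration of the coordinates. The classical derivative \<open>\<partial>\<^sup>\<alpha>\<close> below is only ever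
  applied to smooth functions, for which the order of differentiation is irrelevant.\<close>

definition coords :: "'d::finite list" where
  "coords = (SOME js. distinct js \<and> set js = UNIV)"

lemma coords: "distinct (coords :: 'd::finite list)" "set (coords :: 'd list) = UNIV"
proof -
  have "\<exists>js :: 'd list. distinct js \<and> set js = UNIV"
    using finite_distinct_list[of "UNIV :: 'd set"] by auto
  from someI_ex[OF this] show "distinct (coords :: 'd list)" "set (coords :: 'd list) = UNIV"
    by (auto simp: coords_def)
qed

definition multi_deriv ::
    "('d::finite \<Rightarrow> nat) \<Rightarrow> (real^'d \<Rightarrow> complex) \<Rightarrow> real^'d \<Rightarrow> complex" where
  "multi_deriv \<alpha> \<phi> = foldr (\<lambda>j. partial_deriv j ^^ \<alpha> j) coords \<phi>"

text \<open>\<open>C\<^sup>\<infinity>(\<real>\<^sup>d)\<close>: every iterated partial derivative is (Frechet) differentiable, hence continuous.\<close>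

definition smooth :: "(real^'d::finite \<Rightarrow> complex) \<Rightarrow> bool" where
  "smooth \<phi> \<longleftrightarrow> (\<forall>js :: 'd list. foldr partial_deriv js \<phi> differentiable_on UNIV)"

text \<open>\<open>C\<^sub>c\<^sup>\<infinity>(\<Omega>)\<close>, its elements being extended by zero to the whole space.\<close>

definition test_functions :: "(real^'d::finite) set \<Rightarrow> (real^'d \<Rightarrow> complex) set" where
  "test_functions \<Omega> =
     {\<phi>. smooth \<phi> \<and> compact (closure {x. \<phi> x \<noteq> 0}) \<and> closure {x. \<phi> x \<noteq> 0} \<subseteq> \<Omega>}"


subsection \<open>Weak derivatives and Sobolev spaces\<close>

text \<open>Elements of \<open>L\<^sup>p(\<Omega>)\<close> and \<open>W\<^sup>k\<^sup>,\<^sup>p(\<Omega>)\<close> are handled through representatives defined on all of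
  \<open>\<real>\<^sup>d\<close>; only their values on \<open>\<Omega>\<close> matter, and equality in these spaces is \<open>ae_eq_on \<Omega>\<close>.\<close>

definition ae_eq_on ::
    "(real^'d::finite) set \<Rightarrow> (real^'d \<Rightarrow> complex) \<Rightarrow> (real^'d \<Rightarrow> complex) \<Rightarrow> bool" where
  "ae_eq_on \<Omega> u v \<longleftrightarrow> (AE x in lebesgue_on \<Omega>. u x = v x)"

definition Lp_on :: "(real^'d::finite) set \<Rightarrow> real \<Rightarrow> (real^'d \<Rightarrow> complex) set" where
  "Lp_on \<Omega> p = {u. u \<in> borel_measurable (lebesgue_on \<Omega>) \<and>
                   integrable (lebesgue_on \<Omega>) (\<lambda>x. cmod (u x) powr p)}"

definition locally_integrable_on :: "(real^'d::finite) set \<Rightarrow> (real^'d \<Rightarrow> complex) \<Rightarrow> bool" where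
  "locally_integrable_on \<Omega> u \<longleftrightarrow> (\<forall>K. compact K \<and> K \<subseteq> \<Omega> \<longrightarrow> integrable (lebesgue_on K) u)"

definition has_weak_deriv ::
    "(real^'d::finite) set \<Rightarrow> ('d \<Rightarrow> nat) \<Rightarrow> (real^'d \<Rightarrow> complex) \<Rightarrow> (real^'d \<Rightarrow> complex) \<Rightarrow> bool" where
  "has_weak_deriv \<Omega> \<alpha> u w \<longleftrightarrow>
     locally_integrable_on \<Omega> u \<and> locally_integrable_on \<Omega> w \<and>
     (\<forall>\<phi>\<in>test_functions \<Omega>.
        (\<integral>x. u x * multi_deriv \<alpha> \<phi> x \<partial>lebesgue_on \<Omega>) =
        (-1) ^ order_mi \<alpha> * (\<integral>x. w x * \<phi> x \<partial>lebesgue_on \<Omega>))"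

text \<open>A representative of the weak derivative, which is unique up to \<open>ae_eq_on \<Omega>\<close> when it exists.\<close>

definition weak_deriv ::
    "(real^'d::finite) set \<Rightarrow> ('d \<Rightarrow> nat) \<Rightarrow> (real^'d \<Rightarrow> complex) \<Rightarrow> real^'d \<Rightarrow> complex" where
  "weak_deriv \<Omega> \<alpha> u = (SOME w. has_weak_deriv \<Omega> \<alpha> u w)"

definition sobolev_space ::
    "(real^'d::finite) set \<Rightarrow> nat \<Rightarrow> real \<Rightarrow> (real^'d \<Rightarrow> complex) set" where
  "sobolev_space \<Omega> k p =
     {u \<in> Lp_on \<Omega> p. \<forall>\<alpha>. order_mi \<alpha> \<le> k \<longrightarrow> (\<exists>w\<in>Lp_on \<Omega> p. has_weak_deriv \<Omega> \<alpha> u w)}"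

definition sobolev_norm ::
    "(real^'d::finite) set \<Rightarrow> nat \<Rightarrow> real \<Rightarrow> (real^'d \<Rightarrow> complex) \<Rightarrow> real" where
  "sobolev_norm \<Omega> k p u =
     (\<Sum>\<alpha> | order_mi \<alpha> \<le> k. \<integral>x. cmod (weak_deriv \<Omega> \<alpha> u x) powr p \<partial>lebesgue_on \<Omega>) powr (1 / p)"

definition sobolev_seminorm ::
    "(real^'d::finite) set \<Rightarrow> nat \<Rightarrow> real \<Rightarrow> (real^'d \<Rightarrow> complex) \<Rightarrow> real" where
  "sobolev_seminorm \<Omega> k p u =
     (\<Sum>\<alpha> | order_mi \<alpha> = k. \<integral>x. cmod (weak_deriv \<Omega> \<alpha> u x) powr p \<partial>lebesgue_on \<Omega>) powr (1 / p)"

definition modified_norm ::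
    "(real^'d::finite) set \<Rightarrow> nat \<Rightarrow> real \<Rightarrow> nat \<Rightarrow> (nat \<Rightarrow> (real^'d \<Rightarrow> complex) \<Rightarrow> real) \<Rightarrow>
     (real^'d \<Rightarrow> complex) \<Rightarrow> real" where
  "modified_norm \<Omega> k p l f u =
     ((\<Sum>i=1..l. f i u powr p) + sobolev_seminorm \<Omega> k p u powr p) powr (1 / p)"

definition poly_funs :: "nat \<Rightarrow> (real^'d::finite \<Rightarrow> complex) set" where
  "poly_funs n =
     {v. \<exists>C :: ('d \<Rightarrow> nat) \<Rightarrow> complex.
           v = (\<lambda>x. \<Sum>\<alpha> | order_mi \<alpha> \<le> n. C \<alpha> * complex_of_real (\<Prod>j\<in>UNIV. (x $ j) ^ \<alpha> j))}"


subsection \<open>Seminorms and norms on spaces of functions modulo null sets\<close>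

text \<open>The first clause says that \<open>f\<close> is well defined on equivalence classes.\<close>

definition seminorm_on ::
    "(real^'d::finite) set \<Rightarrow> (real^'d \<Rightarrow> complex) set \<Rightarrow> ((real^'d \<Rightarrow> complex) \<Rightarrow> real) \<Rightarrow> bool" where
  "seminorm_on \<Omega> W f \<longleftrightarrow>
     (\<forall>u\<in>W. \<forall>v\<in>W. ae_eq_on \<Omega> u v \<longrightarrow> f u = f v) \<and>
     (\<forall>u\<in>W. 0 \<le> f u) \<and>
     (\<forall>c. \<forall>u\<in>W. f (\<lambda>x. c * u x) = cmod c * f u) \<and>
     (\<forall>u\<in>W. \<forall>v\<in>W. f (\<lambda>x. u x + v x) \<le> f u + f v)"

definition norm_on ::
    "(real^'d::finite) set \<Rightarrow> (real^'d \<Rightarrow> complex) set \<Rightarrow> ((real^'d \<Rightarrow> complex) \<Rightarrow> real) \<Rightarrow> bool" where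
  "norm_on \<Omega> W f \<longleftrightarrow>
     seminorm_on \<Omega> W f \<and> (\<forall>u\<in>W. f u = 0 \<longrightarrow> ae_eq_on \<Omega> u (\<lambda>_. 0))"

definition equivalent_on :: "'f set \<Rightarrow> ('f \<Rightarrow> real) \<Rightarrow> ('f \<Rightarrow> real) \<Rightarrow> bool" where
  "equivalent_on W f g \<longleftrightarrow> (\<exists>c>0. \<exists>C>0. \<forall>u\<in>W. c * g u \<le> f u \<and> f u \<le> C * g u)"


subsection \<open>Lipschitz boundary\<close>

text \<open>Local coordinates \<open>(x', t) \<in> \<real>\<^sup>d\<^sup>-\<^sup>1 \<times> \<real>\<close> are encoded by a distinguished coordinate \<open>e\<close>, which
  plays the role of the last one: \<open>\<real>\<^sup>d\<^sup>-\<^sup>1\<close> is the hyperplane \<open>{x. x $ e = 0}\<close>, and \<open>(x', t)\<close> is the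
  vector \<open>x' + t *\<^sub>R axis e 1\<close>.\<close>

definition base_cube :: "'d::finite \<Rightarrow> real \<Rightarrow> (real^'d) set" where
  "base_cube e a = {x. x $ e = 0 \<and> (\<forall>j. j \<noteq> e \<longrightarrow> \<bar>x $ j\<bar> < a)}"

text \<open>Reflections are included; for \<open>d = 1\<close> they are needed at the right end point of an interval.\<close>

definition rigid_motion :: "(real^'d::finite \<Rightarrow> real^'d) \<Rightarrow> bool" where
  "rigid_motion T \<longleftrightarrow> (\<exists>c A. orthogonal_transformation A \<and> T = (\<lambda>y. c + A y))"

definition lipschitz_boundary :: "(real^'d::finite) set \<Rightarrow> bool" where
  "lipschitz_boundary \<Omega> \<longleftrightarrow>
     (\<exists>a>0. \<exists>b>0. \<exists>(m::nat) (e :: nat \<Rightarrow> 'd) (T :: nat \<Rightarrow> real^'d \<Rightarrow> real^'d) (h :: nat \<Rightarrow> real^'d \<Rightarrow> real).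
        (\<forall>r\<in>{1..m}. rigid_motion (T r) \<and> (\<exists>L. L-lipschitz_on (closure (base_cube (e r) a)) (h r))) \<and>
        (\<forall>y\<in>frontier \<Omega>. \<exists>V. open V \<and> y \<in> V \<and>
           (\<exists>r\<in>{1..m}.
              V \<inter> frontier \<Omega> =
                {T r (x + h r x *\<^sub>R axis (e r) 1) | x. x \<in> base_cube (e r) a} \<and>
              V \<inter> \<Omega> =
                {T r (x + t *\<^sub>R axis (e r) 1) | x t.
                   x \<in> base_cube (e r) a \<and> h r x < t \<and> t < h r x + b} \<and>
              V \<inter> - closure \<Omega> =
                {T r (x + t *\<^sub>R axis (e r) 1) | x t.
                   x \<in> base_cube (e r) a \<and> h r x - b < t \<and> t < h r x})))"

end

theory Submission
  imports Defs
begin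

text \<open>The estimate \<open>\<parallel>u\<parallel>' \<le> C \<parallel>u\<parallel>\<close> is immediate from the boundedness of the seminorms; the converse is the point of
the theorem. It rests on two facts.

First, modulo polynomials the full norm is controlled by the top order derivatives (the Deny--Lions
inequality \<open>deny_lions\<close>): every \<open>u \<in> W\<^sup>k\<^sup>,\<^sup>p(\<Omega>)\<close> has a polynomial \<open>q\<close> of degree less than \<open>k\<close> with
\<open>\<parallel>u - q\<parallel> \<le> C |u|\<^sub>k\<close>. Second, \<open>f\<^sub>1 + \<dots> + f\<^sub>l\<close> is a norm on the finite-dimensional space of these
polynomials and therefore dominates every other norm there (\<open>poly_norm_bound\<close>). Hence
\<open>\<parallel>u\<parallel> \<le> \<parallel>u - q\<parallel> + \<parallel>q\<parallel> \<le> C |u|\<^sub>k + B \<Sum> f\<^sub>i(q)\<close>, and \<open>f\<^sub>i(q) \<le> f\<^sub>i(u) + C\<^sub>i \<parallel>u - q\<parallel>\<close> closes the circle.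

The Deny--Lions inequality follows by induction on \<open>k\<close> from the Poincare inequality
\<open>\<parallel>v - c\<parallel>\<^sub>p \<le> C \<parallel>\<nabla>v\<parallel>\<^sub>p\<close> on \<open>\<Omega>\<close> (\<open>poincare_lipschitz\<close>), applied to the derivatives of order \<open>k - 1\<close>. The
Poincare inequality in turn is a consequence of a single estimate for translations
(\<open>translation_estimate\<close>): if all segments from \<open>x \<in> U\<close> to \<open>x + w\<close> lie in \<open>\<Omega>\<close>, then
\<open>\<integral>\<^sub>U |v(x + w) - v(x)|\<^sup>p dx \<le> C |w|\<^sup>p \<integral>\<^sub>\<Omega> |\<nabla>v|\<^sup>p\<close>. Averaging it over \<open>w\<close> gives the Poincare inequality on
balls; sets that overlap in positive measure can be joined (\<open>poincare_Un\<close>), so connectedness and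
compactness give it near every compact subset of \<open>\<Omega>\<close>; and the layer of \<open>\<Omega>\<close> along a Lipschitz graph can
be pushed into such a compact subset by a translation along the axis of the graph (\<open>boundary_patch\<close>,
\<open>poincare_shift\<close>).

The triangle inequality for \<open>\<parallel>\<cdot>\<parallel>'\<close> is obtained from convexity of its \<open>p\<close>-th power
(\<open>powr_root_subadditive\<close>).\<close>

section \<open>Calculus of smooth functions\<close>

lemma partial_deriv_eqI:
  assumes "(\<phi> has_derivative D) (at x)"
  shows "partial_deriv j \<phi> x = D (axis j 1)"
  using frechet_derivative_at[OF assms] by (simp add: partial_deriv_def)

lemma smooth_differentiable: "smooth \<phi> \<Longrightarrow> \<phi> differentiable (at x)"
  unfolding smooth_def
  by (metis UNIV_I differentiable_on_def foldr_Nil id_apply)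

lemma smooth_partial_deriv: "smooth \<phi> \<Longrightarrow> smooth (partial_deriv j \<phi>)"
  unfolding smooth_def
proof
  fix js assume "\<forall>js. foldr partial_deriv js \<phi> differentiable_on UNIV"
  then have "foldr partial_deriv (js @ [j]) \<phi> differentiable_on UNIV" by blast
  then show "foldr partial_deriv js (partial_deriv j \<phi>) differentiable_on UNIV" by simp
qed

text \<open>Smoothness asks for differentiability of all iterated partial derivatives, so any class of
differentiable functions that is closed under partial derivatives consists of smooth functions.\<close>

lemma smooth_coinduct:
  assumes "X \<phi>" and "\<And>\<phi> x. X \<phi> \<Longrightarrow> \<phi> differentiable (at x)"
    and "\<And>\<phi> j. X \<phi> \<Longrightarrow> X (partial_deriv j \<phi>)"
  shows "smooth \<phi>"
proof -
  have "X (foldr partial_deriv js \<phi>)" for js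
    using assms(1,3) by (induction js) auto
  then show ?thesis
    unfolding smooth_def differentiable_on_def using assms(2) by simp
qed

text \<open>The functions obtained from generators by constants, sums and products. By the sum and product rules it
suffices to differentiate the generators, which reduces every smoothness proof below to a one-line check.\<close>

inductive alg_closure :: "((real^'d::finite \<Rightarrow> complex) \<Rightarrow> bool) \<Rightarrow> (real^'d \<Rightarrow> complex) \<Rightarrow> bool"
  for B where
  gen: "B \<phi> \<Longrightarrow> alg_closure B \<phi>"
| const: "alg_closure B (\<lambda>x. c)"
| add: "alg_closure B \<phi> \<Longrightarrow> alg_closure B \<psi> \<Longrightarrow> alg_closure B (\<lambda>x. \<phi> x + \<psi> x)"
| mult: "alg_closure B \<phi> \<Longrightarrow> alg_closure B \<psi> \<Longrightarrow> alg_closure B (\<lambda>x. \<phi> x * \<psi> x)"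

lemma partial_deriv_const: "partial_deriv j (\<lambda>x. c) = (\<lambda>x. 0)"
  by (rule ext, subst partial_deriv_eqI[OF has_derivative_const]) simp

lemma partial_deriv_add:
  assumes "\<And>x. \<phi> differentiable (at x)" "\<And>x. \<psi> differentiable (at x)"
  shows "partial_deriv j (\<lambda>x. \<phi> x + \<psi> x) = (\<lambda>x. partial_deriv j \<phi> x + partial_deriv j \<psi> x)"
proof
  fix x
  show "partial_deriv j (\<lambda>x. \<phi> x + \<psi> x) x = partial_deriv j \<phi> x + partial_deriv j \<psi> x"
    by (subst partial_deriv_eqI[OF has_derivative_add[OF assms[unfolded frechet_derivative_works]]])
       (simp add: partial_deriv_def)
qed

lemma partial_deriv_mult:
  assumes "\<And>x. \<phi> differentiable (at x)" "\<And>x. \<psi> differentiable (at x)"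
  shows "partial_deriv j (\<lambda>x. \<phi> x * \<psi> x) = (\<lambda>x. \<phi> x * partial_deriv j \<psi> x + partial_deriv j \<phi> x * \<psi> x)"
proof
  fix x
  show "partial_deriv j (\<lambda>x. \<phi> x * \<psi> x) x = \<phi> x * partial_deriv j \<psi> x + partial_deriv j \<phi> x * \<psi> x"
    by (subst partial_deriv_eqI[OF has_derivative_mult[OF assms[unfolded frechet_derivative_works]]])
       (simp add: partial_deriv_def)
qed

lemma alg_closure_smooth:
  assumes diff: "\<And>\<phi> x. B \<phi> \<Longrightarrow> \<phi> differentiable (at x)"
    and der: "\<And>\<phi> j. B \<phi> \<Longrightarrow> alg_closure B (partial_deriv j \<phi>)"
    and "alg_closure B \<phi>"
  shows "smooth \<phi>"
proof -
  have d: "\<psi> differentiable (at x)" if "alg_closure B \<psi>" for \<psi> x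
    using that by (induction) (auto intro: diff)
  have "alg_closure B (partial_deriv j \<psi>)" if "alg_closure B \<psi>" for \<psi> j
    using that
  proof induction
    case (gen \<phi>) then show ?case by (rule der)
  next
    case (const c) then show ?case by (simp add: partial_deriv_const alg_closure.const)
  next
    case (add \<phi> \<psi>)
    then show ?case by (subst partial_deriv_add) (auto intro: d alg_closure.intros)
  next
    case (mult \<phi> \<psi>)
    then show ?case by (subst partial_deriv_mult) (auto intro!: d alg_closure.add alg_closure.mult)
  qed
  with assms(3) d show ?thesis
    by (intro smooth_coinduct[of "alg_closure B"]) auto
qed

lemma alg_closure_smooth_smooth: "alg_closure smooth \<phi> \<Longrightarrow> smooth \<phi>"
  by (rule alg_closure_smooth[of smooth])
     (auto intro: smooth_differentiable smooth_partial_deriv alg_closure.gen)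

lemma smooth_const: "smooth (\<lambda>x. c)"
  and smooth_add: "smooth \<phi> \<Longrightarrow> smooth \<psi> \<Longrightarrow> smooth (\<lambda>x. \<phi> x + \<psi> x)"
  and smooth_mult: "smooth \<phi> \<Longrightarrow> smooth \<psi> \<Longrightarrow> smooth (\<lambda>x. \<phi> x * \<psi> x)"
  by (rule alg_closure_smooth_smooth, rule alg_closure.const)
     (rule alg_closure_smooth_smooth, rule alg_closure.add alg_closure.mult; rule alg_closure.gen; assumption)+

lemma smooth_diff: "smooth \<phi> \<Longrightarrow> smooth \<psi> \<Longrightarrow> smooth (\<lambda>x. \<phi> x - \<psi> x)"
  using smooth_add[OF _ smooth_mult[OF smooth_const[of "-1"]], of \<phi> \<psi>] by simp

lemma smooth_sum: "(\<And>i. i \<in> I \<Longrightarrow> smooth (\<phi> i)) \<Longrightarrow> smooth (\<lambda>x. \<Sum>i\<in>I. \<phi> i x)"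
  by (induction I rule: infinite_finite_induct) (auto intro: smooth_const smooth_add)

lemma smooth_prod: "(\<And>i. i \<in> I \<Longrightarrow> smooth (\<phi> i)) \<Longrightarrow> smooth (\<lambda>x. \<Prod>i\<in>I. \<phi> i x)"
  by (induction I rule: infinite_finite_induct) (auto intro: smooth_const smooth_mult)

lemma smooth_power: "smooth \<phi> \<Longrightarrow> smooth (\<lambda>x. \<phi> x ^ n)"
  by (induction n) (auto intro: smooth_const smooth_mult)

lemma smooth_continuous: "smooth \<phi> \<Longrightarrow> continuous_on S \<phi>"
  by (meson continuous_at_imp_continuous_on differentiable_imp_continuous_within smooth_differentiable)

definition dir_deriv :: "real^'d::finite \<Rightarrow> (real^'d \<Rightarrow> complex) \<Rightarrow> real^'d \<Rightarrow> complex" where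
  "dir_deriv w \<phi> x = (\<Sum>j\<in>UNIV. of_real (w $ j) * partial_deriv j \<phi> x)"

lemma smooth_dir_deriv: "smooth \<phi> \<Longrightarrow> smooth (dir_deriv w \<phi>)"
  unfolding dir_deriv_def[abs_def]
  by (intro smooth_sum smooth_mult smooth_const smooth_partial_deriv)

text \<open>A smooth function is Frechet differentiable by definition, so by linearity its derivative is
determined by the partial derivatives.\<close>

lemma smooth_has_derivative:
  assumes "smooth \<phi>"
  shows "(\<phi> has_derivative (\<lambda>h. dir_deriv h \<phi> x)) (at x)"
proof -
  let ?D = "frechet_derivative \<phi> (at x)"
  have *: "(\<phi> has_derivative ?D) (at x)"
    using smooth_differentiable[OF assms] by (simp add: frechet_derivative_works)
  then interpret bounded_linear ?D by (rule has_derivative_bounded_linear)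
  have "?D h = dir_deriv h \<phi> x" for h
  proof -
    have "?D h = ?D (\<Sum>j\<in>UNIV. h $ j *\<^sub>R axis j 1)"
      using basis_expansion[of h] by (simp add: scalar_mult_eq_scaleR)
    also have "\<dots> = (\<Sum>j\<in>UNIV. h $ j *\<^sub>R ?D (axis j 1))" by (simp add: sum scaleR)
    finally show ?thesis by (simp add: dir_deriv_def partial_deriv_def scaleR_conv_of_real)
  qed
  then have "?D = (\<lambda>h. dir_deriv h \<phi> x)" by blast
  with * show ?thesis by simp
qed

lemma partial_deriv_coord:
  "partial_deriv i (\<lambda>x. of_real (x $ j)) = (\<lambda>x. if i = j then 1 else 0)"
proof
  fix x :: "real^'a"
  have "((\<lambda>x. complex_of_real (x $ j)) has_derivative (\<lambda>h. of_real (h $ j))) (at x)"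
    by (intro has_derivative_of_real bounded_linear.has_derivative[OF bounded_linear_vec_nth] has_derivative_ident)
  from partial_deriv_eqI[OF this, of i]
  show "partial_deriv i (\<lambda>x. complex_of_real (x $ j)) x = (if i = j then 1 else 0)"
    by (auto simp: axis_def)
qed

lemma smooth_coord: "smooth (\<lambda>x :: real^'d::finite. of_real (x $ j))"
proof -
  let ?B = "\<lambda>\<phi>. \<phi> = (\<lambda>x :: real^'d. complex_of_real (x $ j))"
  have d: "\<phi> differentiable at x" if "?B \<phi>" for \<phi> x
  proof -
    have "((\<lambda>x. complex_of_real (x $ j)) has_derivative (\<lambda>h. of_real (h $ j))) (at x)"
      by (intro has_derivative_of_real bounded_linear.has_derivative[OF bounded_linear_vec_nth] has_derivative_ident)
    then have "(\<lambda>x. complex_of_real (x $ j)) differentiable at x" by (rule differentiableI)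
    with that show ?thesis by (simp only:)
  qed
  have p: "alg_closure ?B (partial_deriv i \<phi>)" if "?B \<phi>" for \<phi> i
    unfolding that partial_deriv_coord by (rule alg_closure.const)
  show ?thesis
    by (rule alg_closure_smooth[of ?B, OF d p alg_closure.gen[of ?B, OF refl]])
qed

section \<open>Means over segments and symmetry of derivatives\<close>

text \<open>The mean of \<open>\<phi>\<close> over the segment from \<open>x\<close> to \<open>x + w\<close>. By the fundamental theorem of calculus increments of
a smooth function are such means of its directional derivative (\<open>diff_eq_segment_mean\<close> below).\<close>

definition segment_mean :: "real^'d::finite \<Rightarrow> (real^'d \<Rightarrow> complex) \<Rightarrow> real^'d \<Rightarrow> complex" where
  "segment_mean w \<phi> x = integral {0..1} (\<lambda>s. \<phi> (x + s *\<^sub>R w))"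

lemma continuous_bounded_linear_map:
  fixes D :: "'a::t2_space \<Rightarrow> 'd::finite \<Rightarrow> complex"
  assumes "\<And>j. continuous_on S (\<lambda>t. D t j)"
  shows "continuous_on S (\<lambda>t. Blinfun (\<lambda>h :: real^'d. \<Sum>j\<in>UNIV. of_real (h $ j) * D t j))"
proof (rule continuous_on_blinfun_componentwise)
  fix i :: "real^'d"
  have bl: "bounded_linear (\<lambda>h :: real^'d. \<Sum>j\<in>UNIV. of_real (h $ j) * D t j)" for t
    by (intro bounded_linear_sum bounded_linear_mult_const bounded_linear_compose[OF bounded_linear_of_real bounded_linear_vec_nth])
  show "continuous_on S (\<lambda>t. blinfun_apply (Blinfun (\<lambda>h. \<Sum>j\<in>UNIV. of_real (h $ j) * D t j)) i)"
    unfolding bounded_linear_Blinfun_apply[OF bl]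
    by (intro continuous_intros assms)
qed

text \<open>Differentiation under the integral sign; the derivative is jointly continuous in \<open>x\<close> and \<open>s\<close>.\<close>

lemma segment_mean_has_derivative:
  assumes "smooth \<phi>"
  shows "(segment_mean w \<phi> has_derivative (\<lambda>h. \<Sum>j\<in>UNIV. of_real (h $ j) * segment_mean w (partial_deriv j \<phi>) x)) (at x)"
proof -
  define L where "L = (\<lambda>x s. Blinfun (\<lambda>h. dir_deriv h \<phi> (x + s *\<^sub>R w)))"
  have bl: "bounded_linear (\<lambda>h. dir_deriv h \<phi> x)" for x
    using smooth_has_derivative[OF assms] by (rule has_derivative_bounded_linear)
  have Lapp: "blinfun_apply (L x s) = (\<lambda>h. dir_deriv h \<phi> (x + s *\<^sub>R w))" for x s
    unfolding L_def by (rule bounded_linear_Blinfun_apply[OF bl])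
  have cont: "continuous_on (UNIV \<times> cbox 0 1) (\<lambda>(x, s). L x s)"
  proof -
    have "continuous_on (UNIV \<times> cbox 0 1) (\<lambda>t. Blinfun (\<lambda>h :: real^'a. \<Sum>j\<in>UNIV. of_real (h $ j) * (\<lambda>j. partial_deriv j \<phi> (fst t + snd t *\<^sub>R w)) j))"
      by (intro continuous_bounded_linear_map continuous_on_compose2[OF smooth_continuous[OF smooth_partial_deriv[OF assms], of UNIV]] continuous_intros) auto
    then show ?thesis by (simp add: L_def dir_deriv_def case_prod_unfold)
  qed
  have int: "(\<lambda>s. \<psi> (x + s *\<^sub>R w)) integrable_on cbox 0 1" if "smooth \<psi>" for \<psi> x
    by (intro integrable_continuous continuous_on_compose2[OF smooth_continuous[OF that, of UNIV]] continuous_intros) auto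
  have "((\<lambda>x. integral (cbox 0 1) (\<lambda>s. \<phi> (x + s *\<^sub>R w))) has_derivative
      blinfun_apply (integral (cbox 0 1) (L x))) (at x within UNIV)"
  proof (rule leibniz_rule[where U=UNIV and fx=L])
    fix x :: "real^'a" and s :: real
    have "((\<lambda>x. x + s *\<^sub>R w) has_derivative (\<lambda>h. h)) (at x)"
      by (auto intro!: derivative_eq_intros)
    from diff_chain_at[OF this smooth_has_derivative[OF assms]]
    show "((\<lambda>x. \<phi> (x + s *\<^sub>R w)) has_derivative blinfun_apply (L x s)) (at x within UNIV)"
      by (simp add: o_def Lapp)
  qed (use cont int[OF assms] in auto)
  moreover have "blinfun_apply (integral (cbox 0 1) (L x)) = (\<lambda>h. \<Sum>j\<in>UNIV. of_real (h $ j) * segment_mean w (partial_deriv j \<phi>) x)"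
  proof
    fix h
    have "continuous_on (cbox 0 1) (\<lambda>s. (\<lambda>(x, s). L x s) (x, s))"
      by (rule continuous_on_compose2[OF cont]) (auto intro!: continuous_intros)
    then have "continuous_on (cbox 0 1) (L x)" by simp
    then have "L x integrable_on cbox 0 1" by (rule integrable_continuous)
    then have "blinfun_apply (integral (cbox 0 1) (L x)) h = integral (cbox 0 1) (\<lambda>s. dir_deriv h \<phi> (x + s *\<^sub>R w))"
      by (simp add: blinfun_apply_integral Lapp)
    also have "\<dots> = (\<Sum>j\<in>UNIV. of_real (h $ j) * segment_mean w (partial_deriv j \<phi>) x)"
      unfolding dir_deriv_def segment_mean_def
      by (subst integral_sum[OF finite integrable_on_mult_right[OF int[OF smooth_partial_deriv[OF assms]]]]) simp
    finally show "blinfun_apply (integral (cbox 0 1) (L x)) h = (\<Sum>j\<in>UNIV. of_real (h $ j) * segment_mean w (partial_deriv j \<phi>) x)" .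
  qed
  ultimately show ?thesis unfolding segment_mean_def[abs_def] by simp
qed

lemma partial_deriv_segment_mean:
  assumes "smooth \<phi>" shows "partial_deriv j (segment_mean w \<phi>) = segment_mean w (partial_deriv j \<phi>)"
proof
  fix x
  have "(\<Sum>i\<in>UNIV. of_real (axis j 1 $ i) * segment_mean w (partial_deriv i \<phi>) x) = segment_mean w (partial_deriv j \<phi>) x"
    by (subst sum.remove[of _ j]) (auto simp: axis_def intro!: sum.neutral)
  with partial_deriv_eqI[OF segment_mean_has_derivative[OF assms], of j]
  show "partial_deriv j (segment_mean w \<phi>) x = segment_mean w (partial_deriv j \<phi>) x" by simp
qed

lemma smooth_segment_mean: assumes "smooth \<phi>" shows "smooth (segment_mean w \<phi>)"
proof (rule smooth_coinduct[of "\<lambda>\<psi>. \<exists>\<phi>. smooth \<phi> \<and> \<psi> = segment_mean w \<phi>"])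
  show "\<exists>\<phi>'. smooth \<phi>' \<and> segment_mean w \<phi> = segment_mean w \<phi>'" using assms by blast
next
  fix \<psi> x assume "\<exists>\<phi>'. smooth \<phi>' \<and> \<psi> = segment_mean w \<phi>'"
  then obtain \<phi>' where "smooth \<phi>'" and eq: "\<psi> = segment_mean w \<phi>'" by blast
  from differentiableI[OF segment_mean_has_derivative[OF this(1)]]
  show "\<psi> differentiable (at x)" unfolding eq .
next
  fix \<psi> j assume "\<exists>\<phi>'. smooth \<phi>' \<and> \<psi> = segment_mean w \<phi>'"
  then obtain \<phi>' where "smooth \<phi>'" and eq: "\<psi> = segment_mean w \<phi>'" by blast
  then have "smooth (partial_deriv j \<phi>')" "partial_deriv j \<psi> = segment_mean w (partial_deriv j \<phi>')"
    by (simp_all only: partial_deriv_segment_mean smooth_partial_deriv)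
  then show "\<exists>\<phi>'. smooth \<phi>' \<and> partial_deriv j \<psi> = segment_mean w \<phi>'" by blast
qed

lemma dir_deriv_segment_mean:
  assumes "smooth \<phi>" shows "dir_deriv h (segment_mean w \<phi>) x = segment_mean w (dir_deriv h \<phi>) x"
proof -
  have int: "(\<lambda>s. \<psi> (x + s *\<^sub>R w)) integrable_on {0..1}" if "smooth \<psi>" for \<psi>
    by (intro integrable_continuous_real continuous_on_compose2[OF smooth_continuous[OF that, of UNIV]] continuous_intros) auto
  show ?thesis
    unfolding dir_deriv_def partial_deriv_segment_mean[OF assms] unfolding segment_mean_def
    by (subst integral_sum[OF finite integrable_on_mult_right[OF int[OF smooth_partial_deriv[OF assms]]]]) simp
qed

lemma diff_eq_segment_mean:
  assumes "smooth \<phi>" shows "\<phi> (x + w) - \<phi> x = segment_mean w (dir_deriv w \<phi>) x"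
proof -
  have "((\<lambda>s. \<phi> (x + s *\<^sub>R w)) has_vector_derivative dir_deriv w \<phi> (x + s *\<^sub>R w)) (at s within {0..1})" for s
  proof -
    have "((\<lambda>s. x + s *\<^sub>R w) has_derivative (\<lambda>t. t *\<^sub>R w)) (at s within {0..1})"
      by (auto intro!: derivative_eq_intros)
    from has_derivative_in_compose[OF this has_derivative_at_withinI[OF smooth_has_derivative[OF assms]]]
    have "((\<lambda>s. \<phi> (x + s *\<^sub>R w)) has_derivative (\<lambda>t. dir_deriv (t *\<^sub>R w) \<phi> (x + s *\<^sub>R w))) (at s within {0..1})" .
    moreover have "dir_deriv (t *\<^sub>R w) \<phi> y = t *\<^sub>R dir_deriv w \<phi> y" for t y
      unfolding scaleR_conv_of_real[of t "dir_deriv w \<phi> y"]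
      by (simp add: dir_deriv_def sum_distrib_left mult.assoc)
    ultimately show ?thesis by (simp add: has_vector_derivative_def)
  qed
  then have "((\<lambda>s. dir_deriv w \<phi> (x + s *\<^sub>R w)) has_integral \<phi> (x + 1 *\<^sub>R w) - \<phi> (x + 0 *\<^sub>R w)) {0..1}"
    by (intro fundamental_theorem_of_calculus) auto
  then show ?thesis by (simp add: segment_mean_def integral_unique)
qed

lemma dir_deriv_axis: "dir_deriv (t *\<^sub>R axis j 1) \<phi> x = of_real t * partial_deriv j \<phi> x"
  unfolding dir_deriv_def by (subst sum.remove[of _ j]) (auto simp: axis_def intro!: sum.neutral)

text \<open>The means over shrinking segments converge to the value at the end point.\<close>

lemma segment_mean_zero_imp_zero:
  assumes "smooth \<psi>" and "\<And>t. t > 0 \<Longrightarrow> segment_mean (t *\<^sub>R w) \<psi> x = 0"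
  shows "\<psi> x = 0"
proof (rule ccontr)
  assume "\<psi> x \<noteq> 0"
  then have "cmod (\<psi> x) / 2 > 0" by simp
  moreover have "isCont \<psi> x"
    using smooth_continuous[OF assms(1), of UNIV] by (simp add: continuous_on_eq_continuous_at)
  ultimately obtain d where d: "d > 0" "\<And>y. dist y x < d \<Longrightarrow> dist (\<psi> y) (\<psi> x) < cmod (\<psi> x) / 2"
    unfolding continuous_at_eps_delta by blast
  \<comment> \<open>a step so short that the whole segment stays within distance d\<close>
  define t where "t = d / (2 * (norm w + 1))"
  have t: "t > 0" "t * norm w < d"
  proof -
    have p: "2 * (norm w + 1) > 0" by (simp add: add_nonneg_pos)
    show "t > 0" using d(1) p by (simp add: t_def)
    have "d * norm w < d * (2 * (norm w + 1))" using d(1) norm_ge_zero[of w] by (intro mult_strict_left_mono) (simp_all add: add_nonneg_pos add.commute)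
    then show "t * norm w < d" using p by (simp add: t_def pos_divide_less_eq)
  qed
  have near: "cmod (\<psi> (x + s *\<^sub>R t *\<^sub>R w) - \<psi> x) \<le> cmod (\<psi> x) / 2" if "s \<in> {0..1}" for s
  proof -
    have "s * (t * norm w) \<le> 1 * (t * norm w)" by (rule mult_right_mono) (use that t in auto)
    moreover have "norm (s *\<^sub>R t *\<^sub>R w) = s * (t * norm w)" using that t by (simp add: abs_mult)
    ultimately have "norm (s *\<^sub>R t *\<^sub>R w) < d" using t by linarith
    then show ?thesis using d(2)[of "x + s *\<^sub>R t *\<^sub>R w"] by (simp add: dist_norm)
  qed
  have int: "(\<lambda>s. \<psi> (x + s *\<^sub>R t *\<^sub>R w)) integrable_on {0..1}"
    by (intro integrable_continuous_real continuous_on_compose2[OF smooth_continuous[OF assms(1), of UNIV]] continuous_intros) auto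
  have "integral {0..1} (\<lambda>s. \<psi> (x + s *\<^sub>R t *\<^sub>R w) - \<psi> x) = segment_mean (t *\<^sub>R w) \<psi> x - \<psi> x"
    unfolding segment_mean_def by (subst integral_diff[OF int]) auto
  also have "\<dots> = - \<psi> x" using assms(2)[OF t(1)] by simp
  moreover have "norm (integral {0..1} (\<lambda>s. \<psi> (x + s *\<^sub>R t *\<^sub>R w) - \<psi> x)) \<le> integral {0..1::real} (\<lambda>_. cmod (\<psi> x) / 2)"
    using near by (intro integral_norm_bound_integral integrable_diff int) auto
  ultimately show False using \<open>\<psi> x \<noteq> 0\<close> by (simp add: norm_minus_cancel)
qed

text \<open>Write \<open>\<phi>(y + t e\<^sub>i) - \<phi>(y)\<close> as \<open>t\<close> times the segment mean of \<open>\<partial>\<^sub>i\<phi>\<close> and apply \<open>\<partial>\<^sub>j\<close>, which commutes with segment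
means. Comparing with the same formula for the increment of \<open>\<partial>\<^sub>j\<phi>\<close>, the function
\<open>\<partial>\<^sub>i\<partial>\<^sub>j\<phi> - \<partial>\<^sub>j\<partial>\<^sub>i\<phi>\<close> has mean zero over every segment in direction \<open>e\<^sub>i\<close>, hence vanishes.\<close>

lemma partial_deriv_commute:
  assumes "smooth \<phi>"
  shows "partial_deriv i (partial_deriv j \<phi>) = partial_deriv j (partial_deriv i \<phi>)"
proof
  fix x
  let ?\<psi> = "\<lambda>y. partial_deriv i (partial_deriv j \<phi>) y - partial_deriv j (partial_deriv i \<phi>) y"
  note sm = smooth_partial_deriv[OF smooth_partial_deriv[OF assms]]
  have "segment_mean (t *\<^sub>R axis i 1) ?\<psi> y = 0" if t: "t > 0" for t y
  proof -
    let ?w = "t *\<^sub>R axis i 1 :: real^'a"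
    have int: "(\<lambda>s. \<psi> (y + s *\<^sub>R ?w)) integrable_on {0..1}" if "smooth \<psi>" for \<psi>
      by (intro integrable_continuous_real continuous_on_compose2[OF smooth_continuous[OF that, of UNIV]] continuous_intros) auto
    have tr: "(\<lambda>y. \<phi> (y + ?w) - \<phi> y) = segment_mean ?w (dir_deriv ?w \<phi>)"
      using diff_eq_segment_mean[OF assms] by blast
    have mult: "segment_mean ?w (\<lambda>x. of_real t * \<psi> x) y = of_real t * segment_mean ?w \<psi> y" for \<psi> y
      by (simp add: segment_mean_def)
    have "((\<lambda>y. \<phi> (y + ?w) - \<phi> y) has_derivative (\<lambda>h. dir_deriv h \<phi> (y + ?w) - dir_deriv h \<phi> y)) (at y)"
    proof (intro has_derivative_diff smooth_has_derivative[OF assms])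
      have "((\<lambda>x. x + ?w) has_derivative (\<lambda>h. h)) (at y)"
        by (auto intro!: derivative_eq_intros)
      from diff_chain_at[OF this smooth_has_derivative[OF assms]]
      show "((\<lambda>y. \<phi> (y + ?w)) has_derivative (\<lambda>h. dir_deriv h \<phi> (y + ?w))) (at y)" by (simp add: o_def)
    qed
    from partial_deriv_eqI[OF this, of j]
    have "partial_deriv j \<phi> (y + ?w) - partial_deriv j \<phi> y = partial_deriv j (segment_mean ?w (dir_deriv ?w \<phi>)) y"
      using dir_deriv_axis[of 1 j \<phi>] by (simp add: tr)
    also have "partial_deriv j (segment_mean ?w (dir_deriv ?w \<phi>)) y = segment_mean ?w (partial_deriv j (dir_deriv ?w \<phi>)) y"
      by (simp add: partial_deriv_segment_mean smooth_dir_deriv assms)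
    also have "partial_deriv j (dir_deriv ?w \<phi>) = (\<lambda>y. of_real t * partial_deriv j (partial_deriv i \<phi>) y)"
      unfolding dir_deriv_axis[abs_def]
      by (subst partial_deriv_mult) (auto simp: partial_deriv_const smooth_differentiable smooth_partial_deriv assms)
    also have "partial_deriv j \<phi> (y + ?w) - partial_deriv j \<phi> y = segment_mean ?w (\<lambda>y. of_real t * partial_deriv i (partial_deriv j \<phi>) y) y"
      using diff_eq_segment_mean[OF smooth_partial_deriv[OF assms], of j y ?w] by (simp add: dir_deriv_axis[abs_def])
    finally have "segment_mean ?w (partial_deriv i (partial_deriv j \<phi>)) y = segment_mean ?w (partial_deriv j (partial_deriv i \<phi>)) y"
      using t by (simp add: mult)
    then show ?thesis unfolding segment_mean_def by (subst integral_diff[OF int[OF sm] int[OF sm]]) simp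
  qed
  then have "?\<psi> x = 0" by (rule segment_mean_zero_imp_zero[OF smooth_diff[OF sm sm]])
  then show "partial_deriv i (partial_deriv j \<phi>) x = partial_deriv j (partial_deriv i \<phi>) x" by simp
qed

section \<open>Classical derivatives of higher order\<close>

lemma smooth_foldr: "smooth \<phi> \<Longrightarrow> smooth (foldr partial_deriv js \<phi>)"
  by (induction js) (auto intro: smooth_partial_deriv)

lemma foldr_partial_deriv_commute:
  "smooth \<phi> \<Longrightarrow> foldr partial_deriv js (partial_deriv j \<phi>) = partial_deriv j (foldr partial_deriv js \<phi>)"
proof (induction js)
  case (Cons a js)
  then show ?case using partial_deriv_commute[OF smooth_foldr[OF Cons.prems], of a j js] by simp
qed simp

text \<open>Only the number of occurrences of each coordinate matters; this makes the classical derivative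
\<open>\<partial>\<^sup>\<alpha>\<close> independent of the enumeration of the coordinates.\<close>

lemma foldr_partial_deriv_perm:
  assumes "smooth \<phi>" "mset js = mset ks"
  shows "foldr partial_deriv js \<phi> = foldr partial_deriv ks \<phi>"
  using assms(2)
proof (induction js arbitrary: ks)
  case (Cons j js)
  then have "j \<in> set ks" by (metis list.set_intros(1) mset_eq_setD)
  then obtain k1 k2 where ks: "ks = k1 @ j # k2" by (meson split_list)
  with Cons.prems have "mset js = mset (k1 @ k2)" by simp
  then have "foldr partial_deriv js \<phi> = foldr partial_deriv (k1 @ k2) \<phi>" by (rule Cons.IH)
  then show ?case
    by (simp add: ks foldr_partial_deriv_commute smooth_foldr assms)
qed simp

text \<open>The list of coordinates along which \<open>\<partial>\<^sup>\<alpha>\<close> differentiates.\<close>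

definition mi_list :: "('d::finite \<Rightarrow> nat) \<Rightarrow> 'd list" where
  "mi_list \<alpha> = concat (map (\<lambda>j. replicate (\<alpha> j) j) coords)"

lemma count_mi_list: "count (mset (mi_list \<alpha>)) j = \<alpha> j"
proof -
  have "distinct js \<Longrightarrow> count (mset (concat (map (\<lambda>j. replicate (\<alpha> j) j) js))) j = (if j \<in> set js then \<alpha> j else 0)" for js
    by (induction js) (auto simp: count_replicate_mset)
  then show ?thesis by (simp add: mi_list_def coords)
qed

lemma length_mi_list: "length (mi_list \<alpha>) = order_mi \<alpha>"
proof -
  have "distinct js \<Longrightarrow> length (concat (map (\<lambda>j. replicate (\<alpha> j) j) js)) = (\<Sum>j\<in>set js. \<alpha> j)" for js
    by (induction js) auto
  then show ?thesis by (simp add: mi_list_def coords order_mi_def)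
qed

lemma multi_deriv_eq_foldr: "multi_deriv \<alpha> \<phi> = foldr partial_deriv (mi_list \<alpha>) \<phi>"
proof -
  have rep: "foldr f (replicate n x) y = (f x ^^ n) y" for f :: "'x \<Rightarrow> 'y \<Rightarrow> 'y" and n x y
    by (induction n) auto
  have "foldr (\<lambda>j. partial_deriv j ^^ \<alpha> j) js \<phi> = foldr partial_deriv (concat (map (\<lambda>j. replicate (\<alpha> j) j) js)) \<phi>" for js
    by (induction js) (auto simp: rep)
  then show ?thesis by (simp add: multi_deriv_def mi_list_def)
qed

lemma smooth_multi_deriv: "smooth \<phi> \<Longrightarrow> smooth (multi_deriv \<alpha> \<phi>)"
  by (simp add: multi_deriv_eq_foldr smooth_foldr)

text \<open>The multi-index \<open>\<alpha> + e\<^sub>j\<close>.\<close>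

definition mi_suc :: "'d \<Rightarrow> ('d::finite \<Rightarrow> nat) \<Rightarrow> 'd \<Rightarrow> nat" where
  "mi_suc j \<alpha> = \<alpha>(j := Suc (\<alpha> j))"

lemma order_mi_suc [simp]: "order_mi (mi_suc j \<alpha>) = Suc (order_mi \<alpha>)"
  by (simp add: order_mi_def mi_suc_def sum.remove[of UNIV j])

lemma multi_deriv_mi_suc:
  assumes "smooth \<phi>"
  shows "multi_deriv (mi_suc j \<alpha>) \<phi> = multi_deriv \<alpha> (partial_deriv j \<phi>)"
    and "multi_deriv (mi_suc j \<alpha>) \<phi> = partial_deriv j (multi_deriv \<alpha> \<phi>)"
proof -
  have "mset (mi_list (mi_suc j \<alpha>)) = mset (j # mi_list \<alpha>)"
    by (rule multiset_eqI) (simp add: count_mi_list mi_suc_def)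
  from foldr_partial_deriv_perm[OF assms this]
  show "multi_deriv (mi_suc j \<alpha>) \<phi> = partial_deriv j (multi_deriv \<alpha> \<phi>)"
    by (simp add: multi_deriv_eq_foldr)
  then show "multi_deriv (mi_suc j \<alpha>) \<phi> = multi_deriv \<alpha> (partial_deriv j \<phi>)"
    by (simp add: multi_deriv_eq_foldr foldr_partial_deriv_commute assms)
qed

lemma multi_deriv_zero: "multi_deriv (\<lambda>_. 0) \<phi> = \<phi>"
proof -
  have "length (mi_list (\<lambda>_::'a. 0)) = 0" by (simp add: length_mi_list order_mi_def)
  then show ?thesis by (simp add: multi_deriv_eq_foldr)
qed

lemma multi_deriv_unit: "smooth \<phi> \<Longrightarrow> multi_deriv (mi_suc j (\<lambda>_. 0)) \<phi> = partial_deriv j \<phi>"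
  by (simp add: multi_deriv_mi_suc multi_deriv_zero)

section \<open>Bump functions and the fundamental lemma\<close>

text \<open>The functions \<open>e\<^sup>-\<^sup>1\<^sup>/\<^sup>t / t\<^sup>m\<close> for \<open>t > 0\<close>, extended by zero. The family, unlike its member for \<open>m = 0\<close>
alone, spans a space closed under differentiation.\<close>

definition flat :: "nat \<Rightarrow> real \<Rightarrow> real" where
  "flat m t = (if t > 0 then exp (- 1 / t) / t ^ m else 0)"

lemma flat_has_derivative:
  "(flat m has_real_derivative flat (m + 2) t - real m * flat (m + 1) t) (at t)"
proof (cases t "0 :: real" rule: linorder_cases)
  case less
  have "((\<lambda>t. 0) has_real_derivative 0) (at t)" by simp
  then have "(flat m has_real_derivative 0) (at t)"
    by (rule has_field_derivative_transform_within_open[of _ _ _ "{..<0}"]) (use less in \<open>auto simp: flat_def\<close>)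
  then show ?thesis using less by (simp add: flat_def)
next
  case greater
  have "((\<lambda>t. exp (- 1 / t) / t ^ m) has_real_derivative flat (m + 2) t - real m * flat (m + 1) t) (at t)"
  proof -
    have 1: "((\<lambda>t. exp (- 1 / t)) has_real_derivative exp (- 1 / t) / (t * t)) (at t)"
      using greater by (auto intro!: derivative_eq_intros simp: power2_eq_square)
    have 2: "exp (- 1 / t) / (t * t) * t ^ m - exp (- 1 / t) * (real m * t ^ (m - Suc 0))
        = (flat (m + 2) t - real m * flat (m + 1) t) * (t ^ m * t ^ m)"
      using greater by (cases m) (auto simp: flat_def field_simps)
    show ?thesis
      using DERIV_divide[OF 1 DERIV_pow[of m t]] greater unfolding 2 by simp
  qed
  then show ?thesis
    by (rule has_field_derivative_transform_within_open[of _ _ _ "{0<..}"]) (use greater in \<open>auto simp: flat_def\<close>)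
next
  case equal
  have "((\<lambda>h. inverse h ^ Suc m / exp (inverse h)) \<longlongrightarrow> 0) (at_right (0::real))"
    by (rule filterlim_compose[OF tendsto_power_div_exp_0 filterlim_inverse_at_top_right])
  then have r: "((\<lambda>h. (flat m (0 + h) - flat m 0) / h) \<longlongrightarrow> 0) (at_right 0)"
  proof (rule Lim_transform_eventually)
    show "\<forall>\<^sub>F h in at_right 0. inverse h ^ Suc m / exp (inverse h) = (flat m (0 + h) - flat m 0) / h"
      by (rule eventually_mono[OF eventually_at_right_less])
         (simp add: flat_def exp_minus field_simps power_inverse)
  qed
  have l: "((\<lambda>h. (flat m (0 + h) - flat m 0) / h) \<longlongrightarrow> 0) (at_left 0)"
    by (rule Lim_transform_eventually[OF tendsto_const])
       (auto simp: eventually_at_filter flat_def)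
  have "flat (m + 2) t - real m * flat (m + 1) t = 0" using equal by (simp add: flat_def)
  with filterlim_split_at[OF l r] show ?thesis unfolding DERIV_def equal by simp
qed

lemma smooth_flat: "smooth (\<lambda>x :: real^'d::finite. of_real (flat m (c * (x $ j) + d)))"
proof -
  let ?B = "\<lambda>\<phi>. \<exists>m. \<phi> = (\<lambda>x :: real^'d. complex_of_real (flat m (c * (x $ j) + d)))"
  have der: "((\<lambda>x. complex_of_real (flat m (c * (x $ j) + d))) has_derivative
      (\<lambda>h. of_real ((c * (h $ j)) * (flat (m + 2) (c * (x $ j) + d) - real m * flat (m + 1) (c * (x $ j) + d))))) (at x)"
    for m and x :: "real^'d"
  proof (rule has_derivative_of_real)
    have 1: "((\<lambda>x :: real^'d. c * (x $ j) + d) has_derivative (\<lambda>h. c * (h $ j))) (at x)"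
      by (auto intro!: derivative_eq_intros bounded_linear.has_derivative[OF bounded_linear_vec_nth])
    from DERIV_compose_FDERIV[OF flat_has_derivative 1]
    show "((\<lambda>x. flat m (c * x $ j + d)) has_derivative
     (\<lambda>h. c * h $ j * (flat (m + 2) (c * x $ j + d) - real m * flat (m + 1) (c * x $ j + d)))) (at x)" .
  qed
  have d: "\<phi> differentiable at x" if "?B \<phi>" for \<phi> x
  proof -
    from that obtain m where eq: "\<phi> = (\<lambda>x. of_real (flat m (c * (x $ j) + d)))" by blast
    show ?thesis unfolding eq by (rule differentiableI[OF der])
  qed
  have p: "alg_closure ?B (partial_deriv i \<phi>)" if "?B \<phi>" for \<phi> i
  proof -
    from that obtain m where eq: "\<phi> = (\<lambda>x. of_real (flat m (c * (x $ j) + d)))" by blast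
    have g: "alg_closure ?B (\<lambda>x. of_real (flat n (c * (x $ j) + d)))" for n
      by (rule alg_closure.gen) blast
    have "partial_deriv i \<phi> = (\<lambda>x. of_real (c * axis i 1 $ j) *
       (of_real (flat (m + 2) (c * (x $ j) + d)) + of_real (- real m) * of_real (flat (m + 1) (c * (x $ j) + d))))"
      unfolding eq by (rule ext, subst partial_deriv_eqI[OF der]) simp
    then show ?thesis
      by (simp only:) (rule alg_closure.mult[OF alg_closure.const alg_closure.add[OF g alg_closure.mult[OF alg_closure.const g]]])
  qed
  have "alg_closure ?B (\<lambda>x. of_real (flat m (c * (x $ j) + d)))"
    by (rule alg_closure.gen) blast
  then show ?thesis
    by (rule alg_closure_smooth[where B="?B", rotated 2]) (erule d, erule p)
qed

lemma flat_0_bounds: "0 \<le> flat 0 t" "flat 0 t \<le> 1"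
  by (auto simp: flat_def)

lemma flat_0_tendsto: "t > 0 \<Longrightarrow> (\<lambda>n. flat 0 (real n * t - 1)) \<longlonglongrightarrow> 1"
proof -
  assume t: "t > 0"
  have lin: "filterlim (\<lambda>n. real n * t - 1) at_top sequentially"
    using t by real_asymp
  have "((\<lambda>y. flat 0 y) \<longlongrightarrow> 1) at_top"
  proof (rule Lim_transform_eventually)
    show "((\<lambda>y::real. exp (- 1 / y)) \<longlongrightarrow> 1) at_top" by real_asymp
    show "\<forall>\<^sub>F y in at_top. exp (- 1 / y) = flat 0 y"
      by (rule eventually_mono[OF eventually_gt_at_top[of 0]]) (simp add: flat_def)
  qed
  then show ?thesis using lin by (rule filterlim_compose)
qed

text \<open>A bump supported in the open box with corners \<open>a\<close> and \<open>b\<close>. The shift by \<open>-1\<close> keeps the support at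
distance \<open>1 / n\<close> from the boundary, and since \<open>e\<^sup>-\<^sup>1\<^sup>/\<^sup>t\<close> tends to \<open>1\<close> as \<open>t\<close> tends to infinity, the bumps converge
to the indicator function of the box as \<open>n\<close> grows.\<close>

definition bump :: "nat \<Rightarrow> real^'d::finite \<Rightarrow> real^'d \<Rightarrow> real^'d \<Rightarrow> real" where
  "bump n a b x = (\<Prod>j\<in>UNIV. flat 0 (real n * (x $ j - a $ j) - 1) * flat 0 (real n * (b $ j - x $ j) - 1))"

lemma bump_bounds: "0 \<le> bump n a b x" "bump n a b x \<le> 1"
  unfolding bump_def
  by (auto intro!: prod_nonneg prod_le_1 mult_nonneg_nonneg mult_le_one flat_0_bounds)

lemma smooth_bump: "smooth (\<lambda>x. of_real (bump n a b x))"
proof -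
  have "smooth (\<lambda>x. \<Prod>j\<in>UNIV. complex_of_real (flat 0 (real n * (x $ j) + (- real n * (a $ j) - 1))) *
      complex_of_real (flat 0 (- real n * (x $ j) + (real n * b $ j - 1))))"
    by (intro smooth_prod smooth_mult smooth_flat)
  also have "(\<lambda>x. \<Prod>j\<in>UNIV. complex_of_real (flat 0 (real n * (x $ j) + (- real n * (a $ j) - 1))) *
      complex_of_real (flat 0 (- real n * (x $ j) + (real n * b $ j - 1)))) = (\<lambda>x. of_real (bump n a b x))"
    by (simp add: bump_def algebra_simps)
  finally show ?thesis .
qed

lemma bump_support: "{x. bump n a b x \<noteq> 0} \<subseteq> cbox (a + (1 / real n) *\<^sub>R 1) (b - (1 / real n) *\<^sub>R 1)"
  and cbox_inner_subset: "n > 0 \<Longrightarrow> cbox (a + (1 / real n) *\<^sub>R 1) (b - (1 / real n) *\<^sub>R 1) \<subseteq> box a (b :: real^'d::finite)"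
proof -
  show "{x. bump n a b x \<noteq> 0} \<subseteq> cbox (a + (1 / real n) *\<^sub>R 1) (b - (1 / real n) *\<^sub>R 1)"
  proof safe
    fix x assume "bump n a b x \<noteq> 0"
    then have "flat 0 (real n * (x $ j - a $ j) - 1) \<noteq> 0" "flat 0 (real n * (b $ j - x $ j) - 1) \<noteq> 0" for j
      unfolding bump_def by auto
    moreover have "t > 1" if "flat 0 (t - 1) \<noteq> 0" for t
      using that by (auto simp: flat_def split: if_splits)
    ultimately have *: "real n * (x $ j - a $ j) > 1" "real n * (b $ j - x $ j) > 1" for j
      by blast+
    have "n > 0" using *(1) by (cases "n = 0") auto
    then have "a $ j + 1 / real n \<le> x $ j" "x $ j \<le> b $ j - 1 / real n" for j
      using *[of j] by (auto simp: field_simps)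
    then show "x \<in> cbox (a + (1 / real n) *\<^sub>R 1) (b - (1 / real n) *\<^sub>R 1)"
      by (simp add: mem_box_cart)
  qed
  assume "n > 0"
  then have "(1::real) / real n > 0" by simp
  then show "cbox (a + (1 / real n) *\<^sub>R 1) (b - (1 / real n) *\<^sub>R 1) \<subseteq> box a b"
    unfolding mem_box_cart subset_iff
  proof (intro allI impI)
    fix x i
    assume "\<forall>i. (a + (1 / real n) *\<^sub>R 1) $ i \<le> x $ i \<and> x $ i \<le> (b - (1 / real n) *\<^sub>R 1) $ i"
    then have "a $ i + 1 / real n \<le> x $ i" "x $ i \<le> b $ i - 1 / real n" by simp_all
    with \<open>(1::real) / real n > 0\<close> show "a $ i < x $ i \<and> x $ i < b $ i" by linarith
  qed
qed

lemma bump_tendsto: "x \<in> box a b \<Longrightarrow> (\<lambda>n. bump n a b x) \<longlonglongrightarrow> 1"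
proof -
  assume x: "x \<in> box a b"
  have "(\<lambda>n. \<Prod>j\<in>UNIV. flat 0 (real n * (x $ j - a $ j) - 1) * flat 0 (real n * (b $ j - x $ j) - 1)) \<longlonglongrightarrow> (\<Prod>j\<in>(UNIV::'a set). 1 * 1)"
    using x by (intro tendsto_prod tendsto_mult flat_0_tendsto) (auto simp: mem_box_cart)
  then show ?thesis unfolding bump_def by simp
qed

text \<open>An open set is a countable union of open boxes. One minus the product of one minus the bumps of the
first \<open>n\<close> boxes is smooth, has compact support in the set, and converges to its indicator function.\<close>

lemma open_indicator_limit:
  fixes W :: "(real^'d::finite) set"
  assumes "open W"
  obtains \<Phi> :: "nat \<Rightarrow> real^'d \<Rightarrow> real"
  where "\<And>n x. 0 \<le> \<Phi> n x" "\<And>n x. \<Phi> n x \<le> 1" "\<And>n. (\<lambda>x. complex_of_real (\<Phi> n x)) \<in> test_functions W"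
    "\<And>x. (\<lambda>n. \<Phi> n x) \<longlonglongrightarrow> indicator W x"
proof -
  obtain D where D: "countable D" "D \<subseteq> Pow W" "\<And>X. X \<in> D \<Longrightarrow> \<exists>a b. X = box a b" "\<Union>D = W"
    using open_countable_Union_open_box[OF assms] by blast
  obtain a b :: "nat \<Rightarrow> real^'d" where ab: "(\<Union>i. box (a i) (b i)) = W"
  proof -
    \<comment> \<open>the empty box makes the enumeration of the boxes total\<close>
    let ?E = "insert {} D"
    have "\<exists>a b. X = box a b" if "X \<in> ?E" for X
    proof (cases "X = {}")
      case True
      have "box (1 :: real^'d) 0 = {}" by (fastforce simp: mem_box_cart)
      then show ?thesis using True by metis
    qed (use that D(3) in auto)
    then have "\<forall>i. \<exists>p. from_nat_into ?E i = box (fst p) (snd p)"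
      using from_nat_into[of ?E] by (metis fst_conv insert_not_empty snd_conv)
    then obtain p where p: "\<And>i. from_nat_into ?E i = box (fst (p i)) (snd (p i))" by metis
    have "(\<Union>i. box (fst (p i)) (snd (p i))) = \<Union>(range (from_nat_into ?E))" by (simp add: p)
    also have "\<dots> = W" using D(1,4) by (simp add: range_from_nat_into)
    finally show ?thesis by (rule that)
  qed
  define \<Phi> where "\<Phi> n x = 1 - (\<Prod>i<n. 1 - bump n (a i) (b i) x)" for n x
  show ?thesis
  proof
    fix n x
    show "0 \<le> \<Phi> n x" "\<Phi> n x \<le> 1"
      using bump_bounds unfolding \<Phi>_def by (auto intro!: prod_le_1 prod_nonneg)
  next
    fix n
    let ?K = "\<Union>i<n. cbox (a i + (1 / real n) *\<^sub>R 1) (b i - (1 / real n) *\<^sub>R 1)"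
    have "smooth (\<lambda>x. 1 - (\<Prod>i<n. 1 - complex_of_real (bump n (a i) (b i) x)))"
      by (intro smooth_diff smooth_const smooth_prod smooth_bump)
    then have sm: "smooth (\<lambda>x. complex_of_real (\<Phi> n x))" by (simp add: \<Phi>_def)
    have "{x. \<Phi> n x \<noteq> 0} \<subseteq> ?K"
    proof safe
      fix x assume "\<Phi> n x \<noteq> 0"
      then have "\<exists>i<n. bump n (a i) (b i) x \<noteq> 0"
        unfolding \<Phi>_def by (metis (no_types, lifting) diff_zero cancel_comm_monoid_add_class.diff_cancel lessThan_iff prod.neutral)
      then show "x \<in> ?K" using bump_support by blast
    qed
    moreover have K: "compact ?K" by (intro compact_UN) auto
    ultimately have cl: "closure {x. \<Phi> n x \<noteq> 0} \<subseteq> ?K"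
      by (intro closure_minimal compact_imp_closed)
    have "?K \<subseteq> W"
    proof (rule UN_least)
      fix i assume "i \<in> {..<n}"
      then have "n > 0" by auto
      from cbox_inner_subset[OF this, of "a i" "b i"] ab
      show "cbox (a i + (1 / real n) *\<^sub>R 1) (b i - (1 / real n) *\<^sub>R 1) \<subseteq> W" by blast
    qed
    then have "closure {x. \<Phi> n x \<noteq> 0} \<subseteq> W" using cl by (rule order_trans[rotated])
    moreover have "compact (closure {x. \<Phi> n x \<noteq> 0})"
      using compact_Int_closed[OF K closed_closure[of "{x. \<Phi> n x \<noteq> 0}"]] unfolding Int_absorb1[OF cl] .
    ultimately show "(\<lambda>x. complex_of_real (\<Phi> n x)) \<in> test_functions W"
      using sm by (simp add: test_functions_def)
  next
    fix x
    show "(\<lambda>n. \<Phi> n x) \<longlonglongrightarrow> indicator W x"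
    proof (cases "x \<in> W")
      case True
      then obtain i where i: "x \<in> box (a i) (b i)" using ab by blast
      have lim: "(\<lambda>n. bump n (a i) (b i) x) \<longlonglongrightarrow> 1" by (rule bump_tendsto[OF i])
      have low: "\<forall>\<^sub>F n in sequentially. bump n (a i) (b i) x \<le> \<Phi> n x"
      proof (rule eventually_mono[OF eventually_gt_at_top[of i]])
        fix n assume "n > i"
        then have "(\<Prod>i<n. 1 - bump n (a i) (b i) x) = (1 - bump n (a i) (b i) x) * (\<Prod>i\<in>{..<n} - {i}. 1 - bump n (a i) (b i) x)"
          by (intro prod.remove) auto
        also have "\<dots> \<le> (1 - bump n (a i) (b i) x) * 1"
          using bump_bounds by (intro mult_left_mono prod_le_1) auto
        finally show "bump n (a i) (b i) x \<le> \<Phi> n x" by (simp add: \<Phi>_def)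
      qed
      have up: "\<Phi> n x \<le> 1" for n
        using bump_bounds unfolding \<Phi>_def by (auto intro!: prod_nonneg)
      have "(\<lambda>n. \<Phi> n x) \<longlonglongrightarrow> 1"
        by (rule tendsto_sandwich[OF low always_eventually[OF allI[OF up]] lim tendsto_const])
      then show ?thesis using True by simp
    next
      case False
      have "bump n (a i) (b i) x = 0" for n i
      proof (rule ccontr)
        assume *: "bump n (a i) (b i) x \<noteq> 0"
        then have "n > 0" by (cases "n = 0") (simp_all add: bump_def flat_def)
        moreover have "x \<in> cbox (a i + (1 / real n) *\<^sub>R 1) (b i - (1 / real n) *\<^sub>R 1)"
          using * bump_support[of n "a i" "b i"] by blast
        ultimately have "x \<in> box (a i) (b i)"
          using cbox_inner_subset[of n "a i" "b i"] by blast
        then show False using ab False by blast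
      qed
      then show ?thesis using False by (simp add: \<Phi>_def)
    qed
  qed
qed

text \<open>The fundamental lemma of the calculus of variations. Approximating indicators of open sets by test
functions shows that the integral of \<open>g\<close> over every open subset of \<open>U\<close> vanishes; the sets with this
property form a Dynkin system, so it holds for all Borel sets.\<close>

lemma AE_eq_zero_if_orthogonal_to_test_functions:
  fixes g :: "real^'d::finite \<Rightarrow> complex"
  assumes g: "integrable lborel g" and U: "open U"
    and orth: "\<And>\<phi>. \<phi> \<in> test_functions U \<Longrightarrow> (\<integral>x. g x * \<phi> x \<partial>lborel) = 0"
  shows "AE x in lborel. x \<in> U \<longrightarrow> g x = 0"
proof -
  note [measurable] = borel_measurable_integrable[OF g] borel_open[OF U]
  let ?g = "\<lambda>x. indicator U x *\<^sub>R g x"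
  have gi: "integrable lborel ?g" using g by (intro integrable_mult_indicator) auto
  have gA: "integrable lborel (\<lambda>x. indicator A x *\<^sub>R ?g x)" if "A \<in> sets borel" for A
    using that by (intro integrable_mult_indicator[OF _ gi]) simp
  have op: "(\<integral>x. indicator A x *\<^sub>R ?g x \<partial>lborel) = 0" if A: "open A" for A
  proof -
    have "open (A \<inter> U)" using A U by blast
    then obtain \<Phi> :: "nat \<Rightarrow> real^'d \<Rightarrow> real"
      where \<Phi>: "\<And>n x. 0 \<le> \<Phi> n x" "\<And>n x. \<Phi> n x \<le> 1" "\<And>n. (\<lambda>x. complex_of_real (\<Phi> n x)) \<in> test_functions (A \<inter> U)"
        "\<And>x. (\<lambda>n. \<Phi> n x) \<longlonglongrightarrow> indicator (A \<inter> U) x"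
      by (rule open_indicator_limit) blast
    have [measurable]: "(\<lambda>x. complex_of_real (\<Phi> n x)) \<in> borel_measurable borel" for n
      using \<Phi>(3)[of n] by (auto simp: test_functions_def intro!: borel_measurable_continuous_onI smooth_continuous)
    have [measurable]: "A \<in> sets borel" using A by simp
    have "(\<lambda>n. \<integral>x. g x * of_real (\<Phi> n x) \<partial>lborel) \<longlonglongrightarrow> (\<integral>x. g x * of_real (indicator (A \<inter> U) x) \<partial>lborel)"
    proof (rule integral_dominated_convergence[where w="\<lambda>x. norm (g x)"])
      show "AE x in lborel. (\<lambda>n. g x * complex_of_real (\<Phi> n x)) \<longlonglongrightarrow> g x * complex_of_real (indicat_real (A \<inter> U) x)"
        using \<Phi>(4) by (intro AE_I2 tendsto_mult tendsto_const tendsto_of_real)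
      show "AE x in lborel. norm (g x * complex_of_real (\<Phi> n x)) \<le> norm (g x)" for n
        using \<Phi>(1,2)[of n] by (intro AE_I2) (simp add: norm_mult mult_left_le)
    qed (use g in auto)
    moreover have "(\<integral>x. g x * of_real (\<Phi> n x) \<partial>lborel) = 0" for n
      using \<Phi>(3)[of n] by (intro orth) (auto simp: test_functions_def)
    ultimately have "(\<integral>x. g x * of_real (indicator (A \<inter> U) x) \<partial>lborel) = 0"
      by (simp add: LIMSEQ_const_iff)
    also have "(\<lambda>x. g x * of_real (indicator (A \<inter> U) x)) = (\<lambda>x. indicator A x *\<^sub>R ?g x)"
      by (auto simp: fun_eq_iff indicator_def)
    finally show ?thesis .
  qed
  have all: "(\<integral>x. indicator A x *\<^sub>R ?g x \<partial>lborel) = 0" if "A \<in> sets borel" for A :: "(real^'d) set"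
  proof -
    have "Int_stable {S :: (real^'d) set. open S}" by (auto simp: Int_stable_def)
    moreover have "{S :: (real^'d) set. open S} \<subseteq> Pow UNIV" by simp
    moreover have "A \<in> sigma_sets UNIV {S. open S}" using that by (simp add: borel_def)
    ultimately show ?thesis
    proof (induction rule: sigma_sets_induct_disjoint[consumes 3, case_names basic empty compl union])
      case (compl A)
      then have A: "A \<in> sets borel" by (simp add: borel_def)
      have "(\<lambda>x. indicator (UNIV - A) x *\<^sub>R ?g x) = (\<lambda>x. indicator UNIV x *\<^sub>R ?g x - indicator A x *\<^sub>R ?g x)"
        by (auto simp: indicator_def)
      then show ?case
        using compl op[of UNIV] gA[OF A] gA[of UNIV] by simp
    next
      case (union A)
      then have A: "A i \<in> sets borel" for i using union(2) by (auto simp: borel_def)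
      have "(\<integral>x\<in>(\<Union>i. A i). ?g x \<partial>lborel) = (\<Sum>i. (\<integral>x\<in>(A i). ?g x \<partial>lborel))"
        using union(1) A gA[of "\<Union>i. A i"] by (intro lebesgue_integral_countable_add) (auto simp: disjoint_family_on_def set_integrable_def)
      then show ?case using union(3) by (simp add: set_lebesgue_integral_def)
    qed (use op in auto)
  qed
  have "AE x in lborel. ?g x = 0"
    by (rule sigma_finite_measure.density_zero[OF sigma_finite_lborel gi]) (use all in \<open>auto simp: set_lebesgue_integral_def\<close>)
  then show ?thesis by eventually_elim (auto simp: indicator_def)
qed

section \<open>Borel representatives on open sets\<close>

lemma open_sets_lebesgue: "open \<Omega> \<Longrightarrow> \<Omega> \<inter> space lebesgue \<in> sets lebesgue"
  by (simp add: lmeasurable_open borel_open sets_completionI_sets)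

text \<open>For Borel measurable representatives that vanish outside \<open>\<Omega>\<close>, translations and Fubini's theorem are
available on the whole space; the next lemmas mediate between them and Lebesgue measure on \<open>\<Omega>\<close>.\<close>

lemma lebesgue_on_eq_lborel:
  fixes F :: "'a::euclidean_space \<Rightarrow> 'b::{banach, second_countable_topology}"
  assumes "open \<Omega>" "F \<in> borel_measurable borel" "\<And>x. x \<notin> \<Omega> \<Longrightarrow> F x = 0"
  shows "integrable (lebesgue_on \<Omega>) F \<longleftrightarrow> integrable lborel F"
    and "integral\<^sup>L (lebesgue_on \<Omega>) F = integral\<^sup>L lborel F"
proof -
  have F: "(\<lambda>x. indicator \<Omega> x *\<^sub>R F x) = F"
    using assms(3) by (auto simp: fun_eq_iff indicator_def)
  show "integrable (lebesgue_on \<Omega>) F \<longleftrightarrow> integrable lborel F"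
    using assms(2) by (simp add: integrable_restrict_space[OF open_sets_lebesgue[OF assms(1)]] F integrable_completion)
  show "integral\<^sup>L (lebesgue_on \<Omega>) F = integral\<^sup>L lborel F"
    using assms(2) by (simp add: integral_restrict_space[OF open_sets_lebesgue[OF assms(1)]] F integral_completion)
qed

lemma AE_lebesgue_on:
  "open \<Omega> \<Longrightarrow> (AE x in lebesgue_on \<Omega>. P x) \<longleftrightarrow> (AE x in lborel. x \<in> \<Omega> \<longrightarrow> P x)"
  by (simp add: AE_restrict_space_iff[OF open_sets_lebesgue] AE_completion_iff)

lemma borel_representative:
  fixes u :: "'a::euclidean_space \<Rightarrow> complex"
  assumes "open \<Omega>" "u \<in> borel_measurable (lebesgue_on \<Omega>)"
  shows "\<exists>v. v \<in> borel_measurable borel \<and> (\<forall>x. x \<notin> \<Omega> \<longrightarrow> v x = 0) \<and> (AE x in lborel. x \<in> \<Omega> \<longrightarrow> u x = v x)"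
proof -
  have "(\<lambda>x. indicator \<Omega> x *\<^sub>R u x) \<in> borel_measurable lebesgue"
    using assms(2) by (simp add: borel_measurable_restrict_space_iff[OF open_sets_lebesgue[OF assms(1)]])
  then have "(\<lambda>x. Re (indicator \<Omega> x *\<^sub>R u x)) \<in> borel_measurable lebesgue" "(\<lambda>x. Im (indicator \<Omega> x *\<^sub>R u x)) \<in> borel_measurable lebesgue"
    by (rule measurable_compose, measurable)+
  from this[THEN completion_ex_borel_measurable_real]
  obtain r i where [measurable]: "r \<in> borel_measurable borel" "i \<in> borel_measurable borel"
    and r: "AE x in lborel. Re (indicator \<Omega> x *\<^sub>R u x) = r x" and i: "AE x in lborel. Im (indicator \<Omega> x *\<^sub>R u x) = i x"
    by auto
  have [measurable]: "\<Omega> \<in> sets borel" using assms(1) by simp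
  let ?v = "\<lambda>x. indicator \<Omega> x *\<^sub>R (of_real (r x) + \<i> * of_real (i x))"
  show ?thesis
  proof (intro exI[of _ ?v] conjI allI impI)
    show "?v \<in> borel_measurable borel" by measurable
    show "AE x in lborel. x \<in> \<Omega> \<longrightarrow> u x = ?v x"
      using r i by eventually_elim (auto simp: complex_eq_iff indicator_def)
  qed simp
qed

lemma AE_eq_measurable:
  fixes u v :: "'a::euclidean_space \<Rightarrow> complex"
  assumes "open \<Omega>" "u \<in> borel_measurable (lebesgue_on \<Omega>)" "AE x in lebesgue_on \<Omega>. u x = v x"
  shows "v \<in> borel_measurable (lebesgue_on \<Omega>)"
proof -
  have "(\<lambda>x. indicator \<Omega> x *\<^sub>R u x) \<in> borel_measurable lebesgue"
    using assms(2) by (simp add: borel_measurable_restrict_space_iff[OF open_sets_lebesgue[OF assms(1)]])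
  moreover have "AE x in lebesgue. indicator \<Omega> x *\<^sub>R u x = indicator \<Omega> x *\<^sub>R v x"
    using assms(3) unfolding AE_restrict_space_iff[OF open_sets_lebesgue[OF assms(1)]]
    by eventually_elim (auto simp: indicator_def)
  ultimately have "(\<lambda>x. indicator \<Omega> x *\<^sub>R v x) \<in> borel_measurable lebesgue"
    by (rule borel_measurable_AE)
  then show ?thesis by (simp add: borel_measurable_restrict_space_iff[OF open_sets_lebesgue[OF assms(1)]])
qed

section \<open>Test functions\<close>

lemma test_functionsD:
  assumes "\<phi> \<in> test_functions \<Omega>"
  shows "smooth \<phi>" "compact (closure {x. \<phi> x \<noteq> 0})" "closure {x. \<phi> x \<noteq> 0} \<subseteq> \<Omega>"
  using assms by (auto simp: test_functions_def)

lemma test_functions_mono: "\<Omega> \<subseteq> \<Omega>' \<Longrightarrow> test_functions \<Omega> \<subseteq> test_functions \<Omega>'"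
  by (auto simp: test_functions_def)

lemma test_functions_support:
  assumes "smooth \<phi>" "compact K" "K \<subseteq> \<Omega>" "{x. \<phi> x \<noteq> 0} \<subseteq> K"
  shows "\<phi> \<in> test_functions \<Omega>"
proof -
  have cl: "closure {x. \<phi> x \<noteq> 0} \<subseteq> K" by (rule closure_minimal[OF assms(4) compact_imp_closed[OF assms(2)]])
  have "compact (closure {x. \<phi> x \<noteq> 0})"
    using compact_Int_closed[OF assms(2) closed_closure[of "{x. \<phi> x \<noteq> 0}"]] unfolding Int_absorb1[OF cl] .
  then show ?thesis using assms(1) order_trans[OF cl assms(3)] by (simp add: test_functions_def)
qed

lemma test_functions_mult:
  assumes "smooth \<psi>" "\<phi> \<in> test_functions \<Omega>"
  shows "(\<lambda>x. \<psi> x * \<phi> x) \<in> test_functions \<Omega>"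
  by (rule test_functions_support[OF smooth_mult[OF assms(1) test_functionsD(1)[OF assms(2)]] test_functionsD(2,3)[OF assms(2)]])
     (use closure_subset[of "{x. \<phi> x \<noteq> 0}"] in auto)

lemma test_functions_partial_deriv:
  assumes "\<phi> \<in> test_functions \<Omega>"
  shows "partial_deriv j \<phi> \<in> test_functions \<Omega>"
proof (rule test_functions_support[OF smooth_partial_deriv[OF test_functionsD(1)[OF assms]] test_functionsD(2,3)[OF assms]], safe)
  fix x assume ne: "partial_deriv j \<phi> x \<noteq> 0"
  show "x \<in> closure {x. \<phi> x \<noteq> 0}"
  proof (rule ccontr)
    assume x: "x \<notin> closure {x. \<phi> x \<noteq> 0}"
    have "((\<lambda>x. 0) has_derivative (\<lambda>h. 0)) (at x)" by simp
    then have "(\<phi> has_derivative (\<lambda>h. 0)) (at x)"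
      by (rule has_derivative_transform_within_open[of _ _ _ _ "- closure {x. \<phi> x \<noteq> 0}"])
         (use x closure_subset[of "{x. \<phi> x \<noteq> 0}"] in auto)
    from partial_deriv_eqI[OF this] ne show False by simp
  qed
qed

lemma test_functions_multi_deriv:
  assumes "\<phi> \<in> test_functions \<Omega>" shows "multi_deriv \<alpha> \<phi> \<in> test_functions \<Omega>"
proof -
  have "foldr partial_deriv js \<phi> \<in> test_functions \<Omega>" for js
    using assms by (induction js) (auto intro: test_functions_partial_deriv)
  then show ?thesis by (simp add: multi_deriv_eq_foldr)
qed

text \<open>The support of the mean of \<open>\<phi>\<close> over backward segments is swept out by translating the support of \<open>\<phi>\<close>
along \<open>w\<close>, which stays compact.\<close>

lemma test_functions_segment_mean:
  assumes "\<phi> \<in> test_functions U" "\<And>x s. x \<in> U \<Longrightarrow> 0 \<le> s \<Longrightarrow> s \<le> 1 \<Longrightarrow> x + s *\<^sub>R w \<in> \<Omega>"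
  shows "segment_mean (- w) \<phi> \<in> test_functions \<Omega>"
proof -
  let ?S = "closure {x. \<phi> x \<noteq> 0}"
  let ?K = "(\<lambda>(x, s). x + s *\<^sub>R w) ` (?S \<times> {0..1::real})"
  note \<phi> = test_functionsD[OF assms(1)]
  show ?thesis
  proof (rule test_functions_support[OF smooth_segment_mean[OF \<phi>(1)]])
    show "compact ?K"
      by (intro compact_continuous_image compact_Times \<phi>(2)) (auto simp: case_prod_unfold intro!: continuous_intros)
    show "?K \<subseteq> \<Omega>" using \<phi>(3) assms(2) by auto
    show "{x. segment_mean (- w) \<phi> x \<noteq> 0} \<subseteq> ?K"
    proof (rule ccontr)
      assume "\<not> {x. segment_mean (- w) \<phi> x \<noteq> 0} \<subseteq> ?K"
      then obtain x where x: "segment_mean (- w) \<phi> x \<noteq> 0" "x \<notin> ?K" by blast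
      have "\<phi> (x + s *\<^sub>R (- w)) = 0" if "s \<in> {0..1}" for s
      proof (rule ccontr)
        assume "\<phi> (x + s *\<^sub>R (- w)) \<noteq> 0"
        then have "x + s *\<^sub>R (- w) \<in> ?S" using closure_subset[of "{x. \<phi> x \<noteq> 0}"] by blast
        then have "(\<lambda>(x, s). x + s *\<^sub>R w) (x + s *\<^sub>R (- w), s) \<in> ?K" using that by (intro imageI) auto
        then show False using x(2) by simp
      qed
      then have "segment_mean (- w) \<phi> x = integral {0..1} (\<lambda>s::real. 0)"
        unfolding segment_mean_def by (intro integral_cong)
      then show False using x(1) by simp
    qed
  qed
qed

lemma test_functions_bounded:
  assumes "\<phi> \<in> test_functions \<Omega>"
  obtains M where "M \<ge> 0" "\<And>x. cmod (\<phi> x) \<le> M"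
proof -
  have "compact (\<phi> ` closure {x. \<phi> x \<noteq> 0})"
    by (intro compact_continuous_image smooth_continuous test_functionsD[OF assms])
  then have "bounded (\<phi> ` closure {x. \<phi> x \<noteq> 0})" by (rule compact_imp_bounded)
  then obtain M where M: "\<And>x. x \<in> closure {x. \<phi> x \<noteq> 0} \<Longrightarrow> cmod (\<phi> x) \<le> M"
    unfolding bounded_iff by blast
  show ?thesis
  proof
    show "cmod (\<phi> x) \<le> max M 0" for x
    proof (cases "\<phi> x = 0")
      case False
      then show ?thesis using M[of x] closure_subset[of "{x. \<phi> x \<noteq> 0}"] by (simp add: subset_iff max.coboundedI1)
    qed simp
  qed simp
qed

lemma test_functions_borel: "\<phi> \<in> test_functions \<Omega> \<Longrightarrow> \<phi> \<in> borel_measurable borel"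
  by (intro borel_measurable_continuous_onI smooth_continuous test_functionsD)

lemma test_functions_integrable:
  assumes "\<phi> \<in> test_functions \<Omega>" shows "integrable lborel \<phi>"
proof -
  let ?S = "closure {x. \<phi> x \<noteq> 0}"
  have "integrable lborel (\<lambda>x. indicator ?S x *\<^sub>R \<phi> x)"
    by (intro borel_integrable_compact test_functionsD[OF assms] smooth_continuous)
  also have "(\<lambda>x. indicator ?S x *\<^sub>R \<phi> x) = \<phi>"
    using closure_subset[of "{x. \<phi> x \<noteq> 0}"] by (auto simp: fun_eq_iff indicator_def)
  finally show ?thesis .
qed

section \<open>Segment means of integrable functions\<close>

text \<open>The same mean as \<open>segment_mean\<close>, as a Lebesgue integral, so that it can be formed for functions that
are merely integrable.\<close>

definition segment_mean_lborel :: "real^'d::finite \<Rightarrow> (real^'d \<Rightarrow> complex) \<Rightarrow> real^'d \<Rightarrow> complex" where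
  "segment_mean_lborel w g x = (\<integral>s. indicator {0..1} s *\<^sub>R g (x + s *\<^sub>R w) \<partial>lborel)"

lemma segment_mean_eq_lborel: "smooth \<phi> \<Longrightarrow> segment_mean w \<phi> x = segment_mean_lborel w \<phi> x"
proof -
  assume "smooth \<phi>"
  then have "set_integrable lborel {0..1} (\<lambda>s. \<phi> (x + s *\<^sub>R w))"
    unfolding set_integrable_def
    by (intro borel_integrable_compact continuous_on_compose2[OF smooth_continuous[of \<phi> UNIV]] continuous_intros) auto
  from set_borel_integral_eq_integral(2)[OF this] show ?thesis
    by (simp add: segment_mean_def segment_mean_lborel_def set_lebesgue_integral_def)
qed

lemma lborel_integral_translate:
  fixes F :: "'a::euclidean_space \<Rightarrow> 'b::{banach, second_countable_topology}"
  assumes "F \<in> borel_measurable borel"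
  shows "(\<integral>x. F (x + c) \<partial>lborel) = (\<integral>x. F x \<partial>lborel)"
    and "integrable lborel (\<lambda>x. F (x + c)) \<longleftrightarrow> integrable lborel F"
  using integral_distr[of "(+) c" lborel borel F] integrable_distr_eq[of "(+) c" lborel borel F] assms
  by (simp_all add: lborel_distr_plus add.commute)

text \<open>Segment means are formally self-adjoint up to reversing the direction: exchange the integrals and
translate the inner one.\<close>

lemma integral_segment_mean_lborel:
  fixes g \<phi> :: "real^'d::finite \<Rightarrow> complex"
  assumes g: "integrable lborel g" "g \<in> borel_measurable borel" and \<phi>: "continuous_on UNIV \<phi>" "\<And>x. cmod (\<phi> x) \<le> M"
  shows "(\<integral>x. g x * segment_mean_lborel (- w) \<phi> x \<partial>lborel) = (\<integral>x. segment_mean_lborel w g x * \<phi> x \<partial>lborel)"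
    and "integrable lborel (\<lambda>x. segment_mean_lborel w g x * \<phi> x)"
proof -
  have [measurable]: "\<phi> \<in> borel_measurable borel" by (rule borel_measurable_continuous_onI[OF \<phi>(1)])
  note [measurable] = g(2)
  have M: "M \<ge> 0" using \<phi>(2)[of 0] norm_ge_zero order_trans by blast
  let ?F = "\<lambda>x s. indicator {0..1::real} s *\<^sub>R (g x * \<phi> (x + s *\<^sub>R (- w)))"
  let ?G = "\<lambda>x s. indicator {0..1::real} s *\<^sub>R (g (x + s *\<^sub>R w) * \<phi> x)"
  have tr: "?G x s = (\<lambda>x. ?F x s) (x + s *\<^sub>R w)" for x s by simp
  have 01: "integrable lborel (\<lambda>s. indicator {0..1::real} s *\<^sub>R (c::real))" for c
    by (simp add: integrable_mult_left)
  have Fx: "integrable lborel (\<lambda>x. ?F x s)" for s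
    by (rule Bochner_Integration.integrable_bound[OF integrable_mult_left[OF integrable_norm[OF g(1)], of M]])
       (use \<phi>(2) M in \<open>auto simp: norm_mult indicator_def intro!: mult_mono\<close>)
  have meas1[measurable]: "case_prod ?F \<in> borel_measurable (lborel \<Otimes>\<^sub>M lborel)" by measurable
  have meas2[measurable]: "case_prod ?G \<in> borel_measurable (lborel \<Otimes>\<^sub>M lborel)" by measurable
  have ms: "(\<lambda>s. \<integral>x. norm (?F x s) \<partial>lborel) \<in> borel_measurable lborel" by measurable
  have eqn: "(\<integral>x. norm (?G x s) \<partial>lborel) = (\<integral>x. norm (?F x s) \<partial>lborel)" for s
    unfolding tr by (rule lborel_integral_translate(1)[of "\<lambda>x. norm (?F x s)"]) measurable
  have bnd: "(\<integral>x. norm (?F x s) \<partial>lborel) \<le> indicator {0..1::real} s *\<^sub>R (\<integral>x. norm (g x) * M \<partial>lborel)" for s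
  proof -
    have "(\<integral>x. norm (?F x s) \<partial>lborel) \<le> (\<integral>x. indicator {0..1::real} s *\<^sub>R (norm (g x) * M) \<partial>lborel)"
      by (rule integral_mono[OF integrable_norm[OF Fx]])
         (use \<phi>(2) g(1) in \<open>auto simp: norm_mult indicator_def intro!: mult_mono\<close>)
    then show ?thesis by simp
  qed
  have Fs: "integrable lborel (\<lambda>s. \<integral>x. norm (?F x s) \<partial>lborel)"
  proof (rule Bochner_Integration.integrable_bound[OF 01[of "\<integral>x. norm (g x) * M \<partial>lborel"] ms], rule AE_I2)
    fix s
    have "0 \<le> (\<integral>x. norm (?F x s) \<partial>lborel)" by (rule Bochner_Integration.integral_nonneg) simp
    then have "norm (\<integral>x. norm (?F x s) \<partial>lborel) = (\<integral>x. norm (?F x s) \<partial>lborel)" by (simp only: real_norm_def abs_of_nonneg)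
    also note bnd[of s]
    also have "indicator {0..1::real} s *\<^sub>R (\<integral>x. norm (g x) * M \<partial>lborel) \<le> norm (indicator {0..1::real} s *\<^sub>R (\<integral>x. norm (g x) * M \<partial>lborel))"
      unfolding real_norm_def by (rule abs_ge_self)
    finally show "norm (\<integral>x. norm (?F x s) \<partial>lborel) \<le> norm (indicator {0..1::real} s *\<^sub>R (\<integral>x. norm (g x) * M \<partial>lborel))" .
  qed
  have Fi: "integrable (lborel \<Otimes>\<^sub>M lborel) (\<lambda>(s, x). ?F x s)"
    by (rule lborel_pair.Fubini_integrable) (use Fs Fx in auto)
  have Gi: "integrable (lborel \<Otimes>\<^sub>M lborel) (\<lambda>(s, x). ?G x s)"
  proof (rule lborel_pair.Fubini_integrable)
    show "integrable lborel (\<lambda>s. \<integral>x. norm (case (s, x) of (s, x) \<Rightarrow> ?G x s) \<partial>lborel)"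
      using Fs unfolding eqn[symmetric] by (simp only: prod.case)
    show "AE s in lborel. integrable lborel (\<lambda>x. case (s, x) of (s, x) \<Rightarrow> ?G x s)"
    proof (rule AE_I2)
      fix s
      have "integrable lborel (\<lambda>x. (\<lambda>x. ?F x s) (x + s *\<^sub>R w))"
        using Fx by (subst lborel_integral_translate(2)) measurable
      then show "integrable lborel (\<lambda>x. case (s, x) of (s, x) \<Rightarrow> ?G x s)"
        unfolding tr[symmetric] by (simp only: prod.case)
    qed
  qed measurable
  have "(\<integral>x. g x * segment_mean_lborel (- w) \<phi> x \<partial>lborel) = (\<integral>x. \<integral>s. ?F x s \<partial>lborel \<partial>lborel)"
    unfolding segment_mean_lborel_def by (subst integral_mult_right_zero[symmetric]) (simp add: mult_ac)
  also have "\<dots> = (\<integral>s. \<integral>x. ?F x s \<partial>lborel \<partial>lborel)"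
    using lborel_pair.Fubini_integral[OF Fi] by (simp only: prod.case)
  also have "\<dots> = (\<integral>s. \<integral>x. ?G x s \<partial>lborel \<partial>lborel)"
    unfolding tr by (subst lborel_integral_translate(1)) simp_all
  also have "\<dots> = (\<integral>x. \<integral>s. ?G x s \<partial>lborel \<partial>lborel)"
    using lborel_pair.Fubini_integral[OF Gi] by (simp only: prod.case)
  also have "\<dots> = (\<integral>x. segment_mean_lborel w g x * \<phi> x \<partial>lborel)"
    unfolding segment_mean_lborel_def by (subst integral_mult_left_zero[symmetric]) simp
  finally show "(\<integral>x. g x * segment_mean_lborel (- w) \<phi> x \<partial>lborel) = (\<integral>x. segment_mean_lborel w g x * \<phi> x \<partial>lborel)" .
  have "integrable lborel (\<lambda>x. \<integral>s. ?G x s \<partial>lborel)"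
    using lborel_pair.integrable_snd[OF Gi] by simp
  then show "integrable lborel (\<lambda>x. segment_mean_lborel w g x * \<phi> x)"
    unfolding segment_mean_lborel_def by (subst integral_mult_left_zero[symmetric]) simp
qed

text \<open>The segment mean of \<open>\<partial>\<^sub>j\<phi>\<close> in direction \<open>e\<^sub>j\<close> has the same integral as \<open>\<partial>\<^sub>j\<phi>\<close> and equals
\<open>\<phi>(x + e\<^sub>j) - \<phi>(x)\<close>, whose integral is zero by translation invariance.\<close>

lemma integral_partial_deriv_zero:
  assumes "\<phi> \<in> test_functions \<Omega>"
  shows "(\<integral>x. partial_deriv j \<phi> x \<partial>lborel) = 0"
proof -
  note \<phi> = test_functionsD[OF assms]
  note d = test_functions_partial_deriv[OF assms, of j]
  let ?e = "axis j 1 :: real^'a"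
  have "(\<integral>x. partial_deriv j \<phi> x \<partial>lborel) = (\<integral>x. partial_deriv j \<phi> x * segment_mean_lborel (- ?e) (\<lambda>_. 1) x \<partial>lborel)"
    by (simp add: segment_mean_lborel_def)
  also have "\<dots> = (\<integral>x. segment_mean_lborel ?e (partial_deriv j \<phi>) x * 1 \<partial>lborel)"
    by (rule integral_segment_mean_lborel(1)[OF test_functions_integrable[OF d] test_functions_borel[OF d], of _ 1]) auto
  also have "\<dots> = (\<integral>x. \<phi> (x + ?e) - \<phi> x \<partial>lborel)"
  proof -
    have "dir_deriv ?e \<phi> = partial_deriv j \<phi>"
      using dir_deriv_axis[of 1 j \<phi>] by (intro ext) simp
    then have "\<phi> (x + ?e) - \<phi> x = segment_mean_lborel ?e (partial_deriv j \<phi>) x" for x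
      using diff_eq_segment_mean[OF \<phi>(1), of x ?e] segment_mean_eq_lborel[OF test_functionsD(1)[OF d]] by simp
    then show ?thesis by (simp only: mult_1_right)
  qed
  also have "\<dots> = 0"
    using test_functions_integrable[OF assms]
    by (subst Bochner_Integration.integral_diff) (auto simp: lborel_integral_translate test_functions_borel[OF assms])
  finally show ?thesis .
qed

section \<open>Weak derivatives\<close>

text \<open>The integrand lives on the compact support of \<open>\<phi>\<close>.\<close>

lemma locally_integrable_times_test:
  fixes w :: "real^'d::finite \<Rightarrow> complex"
  assumes \<Omega>: "open \<Omega>" and w: "locally_integrable_on \<Omega> w" and \<phi>: "\<phi> \<in> test_functions \<Omega>"
  shows "integrable lebesgue (\<lambda>x. w x * \<phi> x)"
    and "integrable (lebesgue_on \<Omega>) (\<lambda>x. w x * \<phi> x)"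
    and "(\<integral>x. w x * \<phi> x \<partial>lebesgue_on \<Omega>) = (\<integral>x. w x * \<phi> x \<partial>lebesgue)"
proof -
  let ?S = "closure {x. \<phi> x \<noteq> 0}"
  note S = test_functionsD[OF \<phi>]
  have sub: "x \<in> ?S" if "\<phi> x \<noteq> 0" for x using that closure_subset[of "{x. \<phi> x \<noteq> 0}"] by blast
  obtain M where M: "M \<ge> 0" "\<And>x. cmod (\<phi> x) \<le> M" using test_functions_bounded[OF \<phi>] by blast
  have "integrable (lebesgue_on ?S) w" using w S by (simp add: locally_integrable_on_def)
  then have i: "integrable lebesgue (\<lambda>x. indicator ?S x *\<^sub>R w x)"
    by (subst (asm) integrable_restrict_space) simp_all
  have [measurable]: "\<phi> \<in> borel_measurable lebesgue"
    by (rule measurable_completion) (simp add: test_functions_borel[OF \<phi>])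
  note [measurable] = borel_measurable_integrable[OF i]
  have "integrable lebesgue (\<lambda>x. (indicator ?S x *\<^sub>R w x) * \<phi> x)"
  proof (rule Bochner_Integration.integrable_bound[OF integrable_mult_left[OF integrable_norm[OF i], of M]])
    show "(\<lambda>x. (indicator ?S x *\<^sub>R w x) * \<phi> x) \<in> borel_measurable lebesgue" by measurable
    show "AE x in lebesgue. norm ((indicator ?S x *\<^sub>R w x) * \<phi> x) \<le> norm (norm (indicator ?S x *\<^sub>R w x) * M)"
    proof (rule AE_I2)
      fix x
      have "norm (indicator ?S x *\<^sub>R w x) * norm (\<phi> x) \<le> norm (indicator ?S x *\<^sub>R w x) * M"
        by (rule mult_left_mono[OF M(2) norm_ge_zero])
      then show "norm ((indicator ?S x *\<^sub>R w x) * \<phi> x) \<le> norm (norm (indicator ?S x *\<^sub>R w x) * M)"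
        using M(1) by (simp add: norm_mult)
    qed
  qed
  also have "(\<lambda>x. (indicator ?S x *\<^sub>R w x) * \<phi> x) = (\<lambda>x. w x * \<phi> x)"
    using sub by (fastforce simp: fun_eq_iff indicator_def)
  finally show *: "integrable lebesgue (\<lambda>x. w x * \<phi> x)" .
  have eq: "(\<lambda>x. indicator \<Omega> x *\<^sub>R (w x * \<phi> x)) = (\<lambda>x. w x * \<phi> x)"
    using sub S(3) by (fastforce simp: fun_eq_iff indicator_def)
  show "integrable (lebesgue_on \<Omega>) (\<lambda>x. w x * \<phi> x)"
    unfolding integrable_restrict_space[OF open_sets_lebesgue[OF \<Omega>]] eq by (rule *)
  show "(\<integral>x. w x * \<phi> x \<partial>lebesgue_on \<Omega>) = (\<integral>x. w x * \<phi> x \<partial>lebesgue)"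
    unfolding integral_restrict_space[OF open_sets_lebesgue[OF \<Omega>]] eq ..
qed

lemma locally_integrable_add:
  "locally_integrable_on \<Omega> u \<Longrightarrow> locally_integrable_on \<Omega> v \<Longrightarrow> locally_integrable_on \<Omega> (\<lambda>x. u x + v x)"
  and locally_integrable_diff:
  "locally_integrable_on \<Omega> u \<Longrightarrow> locally_integrable_on \<Omega> v \<Longrightarrow> locally_integrable_on \<Omega> (\<lambda>x. u x - v x)"
  and locally_integrable_cmult:
  "locally_integrable_on \<Omega> u \<Longrightarrow> locally_integrable_on \<Omega> (\<lambda>x. c * u x)"
  by (auto simp: locally_integrable_on_def)

lemma smooth_locally_integrable: "smooth q \<Longrightarrow> locally_integrable_on \<Omega> q"
  unfolding locally_integrable_on_def
proof safe
  fix K :: "(real^'a) set" assume q: "smooth q" and K: "compact K"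
  have Kl: "K \<inter> space lebesgue \<in> sets lebesgue" using K by (simp add: borel_compact sets_completionI_sets)
  have i: "integrable lborel (\<lambda>x. indicator K x *\<^sub>R q x)"
    by (rule borel_integrable_compact[OF K smooth_continuous[OF q]])
  then have "integrable lebesgue (\<lambda>x. indicator K x *\<^sub>R q x)"
    using integrable_completion[OF borel_measurable_integrable[OF i]] by simp
  then show "integrable (lebesgue_on K) q" unfolding integrable_restrict_space[OF Kl] .
qed

text \<open>The fundamental lemma again, now for locally integrable functions: it is applied on the interiors of
countably many boxes that exhaust \<open>\<Omega>\<close>, the boundaries of the boxes being null sets.\<close>

lemma weakly_zero_imp_AE_zero:
  fixes w :: "real^'d::finite \<Rightarrow> complex"
  assumes \<Omega>: "open \<Omega>" and w: "locally_integrable_on \<Omega> w"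
    and orth: "\<And>\<phi>. \<phi> \<in> test_functions \<Omega> \<Longrightarrow> (\<integral>x. w x * \<phi> x \<partial>lebesgue_on \<Omega>) = 0"
  shows "AE x in lebesgue_on \<Omega>. w x = 0"
proof -
  obtain D where D: "countable D" "D \<subseteq> Pow \<Omega>" "\<And>X. X \<in> D \<Longrightarrow> \<exists>a b. X = cbox a b" "\<Union>D = \<Omega>"
    using open_countable_Union_open_cbox[OF \<Omega>] by blast
  have "AE x in lborel. x \<in> X \<longrightarrow> w x = 0" if X: "X \<in> D" for X
  proof -
    from D(2,3) X obtain a b where ab: "X = cbox a b" "cbox a b \<subseteq> \<Omega>" by blast
    have "integrable (lebesgue_on (cbox a b)) w" using w ab by (auto simp: locally_integrable_on_def)
    then have i: "integrable lebesgue (\<lambda>x. indicator (cbox a b) x *\<^sub>R w x)"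
      by (subst (asm) integrable_restrict_space) simp_all
    then have "(\<lambda>x. indicator (cbox a b) x *\<^sub>R w x) \<in> borel_measurable (lebesgue_on UNIV)"
      by (simp only: borel_measurable_integrable lebesgue_on_UNIV_eq)
    from borel_representative[OF open_UNIV this] obtain g where "g \<in> borel_measurable borel"
        "AE x in lborel. x \<in> UNIV \<longrightarrow> indicator (cbox a b) x *\<^sub>R w x = g x"
      by (elim exE conjE) (rule that)
    then have g: "g \<in> borel_measurable borel" "AE x in lborel. indicator (cbox a b) x *\<^sub>R w x = g x"
      by simp_all
    have "integrable lebesgue g"
      by (rule integrable_cong_AE_imp[OF i]) (use g in \<open>auto simp: AE_completion_iff measurable_completion\<close>)
    then have gi: "integrable lborel g" using g(1) by (simp add: integrable_completion)
    have "AE x in lborel. x \<in> box a b \<longrightarrow> g x = 0"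
    proof (rule AE_eq_zero_if_orthogonal_to_test_functions[OF gi open_box])
      fix \<phi> assume \<phi>: "\<phi> \<in> test_functions (box a b)"
      have \<phi>': "\<phi> \<in> test_functions \<Omega>" using \<phi> test_functions_mono[of "box a b" \<Omega>] ab box_subset_cbox[of a b] by blast
      have sub: "x \<in> cbox a b" if "\<phi> x \<noteq> 0" for x
        using that closure_subset[of "{x. \<phi> x \<noteq> 0}"] test_functionsD(3)[OF \<phi>] box_subset_cbox[of a b] by blast
      have "(\<integral>x. g x * \<phi> x \<partial>lborel) = (\<integral>x. g x * \<phi> x \<partial>lebesgue)"
        using g(1) test_functions_borel[OF \<phi>] by (subst integral_completion) auto
      also have "\<dots> = (\<integral>x. w x * \<phi> x \<partial>lebesgue)"
      proof (rule integral_cong_AE)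
        show "AE x in lebesgue. g x * \<phi> x = w x * \<phi> x"
          unfolding AE_completion_iff using g(2)
          by eventually_elim (use sub in \<open>fastforce simp: indicator_def split: if_splits\<close>)
        show "(\<lambda>x. g x * \<phi> x) \<in> borel_measurable lebesgue"
          using g(1) test_functions_borel[OF \<phi>] by (intro measurable_completion) auto
        show "(\<lambda>x. w x * \<phi> x) \<in> borel_measurable lebesgue"
          by (rule borel_measurable_integrable[OF locally_integrable_times_test(1)[OF \<Omega> w \<phi>']])
      qed
      also have "\<dots> = 0" using orth[OF \<phi>'] locally_integrable_times_test(3)[OF \<Omega> w \<phi>'] by simp
      finally show "(\<integral>x. g x * \<phi> x \<partial>lborel) = 0" .
    qed
    moreover have "AE x in lborel. x \<notin> cbox a b - box a b"
    proof -
      have "cbox a b - box a b \<in> null_sets lebesgue"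
        using negligible_frontier_interval[of a b] by (simp add: negligible_iff_null_sets)
      from AE_not_in[OF this] show ?thesis by (simp add: AE_completion_iff)
    qed
    ultimately show ?thesis using g(2)
      by eventually_elim (auto simp: ab indicator_def)
  qed
  then have "AE x in lborel. \<forall>X\<in>D. x \<in> X \<longrightarrow> w x = 0"
    by (subst AE_ball_countable[OF D(1)]) blast
  then have "AE x in lborel. x \<in> \<Omega> \<longrightarrow> w x = 0"
    by eventually_elim (use D(4) in blast)
  then show ?thesis unfolding AE_lebesgue_on[OF \<Omega>] .
qed

lemma has_weak_derivD:
  assumes "has_weak_deriv \<Omega> \<alpha> u w"
  shows "locally_integrable_on \<Omega> u" "locally_integrable_on \<Omega> w"
    "\<phi> \<in> test_functions \<Omega> \<Longrightarrow> (\<integral>x. u x * multi_deriv \<alpha> \<phi> x \<partial>lebesgue_on \<Omega>) =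
        (-1) ^ order_mi \<alpha> * (\<integral>x. w x * \<phi> x \<partial>lebesgue_on \<Omega>)"
  using assms by (auto simp: has_weak_deriv_def)

lemma weak_deriv_unique:
  assumes \<Omega>: "open \<Omega>" and "has_weak_deriv \<Omega> \<alpha> u w" "has_weak_deriv \<Omega> \<alpha> u w'"
  shows "AE x in lebesgue_on \<Omega>. w x = w' x"
proof -
  note w = has_weak_derivD[OF assms(2)] and w' = has_weak_derivD[OF assms(3)]
  have "AE x in lebesgue_on \<Omega>. w x - w' x = 0"
  proof (rule weakly_zero_imp_AE_zero[OF \<Omega> locally_integrable_diff[OF w(2) w'(2)]])
    fix \<phi> assume \<phi>: "\<phi> \<in> test_functions \<Omega>"
    have "(-1) ^ order_mi \<alpha> * (\<integral>x. w x * \<phi> x \<partial>lebesgue_on \<Omega>) = (-1) ^ order_mi \<alpha> * (\<integral>x. w' x * \<phi> x \<partial>lebesgue_on \<Omega>)"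
      using w(3)[OF \<phi>] w'(3)[OF \<phi>] by simp
    then have "(\<integral>x. w x * \<phi> x \<partial>lebesgue_on \<Omega>) = (\<integral>x. w' x * \<phi> x \<partial>lebesgue_on \<Omega>)" by simp
    then show "(\<integral>x. (w x - w' x) * \<phi> x \<partial>lebesgue_on \<Omega>) = 0"
      using locally_integrable_times_test(2)[OF \<Omega> w(2) \<phi>] locally_integrable_times_test(2)[OF \<Omega> w'(2) \<phi>]
      by (simp add: left_diff_distrib)
  qed
  then show ?thesis by eventually_elim simp
qed

lemma has_weak_deriv_zero: "locally_integrable_on \<Omega> u \<Longrightarrow> has_weak_deriv \<Omega> (\<lambda>_. 0) u u"
  by (simp add: has_weak_deriv_def multi_deriv_zero order_mi_def)

lemma has_weak_deriv_add:
  assumes \<Omega>: "open \<Omega>" and u: "has_weak_deriv \<Omega> \<alpha> u w" and v: "has_weak_deriv \<Omega> \<alpha> v z"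
  shows "has_weak_deriv \<Omega> \<alpha> (\<lambda>x. u x + v x) (\<lambda>x. w x + z x)"
  unfolding has_weak_deriv_def
proof (intro conjI ballI locally_integrable_add has_weak_derivD[OF u] has_weak_derivD[OF v])
  fix \<phi> assume \<phi>: "\<phi> \<in> test_functions \<Omega>"
  note * = locally_integrable_times_test(2)[OF \<Omega> _ \<phi>] locally_integrable_times_test(2)[OF \<Omega> _ test_functions_multi_deriv[OF \<phi>]]
  show "(\<integral>x. (u x + v x) * multi_deriv \<alpha> \<phi> x \<partial>lebesgue_on \<Omega>) =
      (- 1) ^ order_mi \<alpha> * (\<integral>x. (w x + z x) * \<phi> x \<partial>lebesgue_on \<Omega>)"
    using has_weak_derivD[OF u] has_weak_derivD[OF v] \<phi> * by (simp add: distrib_right distrib_left)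
qed

lemma has_weak_deriv_cmult:
  assumes u: "has_weak_deriv \<Omega> \<alpha> u w"
  shows "has_weak_deriv \<Omega> \<alpha> (\<lambda>x. c * u x) (\<lambda>x. c * w x)"
  unfolding has_weak_deriv_def
proof (intro conjI ballI locally_integrable_cmult has_weak_derivD[OF u])
  fix \<phi> assume \<phi>: "\<phi> \<in> test_functions \<Omega>"
  show "(\<integral>x. c * u x * multi_deriv \<alpha> \<phi> x \<partial>lebesgue_on \<Omega>) =
      (- 1) ^ order_mi \<alpha> * (\<integral>x. c * w x * \<phi> x \<partial>lebesgue_on \<Omega>)"
    using has_weak_derivD(3)[OF u \<phi>] by (simp add: mult.assoc)
qed

text \<open>Test the defining identity for \<open>\<partial>\<^sup>\<alpha>u\<close> with \<open>\<partial>\<^sub>j\<phi>\<close>.\<close>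

lemma has_weak_deriv_step:
  assumes u: "has_weak_deriv \<Omega> \<alpha> u w" and v: "has_weak_deriv \<Omega> (mi_suc j \<alpha>) u z"
  shows "has_weak_deriv \<Omega> (mi_suc j (\<lambda>_. 0)) w z"
  unfolding has_weak_deriv_def
proof (intro conjI ballI has_weak_derivD(2)[OF u] has_weak_derivD(2)[OF v])
  fix \<phi> assume \<phi>: "\<phi> \<in> test_functions \<Omega>"
  note sm = test_functionsD(1)[OF \<phi>]
  have "(-1) ^ order_mi \<alpha> * (\<integral>x. w x * partial_deriv j \<phi> x \<partial>lebesgue_on \<Omega>) = (-1) ^ Suc (order_mi \<alpha>) * (\<integral>x. z x * \<phi> x \<partial>lebesgue_on \<Omega>)"
    using has_weak_derivD(3)[OF u test_functions_partial_deriv[OF \<phi>], of j] has_weak_derivD(3)[OF v \<phi>]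
    by (simp add: multi_deriv_mi_suc(1)[OF sm])
  then have "(\<integral>x. w x * partial_deriv j \<phi> x \<partial>lebesgue_on \<Omega>) = - (\<integral>x. z x * \<phi> x \<partial>lebesgue_on \<Omega>)"
    by (cases "even (order_mi \<alpha>)") (simp_all add: equation_minus_iff)
  then show "(\<integral>x. w x * multi_deriv (mi_suc j (\<lambda>_. 0)) \<phi> x \<partial>lebesgue_on \<Omega>) =
      (- 1) ^ order_mi (mi_suc j (\<lambda>_. 0)) * (\<integral>x. z x * \<phi> x \<partial>lebesgue_on \<Omega>)"
    by (simp add: multi_deriv_unit[OF sm]) (simp add: order_mi_def)
qed

lemma smooth_integration_by_parts:
  assumes q: "smooth q" and \<phi>: "\<phi> \<in> test_functions \<Omega>"
  shows "(\<integral>x. q x * foldr partial_deriv js \<phi> x \<partial>lborel) = (-1) ^ length js * (\<integral>x. foldr partial_deriv js q x * \<phi> x \<partial>lborel)"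
  using q
proof (induction js arbitrary: q)
  case (Cons j js)
  let ?\<psi> = "foldr partial_deriv js \<phi>"
  have \<psi>: "?\<psi> \<in> test_functions \<Omega>"
    using \<phi> by (induction js) (auto intro: test_functions_partial_deriv)
  note i1 = test_functions_integrable[OF test_functions_mult[OF Cons.prems test_functions_partial_deriv[OF \<psi>, of j]]]
  note i2 = test_functions_integrable[OF test_functions_mult[OF smooth_partial_deriv[OF Cons.prems, of j] \<psi>]]
  have "0 = (\<integral>x. partial_deriv j (\<lambda>x. q x * ?\<psi> x) x \<partial>lborel)"
    using integral_partial_deriv_zero[OF test_functions_mult[OF Cons.prems \<psi>]] by simp
  also have "\<dots> = (\<integral>x. q x * partial_deriv j ?\<psi> x + partial_deriv j q x * ?\<psi> x \<partial>lborel)"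
    by (simp add: partial_deriv_mult[OF smooth_differentiable[OF Cons.prems] smooth_differentiable[OF test_functionsD(1)[OF \<psi>]]])
  also have "\<dots> = (\<integral>x. q x * partial_deriv j ?\<psi> x \<partial>lborel) + (\<integral>x. partial_deriv j q x * ?\<psi> x \<partial>lborel)"
    by (rule Bochner_Integration.integral_add[OF i1 i2])
  finally have "(\<integral>x. q x * partial_deriv j ?\<psi> x \<partial>lborel) = - (\<integral>x. partial_deriv j q x * ?\<psi> x \<partial>lborel)"
    by (simp add: eq_neg_iff_add_eq_0)
  also have "\<dots> = - ((-1) ^ length js * (\<integral>x. foldr partial_deriv js (partial_deriv j q) x * \<phi> x \<partial>lborel))"
    using Cons.IH[OF smooth_partial_deriv[OF Cons.prems, of j]] by simp
  finally show ?case by (simp add: foldr_partial_deriv_commute[OF Cons.prems])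
qed simp

lemma has_weak_deriv_smooth:
  assumes \<Omega>: "open \<Omega>" and q: "smooth q"
  shows "has_weak_deriv \<Omega> \<alpha> q (multi_deriv \<alpha> q)"
  unfolding has_weak_deriv_def
proof (intro conjI ballI smooth_locally_integrable q smooth_multi_deriv)
  fix \<phi> assume \<phi>: "\<phi> \<in> test_functions \<Omega>"
  have *: "(\<integral>x. r x * \<psi> x \<partial>lebesgue_on \<Omega>) = (\<integral>x. r x * \<psi> x \<partial>lborel)" if "smooth r" "\<psi> \<in> test_functions \<Omega>" for r \<psi>
    using test_functions_borel[OF test_functions_mult[OF that]]
    by (simp add: locally_integrable_times_test(3)[OF \<Omega> smooth_locally_integrable[OF that(1)] that(2)] integral_completion)
  show "(\<integral>x. q x * multi_deriv \<alpha> \<phi> x \<partial>lebesgue_on \<Omega>) =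
      (- 1) ^ order_mi \<alpha> * (\<integral>x. multi_deriv \<alpha> q x * \<phi> x \<partial>lebesgue_on \<Omega>)"
    unfolding *[OF q test_functions_multi_deriv[OF \<phi>]] *[OF smooth_multi_deriv[OF q] \<phi>]
    unfolding multi_deriv_eq_foldr smooth_integration_by_parts[OF q \<phi>] length_mi_list ..
qed

section \<open>Inequalities for powers and their integrals\<close>

text \<open>The graph of the convex function \<open>t \<mapsto> t\<^sup>p\<close> lies above its tangent at \<open>m\<close>; after dividing by \<open>m\<^sup>p\<close> this is
Bernoulli's inequality, a case of Young's inequality.\<close>

lemma powr_tangent:
  fixes a m p :: real
  assumes p: "1 \<le> p" and a: "0 \<le> a" and m: "0 < m"
  shows "m powr p * (1 + p * (a / m - 1)) \<le> a powr p"
proof (cases "a = 0")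
  case True
  then show ?thesis using p by (simp add: mult_nonneg_nonpos)
next
  case False
  let ?r = "a / m"
  have r: "?r > 0" using False a m by simp
  have "(?r powr p) powr (1 / p) * 1 powr (1 - 1 / p) \<le> 1 / p * ?r powr p + (1 - 1 / p) * 1"
    using p r by (intro Youngs_inequality_0) auto
  then have "?r \<le> 1 / p * ?r powr p + (1 - 1 / p)"
    using p a m by (simp add: powr_powr)
  then have "p * ?r \<le> p * (1 / p * ?r powr p + (1 - 1 / p))" using p by (intro mult_left_mono) auto
  also have "\<dots> = ?r powr p + p - 1" using p by (simp add: field_simps)
  finally have "1 + p * (?r - 1) \<le> ?r powr p" by (simp add: algebra_simps)
  then have "m powr p * (1 + p * (?r - 1)) \<le> m powr p * ?r powr p" by (intro mult_left_mono) auto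
  also have "\<dots> = a powr p" using m r by (simp flip: powr_mult)
  finally show ?thesis .
qed

lemma powr_convex_combination:
  fixes a b t p :: real
  assumes p: "1 \<le> p" and ab: "0 \<le> a" "0 \<le> b" and t: "0 \<le> t" "t \<le> 1"
  shows "((1 - t) * a + t * b) powr p \<le> (1 - t) * a powr p + t * b powr p"
proof (cases "(1 - t) * a + t * b = 0")
  case True
  then show ?thesis using p ab t by (simp add: mult_nonneg_nonneg)
next
  case False
  define m where "m = (1 - t) * a + t * b"
  have m: "m > 0" using False ab t unfolding m_def
    by (simp add: add_nonneg_nonneg less_le)
  have "(1 - t) * (m powr p * (1 + p * (a / m - 1))) + t * (m powr p * (1 + p * (b / m - 1))) \<le> (1 - t) * a powr p + t * b powr p"
    using t by (intro add_mono mult_left_mono powr_tangent p ab m) auto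
  moreover have "(1 - t) * (m powr p * (1 + p * (a / m - 1))) + t * (m powr p * (1 + p * (b / m - 1)))
     = m powr p * (1 + p * (((1 - t) * a + t * b) / m - 1))"
    using m by (simp add: field_simps)
  ultimately have "m powr p * (1 + p * (m / m - 1)) \<le> (1 - t) * a powr p + t * b powr p"
    unfolding m_def[symmetric] by linarith
  then have "m powr p \<le> (1 - t) * a powr p + t * b powr p" using m by simp
  then show ?thesis unfolding m_def .
qed

lemma powr_add_le:
  fixes a b p :: real
  assumes p: "1 \<le> p" and ab: "0 \<le> a" "0 \<le> b"
  shows "(a + b) powr p \<le> 2 powr p * (a powr p + b powr p)"
proof -
  have "(a + b) powr p \<le> (2 * max a b) powr p" using p ab by (intro powr_mono2) auto
  also have "\<dots> = 2 powr p * max a b powr p" using ab by (intro powr_mult)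
  also have "\<dots> \<le> 2 powr p * (a powr p + b powr p)"
    by (intro mult_left_mono) (auto simp: max_def)
  finally show ?thesis .
qed

lemma powr_sum_le:
  fixes a :: "'i \<Rightarrow> real"
  assumes p: "1 \<le> p" and I: "finite I" and a: "\<And>i. i \<in> I \<Longrightarrow> 0 \<le> a i"
  shows "(\<Sum>i\<in>I. a i) powr p \<le> real (card I) powr p * (\<Sum>i\<in>I. a i powr p)"
proof (cases "I = {}")
  case False
  then obtain j where j: "j \<in> I" "\<And>i. i \<in> I \<Longrightarrow> a i \<le> a j"
  proof -
    have "Max (a ` I) \<in> a ` I" using I False by (intro Max_in) auto
    then obtain j where "j \<in> I" "Max (a ` I) = a j" by blast
    then show ?thesis using I by (intro that[of j]) (auto simp flip: \<open>Max (a ` I) = a j\<close>)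
  qed
  have "(\<Sum>i\<in>I. a i) \<le> real (card I) * a j"
    using sum_bounded_above[of I a "a j"] j by simp
  then have "(\<Sum>i\<in>I. a i) powr p \<le> (real (card I) * a j) powr p"
    using p a by (intro powr_mono2) (auto intro: sum_nonneg)
  also have "\<dots> = real (card I) powr p * a j powr p" using a j by (simp add: powr_mult)
  also have "\<dots> \<le> real (card I) powr p * (\<Sum>i\<in>I. a i powr p)"
    using member_le_sum[of j I "\<lambda>i. a i powr p"] I j by (intro mult_left_mono) auto
  finally show ?thesis .
qed simp

text \<open>The integral of \<open>|v|\<^sup>p\<close> over \<open>A\<close> with values in the extended nonnegative reals, which avoids integrability
side conditions.\<close>

definition nn_pint :: "real \<Rightarrow> 'a::euclidean_space set \<Rightarrow> ('a \<Rightarrow> complex) \<Rightarrow> ennreal" where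
  "nn_pint p A v = (\<integral>\<^sup>+x. ennreal (cmod (v x) powr p) * indicator A x \<partial>lborel)"

lemma nn_pint_mono: "A \<subseteq> B \<Longrightarrow> nn_pint p A v \<le> nn_pint p B v"
  unfolding nn_pint_def by (intro nn_integral_mono) (auto simp: indicator_def)

lemma nn_pint_Un_le:
  assumes "v \<in> borel_measurable borel" "A \<in> sets borel" "B \<in> sets borel"
  shows "nn_pint p (A \<union> B) v \<le> nn_pint p A v + nn_pint p B v"
proof -
  have "nn_pint p (A \<union> B) v \<le> (\<integral>\<^sup>+x. ennreal (cmod (v x) powr p) * indicator A x + ennreal (cmod (v x) powr p) * indicator B x \<partial>lborel)"
    unfolding nn_pint_def by (intro nn_integral_mono) (auto simp: indicator_def)
  also have "\<dots> = nn_pint p A v + nn_pint p B v"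
    unfolding nn_pint_def using assms by (intro nn_integral_add) auto
  finally show ?thesis .
qed

lemma nn_pint_add_le:
  assumes p: "1 \<le> p" and [measurable]: "u \<in> borel_measurable borel" "v \<in> borel_measurable borel" "A \<in> sets borel"
    and w: "\<And>x. w x = u x + v x"
  shows "nn_pint p A w \<le> ennreal (2 powr p) * (nn_pint p A u + nn_pint p A v)"
proof -
  have "nn_pint p A w \<le> (\<integral>\<^sup>+x. ennreal (2 powr p) * (ennreal (cmod (u x) powr p) * indicator A x + ennreal (cmod (v x) powr p) * indicator A x) \<partial>lborel)"
    unfolding nn_pint_def
  proof (intro nn_integral_mono)
    fix x
    have "cmod (w x) powr p \<le> (cmod (u x) + cmod (v x)) powr p"
      unfolding w using p by (intro powr_mono2 norm_triangle_ineq) auto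
    also have "\<dots> \<le> 2 powr p * (cmod (u x) powr p + cmod (v x) powr p)"
      by (rule powr_add_le[OF p]) auto
    finally have "ennreal (cmod (w x) powr p) \<le> ennreal (2 powr p) * (ennreal (cmod (u x) powr p) + ennreal (cmod (v x) powr p))"
      by (simp flip: ennreal_mult ennreal_plus add: ennreal_leI)
    then show "ennreal (cmod (w x) powr p) * indicator A x
      \<le> ennreal (2 powr p) * (ennreal (cmod (u x) powr p) * indicator A x + ennreal (cmod (v x) powr p) * indicator A x)"
      by (auto simp: indicator_def)
  qed
  also have "\<dots> = ennreal (2 powr p) * (nn_pint p A u + nn_pint p A v)"
    unfolding nn_pint_def by (subst nn_integral_cmult) (auto simp: nn_integral_add)
  finally show ?thesis .
qed

lemma nn_pint_const: "A \<in> sets borel \<Longrightarrow> nn_pint p A (\<lambda>x. c) = ennreal (cmod c powr p) * emeasure lborel A"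
  unfolding nn_pint_def by (simp add: nn_integral_cmult)

lemma nn_pint_minus_commute: "nn_pint p A (\<lambda>x. u x - v x) = nn_pint p A (\<lambda>x. v x - u x)"
  by (simp add: nn_pint_def norm_minus_commute)

lemma nn_integral_lborel_translate:
  fixes F :: "'a::euclidean_space \<Rightarrow> ennreal"
  assumes "F \<in> borel_measurable borel"
  shows "(\<integral>\<^sup>+x. F (x + c) \<partial>lborel) = (\<integral>\<^sup>+x. F x \<partial>lborel)"
  using nn_integral_distr[of "(+) c" lborel borel F] assms
  by (simp add: lborel_distr_plus add.commute)

lemma nn_pint_translate_le:
  fixes v :: "'a::euclidean_space \<Rightarrow> complex"
  assumes [measurable]: "v \<in> borel_measurable borel" "A \<in> sets borel" and E: "\<And>x. x \<in> E \<Longrightarrow> x + w \<in> A"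
  shows "nn_pint p E (\<lambda>x. v (x + w)) \<le> nn_pint p A v"
proof -
  have "nn_pint p E (\<lambda>x. v (x + w)) \<le> (\<integral>\<^sup>+x. (\<lambda>x. ennreal (cmod (v x) powr p) * indicator A x) (x + w) \<partial>lborel)"
    unfolding nn_pint_def by (intro nn_integral_mono) (auto simp: indicator_def E)
  also have "\<dots> = nn_pint p A v"
    unfolding nn_pint_def by (rule nn_integral_lborel_translate) measurable
  finally show ?thesis .
qed

text \<open>Jensen's inequality on the unit interval: integrate the tangent inequality at the mean \<open>m\<close> of \<open>|h|\<close>.
If \<open>h\<close> is not integrable, its Bochner integral is zero by convention and the estimate is trivial.\<close>

lemma powr_norm_integral_le:
  fixes h :: "real \<Rightarrow> complex"
  assumes p: "1 \<le> p" and [measurable]: "h \<in> borel_measurable borel"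
  shows "ennreal (cmod (\<integral>s. indicator {0..1} s *\<^sub>R h s \<partial>lborel) powr p) \<le> (\<integral>\<^sup>+s. ennreal (cmod (h s) powr p) * indicator {0..1} s \<partial>lborel)"
proof (cases "integrable lborel (\<lambda>s. indicator {0..1::real} s *\<^sub>R h s)")
  case False
  then have "(\<integral>s. indicator {0..1} s *\<^sub>R h s \<partial>lborel) = 0" by (rule not_integrable_integral_eq)
  then show ?thesis by simp
next
  case True
  define m where "m = (\<integral>s. norm (indicator {0..1} s *\<^sub>R h s) \<partial>lborel)"
  have n: "integrable lborel (\<lambda>s. norm (indicator {0..1::real} s *\<^sub>R h s))" using True by (rule integrable_norm)
  have le: "cmod (\<integral>s. indicator {0..1} s *\<^sub>R h s \<partial>lborel) \<le> m"
    unfolding m_def by (rule integral_norm_bound)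
  show ?thesis
  proof (cases "m > 0")
    case False
    with le have "cmod (\<integral>s. indicator {0..1} s *\<^sub>R h s \<partial>lborel) = 0"
      using norm_ge_zero[of "\<integral>s. indicator {0..1} s *\<^sub>R h s \<partial>lborel"] by linarith
    then show ?thesis by simp
  next
    case m: True
    \<comment> \<open>the tangent at \<open>m\<close> is \<open>?k + ?c * t\<close>\<close>
    let ?k = "m powr p * (1 - p)" and ?c = "m powr p * p / m"
    let ?f = "\<lambda>s. ?k * indicator {0..1::real} s + ?c * norm (indicator {0..1::real} s *\<^sub>R h s)"
    have fi: "integrable lborel ?f"
      by (intro Bochner_Integration.integrable_add integrable_mult_right n) simp
    have "(\<integral>s. ?f s \<partial>lborel) = (\<integral>s. ?k * indicator {0..1::real} s \<partial>lborel) + (\<integral>s. ?c * norm (indicator {0..1::real} s *\<^sub>R h s) \<partial>lborel)"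
      by (intro Bochner_Integration.integral_add integrable_mult_right n) simp
    also have "\<dots> = ?k + ?c * m" unfolding m_def by simp
    also have "\<dots> = m powr p" using m by (simp add: field_simps)
    finally have "ennreal (m powr p) = ennreal (\<integral>s. ?f s \<partial>lborel)" by simp
    also have "\<dots> \<le> ennreal (\<integral>s. max 0 (?f s) \<partial>lborel)"
      by (intro ennreal_leI integral_mono fi integrable_max) auto
    also have "\<dots> = (\<integral>\<^sup>+s. ennreal (max 0 (?f s)) \<partial>lborel)"
      by (intro nn_integral_eq_integral[symmetric] integrable_max fi) auto
    also have "\<dots> \<le> (\<integral>\<^sup>+s. ennreal (cmod (h s) powr p) * indicator {0..1} s \<partial>lborel)"
    proof (intro nn_integral_mono)
      fix s
      have "?k + ?c * cmod (h s) = m powr p * (1 + p * (cmod (h s) / m - 1))" using m by (simp add: field_simps)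
      then have "?k + ?c * cmod (h s) \<le> cmod (h s) powr p" using powr_tangent[OF p norm_ge_zero m, of "h s"] by simp
      then show "ennreal (max 0 (?f s)) \<le> ennreal (cmod (h s) powr p) * indicator {0..1} s"
        by (auto simp: indicator_def intro!: ennreal_leI)
    qed
    finally have "ennreal (m powr p) \<le> (\<integral>\<^sup>+s. ennreal (cmod (h s) powr p) * indicator {0..1} s \<partial>lborel)" .
    moreover have "ennreal (cmod (\<integral>s. indicator {0..1} s *\<^sub>R h s \<partial>lborel) powr p) \<le> ennreal (m powr p)"
      using le p by (intro ennreal_leI powr_mono2) auto
    ultimately show ?thesis by (rule order_trans[rotated])
  qed
qed

section \<open>Translations of functions with a weak gradient\<close>

text \<open>\<open>v\<close> has the weak gradient \<open>g\<close> in \<open>\<Omega>\<close>, where both are represented by integrable Borel functions that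
vanish outside \<open>\<Omega>\<close>.\<close>

definition has_weak_gradient :: "(real^'d::finite) set \<Rightarrow> (real^'d \<Rightarrow> complex) \<Rightarrow> ('d \<Rightarrow> real^'d \<Rightarrow> complex) \<Rightarrow> bool" where
  "has_weak_gradient \<Omega> v g \<longleftrightarrow> v \<in> borel_measurable borel \<and> (\<forall>j. g j \<in> borel_measurable borel) \<and>
     (\<forall>x. x \<notin> \<Omega> \<longrightarrow> v x = 0) \<and> (\<forall>j x. x \<notin> \<Omega> \<longrightarrow> g j x = 0) \<and>
     integrable lborel v \<and> (\<forall>j. integrable lborel (g j)) \<and>
     (\<forall>\<phi>\<in>test_functions \<Omega>. \<forall>j. (\<integral>x. v x * partial_deriv j \<phi> x \<partial>lborel) = - (\<integral>x. g j x * \<phi> x \<partial>lborel))"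

definition gradient_energy :: "real \<Rightarrow> ('d::finite \<Rightarrow> real^'d \<Rightarrow> complex) \<Rightarrow> ennreal" where
  "gradient_energy p g = (\<Sum>j\<in>UNIV. nn_pint p UNIV (g j))"

lemma integrable_mult_test:
  fixes g :: "real^'d::finite \<Rightarrow> complex"
  assumes g: "integrable lborel g" and \<phi>: "\<phi> \<in> test_functions \<Omega>"
  shows "integrable lborel (\<lambda>x. g x * \<phi> x)"
proof -
  obtain M where M: "M \<ge> 0" "\<And>x. cmod (\<phi> x) \<le> M" using test_functions_bounded[OF \<phi>] by blast
  note [measurable] = test_functions_borel[OF \<phi>] borel_measurable_integrable[OF g]
  show ?thesis
  proof (rule Bochner_Integration.integrable_bound[OF integrable_mult_left[OF integrable_norm[OF g], of M]])
    show "(\<lambda>x. g x * \<phi> x) \<in> borel_measurable lborel" by measurable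
    show "AE x in lborel. norm (g x * \<phi> x) \<le> norm (norm (g x) * M)"
    proof (rule AE_I2)
      fix x
      have "norm (g x) * norm (\<phi> x) \<le> norm (g x) * M" by (rule mult_left_mono[OF M(2) norm_ge_zero])
      then show "norm (g x * \<phi> x) \<le> norm (norm (g x) * M)" using M(1) by (simp add: norm_mult)
    qed
  qed
qed

text \<open>The fundamental theorem of calculus for weak gradients. Against a test function \<open>\<phi>\<close> on \<open>U\<close> the increment
of \<open>v\<close> becomes, after a translation, \<open>- \<integral> v (w \<cdot> \<nabla>\<Phi>)\<close> for the backward segment mean \<open>\<Phi>\<close> of \<open>\<phi>\<close>. As \<open>\<Phi>\<close> is a
test function on \<open>\<Omega>\<close>, the weak gradient applies, and moving the segment mean back to \<open>g\<close> gives the claim.\<close>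

lemma translation_identity:
  fixes v :: "real^'d::finite \<Rightarrow> complex"
  assumes vg: "has_weak_gradient \<Omega> v g" and U: "open U"
    and seg: "\<And>x s. x \<in> U \<Longrightarrow> 0 \<le> s \<Longrightarrow> s \<le> 1 \<Longrightarrow> x + s *\<^sub>R w \<in> \<Omega>"
  shows "AE x in lborel. x \<in> U \<longrightarrow> v (x + w) - v x - segment_mean_lborel w (\<lambda>y. \<Sum>j\<in>UNIV. of_real (w $ j) * g j y) x = 0"
proof (rule AE_eq_zero_if_orthogonal_to_test_functions[OF _ U])
  let ?g = "\<lambda>y. \<Sum>j\<in>UNIV. of_real (w $ j) * g j y"
  have v: "v \<in> borel_measurable borel" "integrable lborel v" and g: "g j \<in> borel_measurable borel" "integrable lborel (g j)" for j
    using vg by (auto simp: has_weak_gradient_def)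
  have weak: "(\<integral>x. v x * partial_deriv j \<phi> x \<partial>lborel) = - (\<integral>x. g j x * \<phi> x \<partial>lborel)" if "\<phi> \<in> test_functions \<Omega>" for \<phi> j
    using vg that by (auto simp: has_weak_gradient_def)
  have G: "integrable lborel ?g" "?g \<in> borel_measurable borel"
    using g by (auto intro!: Bochner_Integration.integrable_sum integrable_mult_right)
  have iv: "integrable lborel (\<lambda>x. v (x + w))" using lborel_integral_translate(2)[OF v(1)] v(2) by simp
  have ir: "integrable lborel (segment_mean_lborel w ?g)"
    using integral_segment_mean_lborel(2)[OF G, of "\<lambda>_. 1" 1 w] by simp
  show "integrable lborel (\<lambda>x. v (x + w) - v x - segment_mean_lborel w ?g x)"
    using iv ir v(2) by simp
  fix \<phi> assume \<phi>: "\<phi> \<in> test_functions U"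
  note sm = test_functionsD(1)[OF \<phi>]
  obtain M where M: "\<And>x. cmod (\<phi> x) \<le> M" using test_functions_bounded[OF \<phi>] by blast
  let ?\<Phi> = "segment_mean (- w) \<phi>"
  have \<Phi>: "?\<Phi> \<in> test_functions \<Omega>" by (rule test_functions_segment_mean[OF \<phi> seg])
  have [measurable]: "\<phi> \<in> borel_measurable borel" by (rule test_functions_borel[OF \<phi>])
  note [measurable] = v(1)
  have i1: "integrable lborel (\<lambda>x. v (x + w) * \<phi> x)" by (rule integrable_mult_test[OF iv \<phi>])
  have i2: "integrable lborel (\<lambda>x. v x * \<phi> x)" by (rule integrable_mult_test[OF v(2) \<phi>])
  have i3: "integrable lborel (\<lambda>x. segment_mean_lborel w ?g x * \<phi> x)" by (rule integrable_mult_test[OF ir \<phi>])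
  have "(\<lambda>x. (\<lambda>x. v x * \<phi> (x - w)) (x + w)) = (\<lambda>x. v (x + w) * \<phi> x)" by simp
  with lborel_integral_translate[of "\<lambda>x. v x * \<phi> (x - w)" w] i1
  have tr: "(\<integral>x. v (x + w) * \<phi> x \<partial>lborel) = (\<integral>x. v x * \<phi> (x - w) \<partial>lborel)" "integrable lborel (\<lambda>x. v x * \<phi> (x - w))"
    by simp_all
  have "(\<integral>x. segment_mean_lborel w ?g x * \<phi> x \<partial>lborel) = (\<integral>x. ?g x * ?\<Phi> x \<partial>lborel)"
    using integral_segment_mean_lborel(1)[OF G smooth_continuous[OF sm] M, of w] by (simp add: segment_mean_eq_lborel[OF sm])
  also have "\<dots> = (\<integral>x. (\<Sum>j\<in>UNIV. of_real (w $ j) * (g j x * ?\<Phi> x)) \<partial>lborel)"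
    by (simp add: sum_distrib_right mult.assoc)
  also have "\<dots> = (\<Sum>j\<in>UNIV. of_real (w $ j) * (\<integral>x. g j x * ?\<Phi> x \<partial>lborel))"
    using integrable_mult_test[OF g(2) \<Phi>] by (subst Bochner_Integration.integral_sum) auto
  also have "\<dots> = (\<Sum>j\<in>UNIV. of_real (w $ j) * - (\<integral>x. v x * partial_deriv j ?\<Phi> x \<partial>lborel))"
    using weak[OF \<Phi>] by simp
  also have "\<dots> = - (\<integral>x. (\<Sum>j\<in>UNIV. of_real (w $ j) * (v x * partial_deriv j ?\<Phi> x)) \<partial>lborel)"
    using integrable_mult_test[OF v(2) test_functions_partial_deriv[OF \<Phi>]]
    by (subst Bochner_Integration.integral_sum) (auto simp: sum_negf)
  also have "\<dots> = - (\<integral>x. v x * dir_deriv w ?\<Phi> x \<partial>lborel)"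
    by (simp add: dir_deriv_def sum_distrib_left mult_ac)
  also have "(\<lambda>x. v x * dir_deriv w ?\<Phi> x) = (\<lambda>x. v x * \<phi> x - v x * \<phi> (x - w))"
  proof
    fix x
    have neg: "dir_deriv (- w) \<phi> = (\<lambda>x. - dir_deriv w \<phi> x)" by (simp add: fun_eq_iff dir_deriv_def sum_negf)
    have "\<phi> (x - w) - \<phi> x = - segment_mean (- w) (dir_deriv w \<phi>) x"
      using diff_eq_segment_mean[OF sm, of x "- w"] by (simp add: neg segment_mean_def)
    then have "dir_deriv w ?\<Phi> x = \<phi> x - \<phi> (x - w)" unfolding dir_deriv_segment_mean[OF sm] by (simp add: algebra_simps)
    then show "v x * dir_deriv w ?\<Phi> x = v x * \<phi> x - v x * \<phi> (x - w)" by (simp only: right_diff_distrib)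
  qed
  also have "- (\<integral>x. v x * \<phi> x - v x * \<phi> (x - w) \<partial>lborel) = (\<integral>x. v x * \<phi> (x - w) \<partial>lborel) - (\<integral>x. v x * \<phi> x \<partial>lborel)"
    by (simp add: Bochner_Integration.integral_diff[OF i2 tr(2)])
  finally have ray: "(\<integral>x. segment_mean_lborel w ?g x * \<phi> x \<partial>lborel) = (\<integral>x. v x * \<phi> (x - w) \<partial>lborel) - (\<integral>x. v x * \<phi> x \<partial>lborel)" .
  have "(\<integral>x. (v (x + w) - v x - segment_mean_lborel w ?g x) * \<phi> x \<partial>lborel)
    = (\<integral>x. v (x + w) * \<phi> x \<partial>lborel) - (\<integral>x. v x * \<phi> x \<partial>lborel) - (\<integral>x. segment_mean_lborel w ?g x * \<phi> x \<partial>lborel)"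
    by (simp add: left_diff_distrib i1 i2 i3)
  then show "(\<integral>x. (v (x + w) - v x - segment_mean_lborel w ?g x) * \<phi> x \<partial>lborel) = 0"
    by (simp add: ray tr(1))
qed

text \<open>Apply Jensen's inequality to the translation identity and exchange the integrals; each translate of
\<open>|w \<cdot> g|\<^sup>p\<close> has the same integral over the whole space.\<close>

lemma translation_estimate:
  fixes v :: "real^'d::finite \<Rightarrow> complex"
  assumes p: "1 \<le> p" and vg: "has_weak_gradient \<Omega> v g" and U: "open U"
    and seg: "\<And>x s. x \<in> U \<Longrightarrow> 0 \<le> s \<Longrightarrow> s \<le> 1 \<Longrightarrow> x + s *\<^sub>R w \<in> \<Omega>"
  shows "nn_pint p U (\<lambda>x. v (x + w) - v x) \<le> ennreal ((real CARD('d) * norm w) powr p) * gradient_energy p g"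
proof -
  let ?g = "\<lambda>y. \<Sum>j\<in>UNIV. of_real (w $ j) * g j y"
  have g[measurable]: "g j \<in> borel_measurable borel" for j using vg by (simp add: has_weak_gradient_def)
  have [measurable]: "U \<in> sets borel" using U by simp
  have "nn_pint p U (\<lambda>x. v (x + w) - v x) = nn_pint p U (segment_mean_lborel w ?g)"
    unfolding nn_pint_def
    by (rule nn_integral_cong_AE, rule AE_mp[OF translation_identity[OF vg U seg]], assumption+)
       (auto simp: indicator_def)
  also have "\<dots> \<le> (\<integral>\<^sup>+x. (\<integral>\<^sup>+s. ennreal (cmod (?g (x + s *\<^sub>R w)) powr p) * indicator {0..1::real} s \<partial>lborel) \<partial>lborel)"
    unfolding nn_pint_def
  proof (intro nn_integral_mono)
    fix x
    have "ennreal (cmod (segment_mean_lborel w ?g x) powr p) \<le> (\<integral>\<^sup>+s. ennreal (cmod (?g (x + s *\<^sub>R w)) powr p) * indicator {0..1::real} s \<partial>lborel)"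
      unfolding segment_mean_lborel_def by (rule powr_norm_integral_le[OF p]) measurable
    then show "ennreal (cmod (segment_mean_lborel w ?g x) powr p) * indicator U x \<le> (\<integral>\<^sup>+s. ennreal (cmod (?g (x + s *\<^sub>R w)) powr p) * indicator {0..1::real} s \<partial>lborel)"
      by (auto simp: indicator_def)
  qed
  also have "\<dots> = (\<integral>\<^sup>+s. (\<integral>\<^sup>+x. ennreal (cmod (?g (x + s *\<^sub>R w)) powr p) * indicator {0..1::real} s \<partial>lborel) \<partial>lborel)"
    by (rule lborel_pair.Fubini'[symmetric]) measurable
  also have "\<dots> = (\<integral>\<^sup>+s. (\<integral>\<^sup>+x. ennreal (cmod (?g x) powr p) \<partial>lborel) * indicator {0..1::real} s \<partial>lborel)"
  proof (intro nn_integral_cong)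
    fix s :: real
    have "(\<integral>\<^sup>+x. ennreal (cmod (?g (x + s *\<^sub>R w)) powr p) * indicator {0..1::real} s \<partial>lborel)
       = (\<integral>\<^sup>+x. (\<lambda>x. ennreal (cmod (?g x) powr p)) (x + s *\<^sub>R w) \<partial>lborel) * indicator {0..1::real} s"
      by (rule nn_integral_multc) measurable
    also have "\<dots> = (\<integral>\<^sup>+x. ennreal (cmod (?g x) powr p) \<partial>lborel) * indicator {0..1::real} s"
      by (subst nn_integral_lborel_translate) auto
    finally show "(\<integral>\<^sup>+x. ennreal (cmod (?g (x + s *\<^sub>R w)) powr p) * indicator {0..1::real} s \<partial>lborel)
       = (\<integral>\<^sup>+x. ennreal (cmod (?g x) powr p) \<partial>lborel) * indicator {0..1::real} s" .
  qed
  also have "\<dots> = (\<integral>\<^sup>+x. ennreal (cmod (?g x) powr p) \<partial>lborel)"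
    by (simp add: nn_integral_cmult)
  also have "\<dots> \<le> (\<integral>\<^sup>+x. ennreal ((real CARD('d) * norm w) powr p) * (\<Sum>j\<in>UNIV. ennreal (cmod (g j x) powr p)) \<partial>lborel)"
  proof (intro nn_integral_mono)
    fix x
    have "cmod (?g x) \<le> (\<Sum>j\<in>UNIV. norm w * cmod (g j x))"
      by (intro sum_norm_le) (auto simp: norm_mult intro!: mult_right_mono component_le_norm_cart)
    then have "cmod (?g x) powr p \<le> (\<Sum>j\<in>UNIV. norm w * cmod (g j x)) powr p"
      using p by (intro powr_mono2) auto
    also have "\<dots> \<le> real CARD('d) powr p * (\<Sum>j\<in>UNIV. (norm w * cmod (g j x)) powr p)"
      using p by (intro powr_sum_le) auto
    also have "\<dots> = (real CARD('d) * norm w) powr p * (\<Sum>j\<in>UNIV. cmod (g j x) powr p)"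
      by (simp add: powr_mult sum_distrib_left mult_ac)
    finally show "ennreal (cmod (?g x) powr p) \<le> ennreal ((real CARD('d) * norm w) powr p) * (\<Sum>j\<in>UNIV. ennreal (cmod (g j x) powr p))"
      by (simp add: ennreal_leI sum_nonneg flip: ennreal_mult)
  qed
  also have "\<dots> = ennreal ((real CARD('d) * norm w) powr p) * gradient_energy p g"
    unfolding gradient_energy_def nn_pint_def by (subst nn_integral_cmult) (auto simp: nn_integral_sum simp del: sum_ennreal)
  finally show ?thesis .
qed

section \<open>The Poincare inequality on compact subsets\<close>

text \<open>The Poincare inequality on \<open>A\<close>, with the gradient measured on the larger set \<open>\<Omega>\<close>. Measuring it on \<open>\<Omega>\<close>
makes the property stable under the unions and translations used below.\<close>

definition poincare_on :: "real \<Rightarrow> (real^'d::finite) set \<Rightarrow> (real^'d) set \<Rightarrow> bool" where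
  "poincare_on p \<Omega> A \<longleftrightarrow> open A \<and> A \<subseteq> \<Omega> \<and>
     (\<exists>C\<ge>0. \<forall>v g. has_weak_gradient \<Omega> v g \<longrightarrow> (\<exists>c. nn_pint p A (\<lambda>x. v x - c) \<le> ennreal C * gradient_energy p g))"

lemma has_weak_gradient_borel: "has_weak_gradient \<Omega> v g \<Longrightarrow> v \<in> borel_measurable borel"
  by (simp add: has_weak_gradient_def)

lemma emeasure_open_pos:
  assumes "open A" "A \<noteq> {}" shows "emeasure lborel A > 0"
proof (rule ccontr)
  assume "\<not> emeasure lborel A > 0"
  then have "A \<in> null_sets lborel" using assms(1) by (auto simp: null_sets_def)
  then have "negligible A" by (simp add: negligible_iff_null_sets null_sets_completionI)
  then show False using open_not_negligible[OF assms] by blast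
qed

lemma emeasure_eq_ennreal:
  assumes "bounded A" obtains m where "m \<ge> 0" "emeasure lborel A = ennreal m"
  using emeasure_bounded_finite[OF assms] by (cases "emeasure lborel A") auto

text \<open>The double integral of \<open>|v(x) - v(y)|\<^sup>p\<close> over the ball is, with \<open>y = x + w\<close>, an integral over \<open>|w| < 2r\<close> of the
left-hand side of the translation estimate; segments between points of the ball stay in it. So some \<open>y\<close> in
the ball is at most as bad as the average, and \<open>c = v(y)\<close> works.\<close>

lemma poincare_ball:
  fixes x0 :: "real^'d::finite"
  assumes p: "1 \<le> p" and r: "0 < r" and B: "ball x0 r \<subseteq> \<Omega>"
  shows "poincare_on p \<Omega> (ball x0 r)"
proof -
  let ?B = "ball x0 r"
  let ?D = "ball (0 :: real^'d) (2 * r)"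
  let ?k = "(real CARD('d) * (2 * r)) powr p"
  obtain b where b: "b \<ge> 0" "emeasure lborel ?B = ennreal b" using emeasure_eq_ennreal[OF bounded_ball] by metis
  obtain d where d: "d \<ge> 0" "emeasure lborel ?D = ennreal d" using emeasure_eq_ennreal[OF bounded_ball] by metis
  have b0: "b > 0" using emeasure_open_pos[of ?B] r b by simp
  have [measurable]: "ball x s \<in> sets borel" for x :: "real^'d" and s by simp
  \<comment> \<open>\<open>?k\<close> bounds the factor of the translation estimate for \<open>|w| < 2r\<close>; \<open>d\<close> and \<open>b\<close> are the volumes\<close>
  let ?C = "?k * d / b"
  have "\<exists>c. nn_pint p ?B (\<lambda>x. v x - c) \<le> ennreal ?C * gradient_energy p g" if vg: "has_weak_gradient \<Omega> v g" for v g
  proof (cases "gradient_energy p g = \<infinity> \<or> d = 0")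
    case True
    show ?thesis
    proof (cases "d = 0")
      case True
      have "emeasure lborel ?D > 0" using r by (intro emeasure_open_pos) auto
      then show ?thesis using True d by simp
    next
      case False
      then have "?C > 0" using d b0 r by simp
      then have "ennreal ?C \<noteq> 0" by (simp only: ennreal_eq_0_iff not_le)
      then have "ennreal ?C * gradient_energy p g = \<infinity>" using True False by (simp only: ennreal_mult_eq_top_iff simp_thms infinity_ennreal_def)
      then show ?thesis by simp
    qed
  next
    case False
    note v[measurable] = has_weak_gradient_borel[OF vg]
    define J where "J y = nn_pint p ?B (\<lambda>x. v x - v y)" for y
    have [measurable]: "J \<in> borel_measurable borel" unfolding J_def nn_pint_def by measurable
    have fixw: "(\<integral>\<^sup>+x. ennreal (cmod (v x - v (x + w)) powr p) * indicator ?B x * indicator ?B (x + w) \<partial>lborel)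
        \<le> ennreal ?k * gradient_energy p g * indicator ?D w" for w
    proof -
      let ?U = "?B \<inter> (\<lambda>x. x + w) -` ?B"
      have U: "open ?U" by (intro open_Int open_ball open_vimage continuous_intros)
      have seg: "x + s *\<^sub>R w \<in> \<Omega>" if "x \<in> ?U" "0 \<le> s" "s \<le> 1" for x s
      proof -
        have "(1 - s) *\<^sub>R x + s *\<^sub>R (x + w) \<in> ?B"
          using that by (intro convexD[OF convex_ball]) auto
        then show ?thesis using B by (auto simp: algebra_simps)
      qed
      have eq: "(\<integral>\<^sup>+x. ennreal (cmod (v x - v (x + w)) powr p) * indicator ?B x * indicator ?B (x + w) \<partial>lborel)
          = nn_pint p ?U (\<lambda>x. v (x + w) - v x)"
        unfolding nn_pint_def by (intro nn_integral_cong) (auto simp: indicator_def norm_minus_commute)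
      show ?thesis
      proof (cases "w \<in> ?D")
        case True
        have "nn_pint p ?U (\<lambda>x. v (x + w) - v x) \<le> ennreal ((real CARD('d) * norm w) powr p) * gradient_energy p g"
          by (rule translation_estimate[OF p vg U seg])
        also have "\<dots> \<le> ennreal ?k * gradient_energy p g"
          using True p by (intro mult_right_mono ennreal_leI powr_mono2 mult_left_mono) auto
        finally show ?thesis unfolding eq using True by simp
      next
        case False
        have "?U = {}"
        proof (rule ccontr)
          assume "?U \<noteq> {}"
          then obtain x where "dist x0 x < r" "dist x0 (x + w) < r" by auto
          then have "dist x (x + w) < 2 * r" using dist_triangle3[of x "x + w" x0] by simp
          then show False using False by (simp add: dist_norm)
        qed
        then have "nn_pint p ?U (\<lambda>x. v (x + w) - v x) = 0" by (simp add: nn_pint_def)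
        then show ?thesis unfolding eq by simp
      qed
    qed
    have "(\<integral>\<^sup>+y. J y * indicator ?B y \<partial>lborel)
       = (\<integral>\<^sup>+y. (\<integral>\<^sup>+x. ennreal (cmod (v x - v y) powr p) * indicator ?B x * indicator ?B y \<partial>lborel) \<partial>lborel)"
    proof (intro nn_integral_cong)
      fix y
      have "(\<lambda>x. ennreal (cmod (v x - v y) powr p) * indicator ?B x) \<in> borel_measurable lborel" by measurable
      from nn_integral_multc[OF this, of "indicator ?B y"]
      show "J y * indicator ?B y = (\<integral>\<^sup>+x. ennreal (cmod (v x - v y) powr p) * indicator ?B x * indicator ?B y \<partial>lborel)"
        unfolding J_def nn_pint_def by (rule sym)
    qed
    also have "\<dots> = (\<integral>\<^sup>+x. (\<integral>\<^sup>+y. ennreal (cmod (v x - v y) powr p) * indicator ?B x * indicator ?B y \<partial>lborel) \<partial>lborel)"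
      by (rule lborel_pair.Fubini'[symmetric]) measurable
    also have "\<dots> = (\<integral>\<^sup>+x. (\<integral>\<^sup>+w. ennreal (cmod (v x - v (x + w)) powr p) * indicator ?B x * indicator ?B (x + w) \<partial>lborel) \<partial>lborel)"
    proof (rule nn_integral_cong)
      fix x
      have m: "(\<lambda>y. ennreal (cmod (v x - v y) powr p) * indicator ?B x * indicator ?B y) \<in> borel_measurable borel" by measurable
      show "(\<integral>\<^sup>+y. ennreal (cmod (v x - v y) powr p) * indicator ?B x * indicator ?B y \<partial>lborel) =
        (\<integral>\<^sup>+w. ennreal (cmod (v x - v (x + w)) powr p) * indicator ?B x * indicator ?B (x + w) \<partial>lborel)"
        using nn_integral_lborel_translate[OF m, of x, symmetric] by (simp add: add.commute)
    qed
    also have "\<dots> = (\<integral>\<^sup>+w. (\<integral>\<^sup>+x. ennreal (cmod (v x - v (x + w)) powr p) * indicator ?B x * indicator ?B (x + w) \<partial>lborel) \<partial>lborel)"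
      by (rule lborel_pair.Fubini'[symmetric]) measurable
    also have "\<dots> \<le> (\<integral>\<^sup>+w. ennreal ?k * gradient_energy p g * indicator ?D w \<partial>lborel)"
      by (intro nn_integral_mono fixw)
    also have "\<dots> = ennreal ?k * gradient_energy p g * ennreal d"
      by (subst nn_integral_cmult_indicator) (auto simp: d)
    also have "\<dots> = ennreal ?C * gradient_energy p g * ennreal b"
    proof -
      have "ennreal ?C * ennreal b = ennreal ?k * ennreal d"
        using b0 d(1) by (simp flip: ennreal_mult)
      then show ?thesis by (metis mult.assoc mult.commute)
    qed
    finally have JB: "(\<integral>\<^sup>+y. J y * indicator ?B y \<partial>lborel) \<le> ennreal ?C * gradient_energy p g * ennreal b" .
    have "\<exists>y\<in>?B. J y \<le> ennreal ?C * gradient_energy p g"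
    proof (rule ccontr)
      let ?t = "ennreal ?C * gradient_energy p g"
      assume "\<not> (\<exists>y\<in>?B. J y \<le> ?t)"
      then have gt: "?t < J y" if "y \<in> ?B" for y using that by (simp add: not_le)
      have fin: "?t * ennreal b \<noteq> \<infinity>"
        using False by (simp add: ennreal_mult_eq_top_iff)
      have tb: "(\<integral>\<^sup>+y. ?t * indicator ?B y \<partial>lborel) = ?t * ennreal b"
        by (subst nn_integral_cmult_indicator) (auto simp: b)
      have "(\<integral>\<^sup>+y. ?t * indicator ?B y \<partial>lborel) < (\<integral>\<^sup>+y. J y * indicator ?B y \<partial>lborel)"
      proof (rule nn_integral_less)
        show "(\<integral>\<^sup>+y. ?t * indicator ?B y \<partial>lborel) \<noteq> \<infinity>" unfolding tb by (rule fin)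
        show "AE y in lborel. ?t * indicator ?B y \<le> J y * indicator ?B y"
          using gt by (auto simp: indicator_def less_imp_le)
        show "\<not> (AE y in lborel. J y * indicator ?B y \<le> ?t * indicator ?B y)"
        proof
          assume "AE y in lborel. J y * indicator ?B y \<le> ?t * indicator ?B y"
          then have "AE y in lborel. y \<notin> ?B"
          proof eventually_elim
            case (elim y)
            then show ?case using gt[of y] by (auto simp: indicator_def not_le split: if_splits)
          qed
          then have "?B \<in> null_sets lborel" by (subst AE_iff_null_sets) (auto simp del: mem_ball)
          then have "emeasure lborel ?B = 0" by (rule null_setsD1)
          then show False using b b0 by simp
        qed
      qed measurable
      then show False using JB unfolding tb by simp
    qed
    then show ?thesis unfolding J_def by blast
  qed
  moreover have "?C \<ge> 0" using b0 d(1) by simp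
  ultimately show ?thesis unfolding poincare_on_def using B by blast
qed

text \<open>If \<open>v\<close> is close to \<open>a\<close> on \<open>A\<close> and to \<open>c\<close> on \<open>B\<close>, then the two constants are close to each other because
the overlap has positive measure.\<close>

lemma poincare_Un:
  fixes A B :: "(real^'d::finite) set"
  assumes p: "1 \<le> p" and A: "poincare_on p \<Omega> A" and B: "poincare_on p \<Omega> B" and AB: "A \<inter> B \<noteq> {}" and bd: "bounded \<Omega>"
  shows "poincare_on p \<Omega> (A \<union> B)"
proof -
  obtain CA where CA: "CA \<ge> 0" "\<And>v g. has_weak_gradient \<Omega> v g \<Longrightarrow> \<exists>c. nn_pint p A (\<lambda>x. v x - c) \<le> ennreal CA * gradient_energy p g"
    and oA: "open A" "A \<subseteq> \<Omega>" using A unfolding poincare_on_def by blast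
  obtain CB where CB: "CB \<ge> 0" "\<And>v g. has_weak_gradient \<Omega> v g \<Longrightarrow> \<exists>c. nn_pint p B (\<lambda>x. v x - c) \<le> ennreal CB * gradient_energy p g"
    and oB: "open B" "B \<subseteq> \<Omega>" using B unfolding poincare_on_def by blast
  obtain m where m: "m \<ge> 0" "emeasure lborel (A \<inter> B) = ennreal m"
    using emeasure_eq_ennreal[of "A \<inter> B"] bounded_subset[OF bd, of "A \<inter> B"] oA by blast
  obtain b where b: "b \<ge> 0" "emeasure lborel B = ennreal b"
    using emeasure_eq_ennreal[of B] bounded_subset[OF bd, of B] oB by blast
  have m0: "m > 0" using emeasure_open_pos[of "A \<inter> B"] oA oB AB m by (simp add: open_Int)
  have [measurable]: "A \<in> sets borel" "B \<in> sets borel" using oA oB by auto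
  let ?t = "2 powr p :: real"
  let ?K = "?t * (CA + CB) * (b / m)"
  let ?C = "CA + ?t * (CB + ?K)"
  have K0: "?K \<ge> 0" using CA(1) CB(1) b m0 by simp
  have "\<exists>c. nn_pint p (A \<union> B) (\<lambda>x. v x - c) \<le> ennreal ?C * gradient_energy p g" if vg: "has_weak_gradient \<Omega> v g" for v g
  proof -
    let ?G = "gradient_energy p g"
    note [measurable] = has_weak_gradient_borel[OF vg]
    obtain a where a: "nn_pint p A (\<lambda>x. v x - a) \<le> ennreal CA * ?G" using CA(2)[OF vg] by blast
    obtain c where c: "nn_pint p B (\<lambda>x. v x - c) \<le> ennreal CB * ?G" using CB(2)[OF vg] by blast
    have "ennreal (cmod (c - a) powr p) * ennreal m = nn_pint p (A \<inter> B) (\<lambda>x. c - a)"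
      by (subst nn_pint_const) (auto simp: m)
    also have "\<dots> \<le> ennreal ?t * (nn_pint p (A \<inter> B) (\<lambda>x. v x - a) + nn_pint p (A \<inter> B) (\<lambda>x. c - v x))"
      by (rule nn_pint_add_le[OF p]) auto
    also have "\<dots> \<le> ennreal ?t * (nn_pint p A (\<lambda>x. v x - a) + nn_pint p B (\<lambda>x. v x - c))"
      by (subst (2) nn_pint_minus_commute) (intro mult_left_mono add_mono nn_pint_mono, auto)
    also have "\<dots> \<le> ennreal ?t * (ennreal CA * ?G + ennreal CB * ?G)"
      by (intro mult_left_mono add_mono a c) auto
    also have "\<dots> = ennreal (?t * (CA + CB)) * ?G"
      using CA(1) CB(1) by (simp add: ennreal_mult distrib_right mult.assoc)
    finally have "ennreal (b / m) * (ennreal (cmod (c - a) powr p) * ennreal m) \<le> ennreal (b / m) * (ennreal (?t * (CA + CB)) * ?G)"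
      by (rule mult_left_mono) simp
    also have "\<dots> = ennreal ?K * ?G"
    proof -
      have "ennreal (b / m) * ennreal (?t * (CA + CB)) = ennreal (b / m * (?t * (CA + CB)))"
        using CA(1) CB(1) b(1) m0 by (intro ennreal_mult[symmetric]) auto
      also have "b / m * (?t * (CA + CB)) = ?K" by (rule mult.commute)
      finally show ?thesis by (simp only: mult.assoc[symmetric])
    qed
    also have "ennreal (b / m) * (ennreal (cmod (c - a) powr p) * ennreal m) = ennreal (cmod (c - a) powr p) * ennreal b"
    proof -
      have "ennreal (b / m) * ennreal m = ennreal b" using b(1) m0 by (simp flip: ennreal_mult)
      then show ?thesis by (metis mult.assoc mult.commute)
    qed
    finally have ca: "nn_pint p B (\<lambda>x. c - a) \<le> ennreal ?K * ?G" by (subst nn_pint_const) (auto simp: b)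
    have "nn_pint p B (\<lambda>x. v x - a) \<le> ennreal ?t * (nn_pint p B (\<lambda>x. v x - c) + nn_pint p B (\<lambda>x. c - a))"
      by (rule nn_pint_add_le[OF p]) auto
    also have "\<dots> \<le> ennreal ?t * (ennreal CB * ?G + ennreal ?K * ?G)"
      by (intro mult_left_mono add_mono c ca) auto
    finally have Ba: "nn_pint p B (\<lambda>x. v x - a) \<le> ennreal ?t * (ennreal CB * ?G + ennreal ?K * ?G)" .
    have "nn_pint p (A \<union> B) (\<lambda>x. v x - a) \<le> nn_pint p A (\<lambda>x. v x - a) + nn_pint p B (\<lambda>x. v x - a)"
      by (rule nn_pint_Un_le) auto
    also have "\<dots> \<le> ennreal CA * ?G + ennreal ?t * (ennreal CB * ?G + ennreal ?K * ?G)"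
      by (intro add_mono a Ba)
    also have "\<dots> = (ennreal CA + ennreal ?t * (ennreal CB + ennreal ?K)) * ?G"
      by (simp only: distrib_right mult.assoc)
    also have "ennreal CA + ennreal ?t * (ennreal CB + ennreal ?K) = ennreal ?C"
      using CA(1) CB(1) K0 by (simp only: ennreal_plus[symmetric] ennreal_mult[symmetric] powr_ge_zero add_nonneg_nonneg mult_nonneg_nonneg)
    finally show ?thesis by blast
  qed
  moreover have "?C \<ge> 0" using CA(1) CB(1) K0 by simp
  ultimately show ?thesis unfolding poincare_on_def using oA oB by blast
qed

text \<open>On \<open>E\<close> compare \<open>v\<close> with its translate, which takes its values from \<open>A\<close>.\<close>

lemma poincare_shift:
  fixes A E :: "(real^'d::finite) set"
  assumes p: "1 \<le> p" and A: "poincare_on p \<Omega> A" and E: "open E" "E \<subseteq> \<Omega>"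
    and seg: "\<And>x s. x \<in> E \<Longrightarrow> 0 \<le> s \<Longrightarrow> s \<le> 1 \<Longrightarrow> x + s *\<^sub>R w \<in> \<Omega>"
    and EA: "\<And>x. x \<in> E \<Longrightarrow> x + w \<in> A"
  shows "poincare_on p \<Omega> (A \<union> E)"
proof -
  obtain CA where CA: "CA \<ge> 0" "\<And>v g. has_weak_gradient \<Omega> v g \<Longrightarrow> \<exists>c. nn_pint p A (\<lambda>x. v x - c) \<le> ennreal CA * gradient_energy p g"
    and oA: "open A" "A \<subseteq> \<Omega>" using A unfolding poincare_on_def by blast
  have [measurable]: "A \<in> sets borel" "E \<in> sets borel" using oA E by auto
  let ?t = "2 powr p :: real"
  let ?K = "(real CARD('d) * norm w) powr p"
  let ?C = "CA + ?t * (?K + CA)"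
  have "\<exists>c. nn_pint p (A \<union> E) (\<lambda>x. v x - c) \<le> ennreal ?C * gradient_energy p g" if vg: "has_weak_gradient \<Omega> v g" for v g
  proof -
    let ?G = "gradient_energy p g"
    note [measurable] = has_weak_gradient_borel[OF vg]
    obtain c where c: "nn_pint p A (\<lambda>x. v x - c) \<le> ennreal CA * ?G" using CA(2)[OF vg] by blast
    have 1: "nn_pint p E (\<lambda>x. v x - v (x + w)) \<le> ennreal ?K * ?G"
      by (subst nn_pint_minus_commute) (rule translation_estimate[OF p vg E(1) seg])
    have "nn_pint p E (\<lambda>x. v (x + w) - c) \<le> nn_pint p A (\<lambda>x. v x - c)"
      by (rule nn_pint_translate_le[of "\<lambda>x. v x - c"]) (auto simp: EA)
    also note c
    finally have 2: "nn_pint p E (\<lambda>x. v (x + w) - c) \<le> ennreal CA * ?G" .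
    have "nn_pint p E (\<lambda>x. v x - c) \<le> ennreal ?t * (nn_pint p E (\<lambda>x. v x - v (x + w)) + nn_pint p E (\<lambda>x. v (x + w) - c))"
      by (rule nn_pint_add_le[OF p]) auto
    also have "\<dots> \<le> ennreal ?t * (ennreal ?K * ?G + ennreal CA * ?G)"
      by (intro mult_left_mono add_mono 1 2) auto
    finally have 3: "nn_pint p E (\<lambda>x. v x - c) \<le> ennreal ?t * (ennreal ?K * ?G + ennreal CA * ?G)" .
    have "nn_pint p (A \<union> E) (\<lambda>x. v x - c) \<le> nn_pint p A (\<lambda>x. v x - c) + nn_pint p E (\<lambda>x. v x - c)"
      by (rule nn_pint_Un_le) auto
    also have "\<dots> \<le> ennreal CA * ?G + ennreal ?t * (ennreal ?K * ?G + ennreal CA * ?G)"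
      by (intro add_mono c 3)
    also have "\<dots> = (ennreal CA + ennreal ?t * (ennreal ?K + ennreal CA)) * ?G"
      by (simp only: distrib_right mult.assoc)
    also have "ennreal CA + ennreal ?t * (ennreal ?K + ennreal CA) = ennreal ?C"
      using CA(1) by (simp only: ennreal_plus[symmetric] ennreal_mult[symmetric] powr_ge_zero add_nonneg_nonneg mult_nonneg_nonneg)
    finally show ?thesis by blast
  qed
  moreover have "?C \<ge> 0" using CA(1) by simp
  ultimately show ?thesis unfolding poincare_on_def using oA E by blast
qed

lemma poincare_empty: "poincare_on p \<Omega> {}"
  unfolding poincare_on_def by (simp add: nn_pint_def) (rule exI[of _ 0], simp)

text \<open>The points reachable from \<open>x\<^sub>0\<close> through sets with the Poincare inequality form an open set, and by joining
a ball around a limit point also a relatively closed one.\<close>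

lemma poincare_connect:
  fixes \<Omega> :: "(real^'d::finite) set"
  assumes p: "1 \<le> p" and \<Omega>: "open \<Omega>" "connected \<Omega>" "bounded \<Omega>" and x0: "x0 \<in> \<Omega>" and y: "y \<in> \<Omega>"
  shows "\<exists>A. poincare_on p \<Omega> A \<and> x0 \<in> A \<and> y \<in> A"
proof -
  define S where "S = \<Union>{A. poincare_on p \<Omega> A \<and> x0 \<in> A}"
  have oS: "open S" unfolding S_def by (auto simp: poincare_on_def)
  have sub: "S \<subseteq> \<Omega>" unfolding S_def by (auto simp: poincare_on_def)
  obtain r where "r > 0" "ball x0 r \<subseteq> \<Omega>" using \<Omega>(1) x0 by (meson open_contains_ball)
  then have "poincare_on p \<Omega> (ball x0 r)" "x0 \<in> ball x0 r" by (auto intro: poincare_ball[OF p])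
  then have x0S: "x0 \<in> S" unfolding S_def by blast
  have oT: "open (\<Omega> - S)"
  proof (subst open_subopen, intro ballI)
    fix z assume z: "z \<in> \<Omega> - S"
    then obtain r where r: "r > 0" "ball z r \<subseteq> \<Omega>" using \<Omega>(1) by (meson DiffD1 open_contains_ball)
    have "ball z r \<inter> S = {}"
    proof (rule ccontr)
      assume "ball z r \<inter> S \<noteq> {}"
      then obtain A where A: "poincare_on p \<Omega> A" "x0 \<in> A" "A \<inter> ball z r \<noteq> {}" unfolding S_def by blast
      have "poincare_on p \<Omega> (A \<union> ball z r)"
        by (rule poincare_Un[OF p A(1) poincare_ball[OF p r] A(3) \<Omega>(3)])
      then have "A \<union> ball z r \<subseteq> S" unfolding S_def using A(2) by blast
      moreover have "z \<in> ball z r" using r(1) by simp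
      ultimately show False using z by blast
    qed
    then show "\<exists>T. open T \<and> z \<in> T \<and> T \<subseteq> \<Omega> - S" using r by (intro exI[of _ "ball z r"]) auto
  qed
  have "\<Omega> - S = {}"
  proof (rule ccontr)
    assume "\<Omega> - S \<noteq> {}"
    then show False
      using connectedD[OF \<Omega>(2) oS oT] x0 x0S sub by auto
  qed
  then have "y \<in> S" using y by blast
  then show ?thesis unfolding S_def by blast
qed

lemma poincare_compact:
  fixes \<Omega> :: "(real^'d::finite) set"
  assumes p: "1 \<le> p" and \<Omega>: "open \<Omega>" "connected \<Omega>" "bounded \<Omega>" and K: "compact K" "K \<subseteq> \<Omega>"
  shows "\<exists>A. poincare_on p \<Omega> A \<and> K \<subseteq> A"
proof (cases "K = {}")
  case True
  then show ?thesis using poincare_empty by blast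
next
  case False
  then obtain x0 where x0: "x0 \<in> \<Omega>" using K by blast
  let ?\<A> = "{A. poincare_on p \<Omega> A \<and> x0 \<in> A}"
  have "\<And>A. A \<in> ?\<A> \<Longrightarrow> open A" by (simp add: poincare_on_def)
  moreover have "K \<subseteq> \<Union>?\<A>" using poincare_connect[OF p \<Omega> x0] K(2) by blast
  ultimately obtain F where F: "F \<subseteq> ?\<A>" "finite F" "K \<subseteq> \<Union>F"
    using compactE[OF K(1), of ?\<A>] by metis
  have "F = {} \<or> poincare_on p \<Omega> (\<Union>F) \<and> x0 \<in> \<Union>F"
    using F(2,1)
  proof (induction F rule: finite_induct)
    case (insert A F)
    then have A: "poincare_on p \<Omega> A" "x0 \<in> A" by auto
    show ?case
    proof (cases "F = {}")
      case False
      then have "poincare_on p \<Omega> (\<Union>F)" "x0 \<in> \<Union>F" using insert by auto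
      then show ?thesis using poincare_Un[OF p A(1), of "\<Union>F"] A(2) \<Omega>(3) by auto
    qed (use A in auto)
  qed simp
  then show ?thesis using F(3) False by auto
qed

section \<open>The Poincare inequality on Lipschitz domains\<close>

text \<open>In the local coordinates at \<open>y\<close> take for \<open>N\<close> a cylinder of height \<open>2b / 3\<close> around the graph of \<open>h\<close>, and for
\<open>w\<close> the vector of length \<open>b / 3\<close> along the axis. The part of \<open>N\<close> inside \<open>\<Omega>\<close> has height less than \<open>b / 3\<close> above
the graph, so \<open>w\<close> moves it to heights between \<open>b / 3\<close> and \<open>2b / 3\<close> over a closed ball of
the base; these points form a compact subset of \<open>\<Omega>\<close>.\<close>

lemma boundary_patch:
  fixes \<Omega> :: "(real^'d::finite) set"
  assumes \<Omega>: "open \<Omega>" and lip: "lipschitz_boundary \<Omega>" and y: "y \<in> frontier \<Omega>"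
  shows "\<exists>N w K. open N \<and> y \<in> N \<and> compact K \<and> K \<subseteq> \<Omega> \<and>
    (\<forall>u\<in>N \<inter> \<Omega>. u + w \<in> K \<and> (\<forall>s. 0 \<le> s \<longrightarrow> s \<le> 1 \<longrightarrow> u + s *\<^sub>R w \<in> \<Omega>))"
proof -
  obtain a b i e T h V L where ab: "a > 0" "b > 0"
    and rm: "rigid_motion (T i)" and hl: "L-lipschitz_on (closure (base_cube (e i) a)) (h i)"
    and V: "open V" "y \<in> V"
    and V1: "V \<inter> frontier \<Omega> = {T i (x + h i x *\<^sub>R axis (e i) 1) | x. x \<in> base_cube (e i) a}"
    and V2: "V \<inter> \<Omega> = {T i (x + t *\<^sub>R axis (e i) 1) | x t. x \<in> base_cube (e i) a \<and> h i x < t \<and> t < h i x + b}"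
    and V3: "V \<inter> - closure \<Omega> = {T i (x + t *\<^sub>R axis (e i) 1) | x t. x \<in> base_cube (e i) a \<and> h i x - b < t \<and> t < h i x}"
    by (insert lip[unfolded lipschitz_boundary_def])
       (elim exE conjE, drule bspec[OF _ y], elim exE conjE bexE, drule bspec, assumption,
        elim exE conjE, (rule that; assumption))
  define n where "n = (axis (e i) 1 :: real^'d)"
  let ?e = "e i" and ?h = "h i"
  note V1 = V1[folded n_def] and V2 = V2[folded n_def] and V3 = V3[folded n_def]
  have n_e: "n $ ?e = 1" by (simp add: n_def)
  from rm obtain c A where A: "orthogonal_transformation A" and T: "T i = (\<lambda>z. c + A z)"
    unfolding rigid_motion_def by (elim exE conjE) (rule that)
  have hc: "continuous_on (base_cube ?e a) ?h"
    by (rule continuous_on_subset[OF lipschitz_on_continuous_on[OF hl] closure_subset])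
  have linA: "linear A" using A by (rule orthogonal_transformation_linear)
  define S where "S u = inv A (u - c)" for u
  have ST: "S (T i z) = z" for z
    using orthogonal_transformation_bij[OF A] by (simp add: S_def T bij_is_inj)
  have TS: "T i (S u) = u" for u
    using orthogonal_transformation_bij[OF A] by (simp add: S_def T bij_is_surj surj_f_inv_f)
  have contS: "continuous_on X S" for X
    unfolding S_def
    by (rule linear_continuous_on_compose[OF _ orthogonal_transformation_linear[OF orthogonal_transformation_inv[OF A]]])
       (intro continuous_intros)
  have contT: "continuous_on X (T i)" for X
    unfolding T by (intro continuous_intros linear_continuous_on_compose[OF continuous_on_id linA])
  define P where "P z = z - (z $ ?e) *\<^sub>R n" for z :: "real^'d"
  have P_e: "P z $ ?e = 0" for z by (simp add: P_def n_e)
  have Pz: "P z + (z $ ?e) *\<^sub>R n = z" for z by (simp add: P_def)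
  have contP: "continuous_on X P" for X unfolding P_def by (intro continuous_intros)
  from V(2) y V1 obtain x0 where x0: "x0 \<in> base_cube ?e a" and y0: "y = T i (x0 + ?h x0 *\<^sub>R n)" by blast
  let ?O = "\<Inter>j\<in>UNIV - {?e}. {x :: real^'d. \<bar>x $ j\<bar> < a}"
  have "open ?O" by (intro open_INT ballI open_Collect_less continuous_intros) auto
  moreover have "x0 \<in> ?O" using x0 by (auto simp: base_cube_def)
  ultimately obtain \<delta> where \<delta>: "\<delta> > 0" "cball x0 \<delta> \<subseteq> ?O" by (meson open_contains_cball)
  have cube: "x \<in> base_cube ?e a" if "x \<in> cball x0 \<delta>" "x $ ?e = 0" for x
    using \<delta>(2) that by (auto simp: base_cube_def)
  define Q where "Q = P -` ball x0 \<delta>"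
  define N0 where "N0 = (\<lambda>z. \<bar>z $ ?e - ?h (P z)\<bar>) -` {..<b / 3} \<inter> Q"
  define N where "N = S -` N0"
  define w where "w = A ((b / 3) *\<^sub>R n)"
  define K where "K = T i ` (\<lambda>(x, t). x + (?h x + t) *\<^sub>R n) ` ((cball x0 \<delta> \<inter> {x. x $ ?e = 0}) \<times> {b / 3..2 * b / 3})"
  have PQ: "P z \<in> base_cube ?e a" if "z \<in> Q" for z
    using that P_e by (intro cube) (auto simp: Q_def)
  have oQ: "open Q" unfolding Q_def by (intro open_vimage open_ball contP)
  have "continuous_on Q (\<lambda>z. ?h (P z))"
    by (rule continuous_on_compose2[OF hc contP]) (use PQ in auto)
  then have "continuous_on Q (\<lambda>z. \<bar>z $ ?e - ?h (P z)\<bar>)" by (intro continuous_intros)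
  from continuous_on_open_vimage[OF oQ, THEN iffD1, OF this, rule_format, OF open_lessThan]
  have oN0: "open N0" unfolding N0_def .
  have oN: "open N" unfolding N_def by (rule open_vimage[OF oN0 contS])
  have yN: "y \<in> N"
  proof -
    have "x0 $ ?e = 0" using x0 by (simp add: base_cube_def)
    then have "(x0 + ?h x0 *\<^sub>R n) $ ?e = ?h x0" "P (x0 + ?h x0 *\<^sub>R n) = x0"
      by (simp_all add: P_def n_e)
    then show ?thesis using \<delta>(1) ab(2) by (simp add: N_def y0 ST N0_def Q_def)
  qed
  have compK: "compact K"
  proof -
    have "closed {x :: real^'d. x $ ?e = 0}" by (intro closed_Collect_eq continuous_intros)
    then have c: "compact (cball x0 \<delta> \<inter> {x. x $ ?e = 0})" by (intro compact_Int_closed compact_cball)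
    have "continuous_on ((cball x0 \<delta> \<inter> {x. x $ ?e = 0}) \<times> {b / 3..2 * b / 3}) (\<lambda>p. ?h (fst p))"
      by (rule continuous_on_compose2[OF hc continuous_on_fst[OF continuous_on_id]]) (use cube in auto)
    then show ?thesis unfolding K_def
      by (intro compact_continuous_image contT compact_Times c) (auto simp: case_prod_unfold intro!: continuous_intros)
  qed
  have KS: "K \<subseteq> \<Omega>"
  proof
    fix u assume "u \<in> K"
    then obtain x t where x: "x \<in> cball x0 \<delta>" "x $ ?e = 0" and t: "b / 3 \<le> t" "t \<le> 2 * b / 3"
      and u: "u = T i (x + (?h x + t) *\<^sub>R n)"
      unfolding K_def by auto
    have "?h x < ?h x + t" "?h x + t < ?h x + b" using t ab by auto
    then have "u \<in> V \<inter> \<Omega>" unfolding V2 u using cube[OF x] by blast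
    then show "u \<in> \<Omega>" by blast
  qed
  have main: "u + w \<in> K \<and> (\<forall>s. 0 \<le> s \<longrightarrow> s \<le> 1 \<longrightarrow> u + s *\<^sub>R w \<in> \<Omega>)" if u: "u \<in> N \<inter> \<Omega>" for u
  proof -
    define z where "z = S u"
    let ?x = "P z" and ?t = "z $ ?e"
    have uz: "u = T i (?x + ?t *\<^sub>R n)" by (simp add: Pz z_def TS)
    have z: "z \<in> N0" using u by (simp add: N_def z_def)
    then have xc: "?x \<in> base_cube ?e a" and xb: "?x \<in> ball x0 \<delta>" using PQ by (auto simp: N0_def Q_def)
    have near: "\<bar>?t - ?h ?x\<bar> < b / 3" using z by (simp add: N0_def)
    \<comment> \<open>the three descriptions of \<open>V\<close> decide the side of the graph on which \<open>u\<close> lies\<close>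
    have "?t \<noteq> ?h ?x"
    proof
      assume "?t = ?h ?x"
      then have "u = T i (?x + ?h ?x *\<^sub>R n)" using uz by simp
      then have "u \<in> V \<inter> frontier \<Omega>" unfolding V1 using xc by blast
      then show False using u \<Omega> by (simp add: frontier_def interior_open)
    qed
    moreover have "\<not> ?t < ?h ?x"
    proof
      assume "?t < ?h ?x"
      then have "?h ?x - b < ?t \<and> ?t < ?h ?x" using near ab(2) by auto
      then have "u \<in> V \<inter> - closure \<Omega>" unfolding V3 using xc uz by blast
      then show False using u closure_subset[of \<Omega>] by auto
    qed
    ultimately have t: "?h ?x < ?t" by simp
    have sw: "u + s *\<^sub>R w = T i (?x + (?t + s * (b / 3)) *\<^sub>R n)" for s
    proof -
      have "T i (?x + (?t + s * (b / 3)) *\<^sub>R n) = T i ((?x + ?t *\<^sub>R n) + s *\<^sub>R ((b / 3) *\<^sub>R n))"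
        by (simp add: algebra_simps)
      also have "\<dots> = u + s *\<^sub>R w"
        unfolding uz w_def T by (simp only: linear_add[OF linA] linear_scale[OF linA] add.assoc)
      finally show ?thesis by simp
    qed
    have "u + s *\<^sub>R w \<in> \<Omega>" if s: "0 \<le> s" "s \<le> 1" for s
    proof -
      have "0 \<le> s * (b / 3)" "s * (b / 3) \<le> 1 * (b / 3)" using s ab by (auto intro!: mult_right_mono)
      moreover have "?t - ?h ?x < b / 3" using near by (rule abs_le_D1[THEN le_less_trans, OF order_refl])
      ultimately have "?h ?x < ?t + s * (b / 3)" "?t + s * (b / 3) < ?h ?x + b" using t ab(2) by linarith+
      then have "u + s *\<^sub>R w \<in> V \<inter> \<Omega>" unfolding V2 sw using xc by blast
      then show ?thesis by blast
    qed
    moreover have "u + w \<in> K"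
    proof -
      have "(?x, ?t - ?h ?x + b / 3) \<in> (cball x0 \<delta> \<inter> {x. x $ ?e = 0}) \<times> {b / 3..2 * b / 3}"
        using xb P_e t near by auto
      then have "T i ((\<lambda>(x, t). x + (?h x + t) *\<^sub>R n) (?x, ?t - ?h ?x + b / 3)) \<in> K"
        unfolding K_def by (intro imageI)
      then show ?thesis using sw[of 1] by simp
    qed
    ultimately show ?thesis by blast
  qed
  show ?thesis using oN yN compK KS main by blast
qed

text \<open>Finitely many boundary patches cover the boundary. The rest of \<open>\<Omega>\<close> and the compact sets into which the
patches are shifted lie in one set with the Poincare inequality; add the patches one at a time.\<close>

lemma poincare_lipschitz:
  fixes \<Omega> :: "(real^'d::finite) set"
  assumes p: "1 \<le> p" and \<Omega>: "open \<Omega>" "connected \<Omega>" "bounded \<Omega>" and lip: "lipschitz_boundary \<Omega>"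
  shows "poincare_on p \<Omega> \<Omega>"
proof -
  let ?patch = "\<lambda>y N w K. open N \<and> y \<in> N \<and> compact K \<and> K \<subseteq> \<Omega> \<and>
    (\<forall>u\<in>N \<inter> \<Omega>. u + w \<in> K \<and> (\<forall>s. 0 \<le> s \<longrightarrow> s \<le> 1 \<longrightarrow> u + s *\<^sub>R w \<in> \<Omega>))"
  have "\<forall>y\<in>frontier \<Omega>. \<exists>q. ?patch y (fst q) (fst (snd q)) (snd (snd q))"
  proof
    fix y assume "y \<in> frontier \<Omega>"
    from boundary_patch[OF \<Omega>(1) lip this] obtain N w K where "?patch y N w K" by blast
    then show "\<exists>q. ?patch y (fst q) (fst (snd q)) (snd (snd q))" by (intro exI[of _ "(N, w, K)"]) simp
  qed
  from bchoice[OF this] obtain q where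
    q: "\<And>y. y \<in> frontier \<Omega> \<Longrightarrow> ?patch y (fst (q y)) (fst (snd (q y))) (snd (snd (q y)))" by blast
  define N w K where "N y = fst (q y)" and "w y = fst (snd (q y))" and "K y = snd (snd (q y))" for y
  have N: "open (N y)" "y \<in> N y" and K: "compact (K y)" "K y \<subseteq> \<Omega>" if "y \<in> frontier \<Omega>" for y
    using q[OF that] by (auto simp: N_def K_def)
  have w: "u + w y \<in> K y" "0 \<le> s \<Longrightarrow> s \<le> 1 \<Longrightarrow> u + s *\<^sub>R w y \<in> \<Omega>" if "y \<in> frontier \<Omega>" "u \<in> N y \<inter> \<Omega>" for y u s
    using q[OF that(1)] that(2) by (auto simp: N_def K_def w_def)
  have "compact (frontier \<Omega>)" using \<Omega>(3) by (rule compact_frontier_bounded)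
  moreover have "frontier \<Omega> \<subseteq> (\<Union>y\<in>frontier \<Omega>. N y)" using N(2) by blast
  ultimately obtain F where F: "F \<subseteq> frontier \<Omega>" "finite F" "frontier \<Omega> \<subseteq> (\<Union>y\<in>F. N y)"
    using compactE_image[of "frontier \<Omega>" "frontier \<Omega>" N] N(1) by metis
  let ?K = "(closure \<Omega> - (\<Union>y\<in>F. N y)) \<union> (\<Union>y\<in>F. K y)"
  have "open (\<Union>y\<in>F. N y)" using N(1) F(1) by blast
  then have "compact (closure \<Omega> - (\<Union>y\<in>F. N y))"
    using \<Omega>(3) by (intro compact_diff) (simp_all add: compact_closure)
  moreover have "compact (\<Union>y\<in>F. K y)" using F K(1) by (intro compact_UN) auto
  ultimately have "compact ?K" by (rule compact_Un)
  moreover have "?K \<subseteq> \<Omega>"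
  proof -
    have "closure \<Omega> - frontier \<Omega> \<subseteq> \<Omega>" using \<Omega>(1) by (auto simp: frontier_def interior_open)
    then show ?thesis using F(1,3) K(2) by blast
  qed
  ultimately obtain A where A: "poincare_on p \<Omega> A" "?K \<subseteq> A" using poincare_compact[OF p \<Omega>] by blast
  have "poincare_on p \<Omega> (A \<union> (\<Union>y\<in>F'. N y \<inter> \<Omega>))" if "finite F'" "F' \<subseteq> F" for F'
    using that
  proof (induction F' rule: finite_induct)
    case empty
    then show ?case using A(1) by simp
  next
    case (insert y F')
    then have y: "y \<in> frontier \<Omega>" "y \<in> F" using F(1) by auto
    have "poincare_on p \<Omega> ((A \<union> (\<Union>y\<in>F'. N y \<inter> \<Omega>)) \<union> (N y \<inter> \<Omega>))"
    proof (rule poincare_shift[OF p, where w="w y"])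
      show "poincare_on p \<Omega> (A \<union> (\<Union>y\<in>F'. N y \<inter> \<Omega>))" using insert by blast
      show "open (N y \<inter> \<Omega>)" using N(1)[OF y(1)] \<Omega>(1) by blast
      show "x + w y \<in> A \<union> (\<Union>y\<in>F'. N y \<inter> \<Omega>)" if "x \<in> N y \<inter> \<Omega>" for x
        using w(1)[OF y(1) that] y(2) A(2) by blast
    qed (use w(2)[OF y(1)] in auto)
    then show ?case by (simp add: Un_ac)
  qed
  then have "poincare_on p \<Omega> (A \<union> (\<Union>y\<in>F. N y \<inter> \<Omega>))" using F(2) by blast
  moreover have "A \<union> (\<Union>y\<in>F. N y \<inter> \<Omega>) = \<Omega>"
    using A closure_subset[of \<Omega>] by (auto simp: poincare_on_def)
  ultimately show ?thesis by simp
qed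

section \<open>Functions with integrable powers\<close>

text \<open>The \<open>p\<close>-th power of the \<open>L\<^sup>p\<close> norm.\<close>

definition pint :: "(real^'d::finite) set \<Rightarrow> real \<Rightarrow> (real^'d \<Rightarrow> complex) \<Rightarrow> real" where
  "pint \<Omega> p u = (\<integral>x. cmod (u x) powr p \<partial>lebesgue_on \<Omega>)"

lemma pint_nonneg: "0 \<le> pint \<Omega> p u"
  unfolding pint_def by (rule Bochner_Integration.integral_nonneg) simp

lemma Lp_onD:
  assumes "u \<in> Lp_on \<Omega> p"
  shows "u \<in> borel_measurable (lebesgue_on \<Omega>)" "integrable (lebesgue_on \<Omega>) (\<lambda>x. cmod (u x) powr p)"
  using assms by (auto simp: Lp_on_def)

lemma Lp_on_dominated:
  assumes "u \<in> borel_measurable (lebesgue_on \<Omega>)" "integrable (lebesgue_on \<Omega>) b" "\<And>x. cmod (u x) powr p \<le> b x"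
  shows "u \<in> Lp_on \<Omega> p"
proof -
  note [measurable] = assms(1)
  have "integrable (lebesgue_on \<Omega>) (\<lambda>x. cmod (u x) powr p)"
  proof (rule Bochner_Integration.integrable_bound[OF assms(2)])
    show "AE x in lebesgue_on \<Omega>. norm (cmod (u x) powr p) \<le> norm (b x)"
      using assms(3) by (intro AE_I2) (simp add: order_trans[OF _ abs_ge_self])
  qed measurable
  then show ?thesis using assms(1) by (simp add: Lp_on_def)
qed

lemma Lp_on_cmult: "u \<in> Lp_on \<Omega> p \<Longrightarrow> (\<lambda>x. c * u x) \<in> Lp_on \<Omega> p"
  by (auto simp: Lp_on_def norm_mult powr_mult)

lemma pint_cmult: "pint \<Omega> p (\<lambda>x. c * u x) = cmod c powr p * pint \<Omega> p u"
  by (simp add: pint_def norm_mult powr_mult)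

lemma Lp_on_add:
  assumes p: "1 \<le> p" and u: "u \<in> Lp_on \<Omega> p" and v: "v \<in> Lp_on \<Omega> p"
  shows "(\<lambda>x. u x + v x) \<in> Lp_on \<Omega> p"
proof (rule Lp_on_dominated)
  show "(\<lambda>x. u x + v x) \<in> borel_measurable (lebesgue_on \<Omega>)" using Lp_onD(1)[OF u] Lp_onD(1)[OF v] by measurable
  show "integrable (lebesgue_on \<Omega>) (\<lambda>x. 2 powr p * (cmod (u x) powr p + cmod (v x) powr p))"
    using Lp_onD(2)[OF u] Lp_onD(2)[OF v] by auto
  fix x
  have "cmod (u x + v x) powr p \<le> (cmod (u x) + cmod (v x)) powr p"
    using p by (intro powr_mono2 norm_triangle_ineq) auto
  also have "\<dots> \<le> 2 powr p * (cmod (u x) powr p + cmod (v x) powr p)" by (rule powr_add_le[OF p]) auto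
  finally show "cmod (u x + v x) powr p \<le> 2 powr p * (cmod (u x) powr p + cmod (v x) powr p)" .
qed

lemma pint_convex:
  assumes p: "1 \<le> p" and u: "u \<in> Lp_on \<Omega> p" and v: "v \<in> Lp_on \<Omega> p" and t: "0 \<le> t" "t \<le> 1"
  shows "pint \<Omega> p (\<lambda>x. of_real (1 - t) * u x + of_real t * v x) \<le> (1 - t) * pint \<Omega> p u + t * pint \<Omega> p v"
proof -
  have w: "(\<lambda>x. of_real (1 - t) * u x + of_real t * v x) \<in> Lp_on \<Omega> p"
    by (intro Lp_on_add Lp_on_cmult p u v)
  have "pint \<Omega> p (\<lambda>x. of_real (1 - t) * u x + of_real t * v x) \<le> (\<integral>x. (1 - t) * cmod (u x) powr p + t * cmod (v x) powr p \<partial>lebesgue_on \<Omega>)"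
    unfolding pint_def
  proof (rule integral_mono[OF Lp_onD(2)[OF w]])
    show "integrable (lebesgue_on \<Omega>) (\<lambda>x. (1 - t) * cmod (u x) powr p + t * cmod (v x) powr p)"
      using Lp_onD(2)[OF u] Lp_onD(2)[OF v] by auto
    fix x
    have "cmod (of_real (1 - t) * u x + of_real t * v x) \<le> cmod (of_real (1 - t) * u x) + cmod (of_real t * v x)"
      by (rule norm_triangle_ineq)
    also have "\<dots> = (1 - t) * cmod (u x) + t * cmod (v x)" using t by (simp only: norm_mult norm_of_real abs_of_nonneg diff_ge_0_iff_ge)
    finally have "cmod (of_real (1 - t) * u x + of_real t * v x) powr p \<le> ((1 - t) * cmod (u x) + t * cmod (v x)) powr p"
      using p by (intro powr_mono2) auto
    also have "\<dots> \<le> (1 - t) * cmod (u x) powr p + t * cmod (v x) powr p"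
      by (rule powr_convex_combination[OF p _ _ t]) auto
    finally show "cmod (of_real (1 - t) * u x + of_real t * v x) powr p \<le> (1 - t) * cmod (u x) powr p + t * cmod (v x) powr p" .
  qed
  also have "\<dots> = (1 - t) * pint \<Omega> p u + t * pint \<Omega> p v"
    unfolding pint_def using Lp_onD(2)[OF u] Lp_onD(2)[OF v] by simp
  finally show ?thesis .
qed

lemma Lp_on_AE:
  assumes \<Omega>: "open \<Omega>" and u: "u \<in> Lp_on \<Omega> p" and eq: "AE x in lebesgue_on \<Omega>. u x = v x"
  shows "v \<in> Lp_on \<Omega> p" "pint \<Omega> p v = pint \<Omega> p u"
proof -
  have v[measurable]: "v \<in> borel_measurable (lebesgue_on \<Omega>)"
    by (rule AE_eq_measurable[OF \<Omega> Lp_onD(1)[OF u] eq])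
  note [measurable] = Lp_onD(1)[OF u]
  have m: "(\<lambda>x. cmod (v x) powr p) \<in> borel_measurable (lebesgue_on \<Omega>)" by measurable
  have e: "AE x in lebesgue_on \<Omega>. cmod (u x) powr p = cmod (v x) powr p" using eq by eventually_elim simp
  show "v \<in> Lp_on \<Omega> p"
    using integrable_cong_AE_imp[OF Lp_onD(2)[OF u] m e] v by (simp add: Lp_on_def)
  show "pint \<Omega> p v = pint \<Omega> p u"
    unfolding pint_def by (rule integral_cong_AE[symmetric, OF _ m e]) measurable
qed

lemma pint_eq_0:
  assumes u: "u \<in> Lp_on \<Omega> p" and "pint \<Omega> p u = 0"
  shows "AE x in lebesgue_on \<Omega>. u x = 0"
proof -
  have "AE x in lebesgue_on \<Omega>. cmod (u x) powr p = 0"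
    using assms(2) unfolding pint_def
    by (subst (asm) integral_nonneg_eq_0_iff_AE[OF Lp_onD(2)[OF u]]) auto
  then show ?thesis by eventually_elim simp
qed

lemma finite_measure_lebesgue_on:
  assumes "open \<Omega>" "bounded \<Omega>" shows "finite_measure (lebesgue_on \<Omega>)"
proof
  have "emeasure (lebesgue_on \<Omega>) (space (lebesgue_on \<Omega>)) = emeasure lborel \<Omega>"
    using assms(1) open_sets_lebesgue[OF assms(1)] by (simp add: emeasure_restrict_space)
  then show "emeasure (lebesgue_on \<Omega>) (space (lebesgue_on \<Omega>)) \<noteq> \<infinity>"
    using emeasure_bounded_finite[OF assms(2)] by simp
qed

lemma Lp_on_bounded:
  assumes \<Omega>: "open \<Omega>" "bounded \<Omega>" and p: "1 \<le> p" and u: "u \<in> borel_measurable (lebesgue_on \<Omega>)" and M: "\<And>x. x \<in> \<Omega> \<Longrightarrow> cmod (u x) \<le> M"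
  shows "u \<in> Lp_on \<Omega> p"
proof -
  interpret finite_measure "lebesgue_on \<Omega>" by (rule finite_measure_lebesgue_on[OF \<Omega>])
  note [measurable] = u
  have "integrable (lebesgue_on \<Omega>) (\<lambda>x. cmod (u x) powr p)"
  proof (rule integrable_const_bound)
    show "AE x in lebesgue_on \<Omega>. norm (cmod (u x) powr p) \<le> M powr p"
      using p M by (intro AE_I2) (auto intro!: powr_mono2)
  qed measurable
  then show ?thesis using u by (simp add: Lp_on_def)
qed

lemma smooth_Lp_on:
  assumes \<Omega>: "open \<Omega>" "bounded \<Omega>" and p: "1 \<le> p" and q: "smooth q"
  shows "q \<in> Lp_on \<Omega> p"
proof -
  have "compact (q ` closure \<Omega>)"
    using \<Omega>(2) by (intro compact_continuous_image smooth_continuous q) (simp add: compact_closure)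
  then have "bounded (q ` closure \<Omega>)" by (rule compact_imp_bounded)
  then obtain M where M: "\<And>x. x \<in> closure \<Omega> \<Longrightarrow> cmod (q x) \<le> M" unfolding bounded_iff by blast
  have "q \<in> borel_measurable borel" by (rule borel_measurable_continuous_onI[OF smooth_continuous[OF q]])
  then have "q \<in> borel_measurable (lebesgue_on \<Omega>)"
    by (intro measurable_restrict_space1 measurable_completion) simp
  then show ?thesis
    by (rule Lp_on_bounded[OF \<Omega> p]) (use M closure_subset[of \<Omega>] in blast)
qed

text \<open>On a set of finite measure \<open>|u| \<le> 1 + |u|\<^sup>p\<close> is integrable.\<close>

lemma Lp_on_integrable:
  assumes \<Omega>: "open \<Omega>" "bounded \<Omega>" and p: "1 \<le> p" and u: "u \<in> Lp_on \<Omega> p"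
  shows "integrable (lebesgue_on \<Omega>) u"
proof -
  interpret finite_measure "lebesgue_on \<Omega>" by (rule finite_measure_lebesgue_on[OF \<Omega>])
  show ?thesis
  proof (rule Bochner_Integration.integrable_bound)
    show "integrable (lebesgue_on \<Omega>) (\<lambda>x. 1 + cmod (u x) powr p)" using Lp_onD(2)[OF u] by simp
    show "u \<in> borel_measurable (lebesgue_on \<Omega>)" by (rule Lp_onD(1)[OF u])
    show "AE x in lebesgue_on \<Omega>. norm (u x) \<le> norm (1 + cmod (u x) powr p)"
    proof (rule AE_I2)
      fix x
      have "cmod (u x) \<le> 1 + cmod (u x) powr p"
      proof (cases "cmod (u x) \<le> 1")
        case False
        then have "cmod (u x) powr 1 \<le> cmod (u x) powr p" using p by (intro powr_mono) auto
        then show ?thesis using False by simp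
      qed (simp add: add_increasing2)
      then show "norm (u x) \<le> norm (1 + cmod (u x) powr p)" by simp
    qed
  qed
qed

lemma nn_pint_eq_pint:
  fixes f :: "real^'d::finite \<Rightarrow> complex"
  assumes \<Omega>: "open \<Omega>" and f: "f \<in> Lp_on \<Omega> p" and eq: "AE x in lborel. x \<in> \<Omega> \<longrightarrow> f x = w x"
  shows "nn_pint p \<Omega> w = ennreal (pint \<Omega> p f)"
proof -
  have "ennreal (pint \<Omega> p f) = (\<integral>\<^sup>+x. ennreal (cmod (f x) powr p) \<partial>lebesgue_on \<Omega>)"
    unfolding pint_def by (rule nn_integral_eq_integral[OF Lp_onD(2)[OF f], symmetric]) simp
  also have "\<dots> = (\<integral>\<^sup>+x. ennreal (cmod (f x) powr p) * indicator \<Omega> x \<partial>lborel)"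
    by (simp add: nn_integral_restrict_space[OF open_sets_lebesgue[OF \<Omega>]] nn_integral_completion)
  also have "\<dots> = nn_pint p \<Omega> w"
    unfolding nn_pint_def by (rule nn_integral_cong_AE) (use eq in eventually_elim, auto simp: indicator_def)
  finally show ?thesis by simp
qed

lemma Lp_on_representative:
  fixes u :: "real^'d::finite \<Rightarrow> complex"
  assumes \<Omega>: "open \<Omega>" "bounded \<Omega>" and p: "1 \<le> p" and u: "u \<in> Lp_on \<Omega> p"
  shows "\<exists>v. v \<in> borel_measurable borel \<and> (\<forall>x. x \<notin> \<Omega> \<longrightarrow> v x = 0) \<and> (AE x in lborel. x \<in> \<Omega> \<longrightarrow> u x = v x) \<and> integrable lborel v"
proof -
  obtain v where v: "v \<in> borel_measurable borel" "\<forall>x. x \<notin> \<Omega> \<longrightarrow> v x = 0" "AE x in lborel. x \<in> \<Omega> \<longrightarrow> u x = v x"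
    using borel_representative[OF \<Omega>(1) Lp_onD(1)[OF u]] by (elim exE conjE) (rule that)
  have AE: "AE x in lebesgue_on \<Omega>. u x = v x" unfolding AE_lebesgue_on[OF \<Omega>(1)] by (rule v(3))
  have "v \<in> borel_measurable (lebesgue_on \<Omega>)"
    using v(1) by (intro measurable_restrict_space1 measurable_completion) simp
  from integrable_cong_AE_imp[OF Lp_on_integrable[OF \<Omega> p u] this AE]
  have "integrable (lebesgue_on \<Omega>) v" .
  then have "integrable lborel v" using lebesgue_on_eq_lborel(1)[OF \<Omega>(1) v(1)] v(2) by simp
  then show ?thesis using v by blast
qed

text \<open>Replacing \<open>u\<close> and its weak derivatives by Borel representatives changes no integral over \<open>\<Omega>\<close>.\<close>

lemma has_weak_gradient_representative:
  fixes u :: "real^'d::finite \<Rightarrow> complex"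
  assumes \<Omega>: "open \<Omega>" "bounded \<Omega>" and p: "1 \<le> p" and u: "u \<in> Lp_on \<Omega> p"
    and w: "\<And>j. w j \<in> Lp_on \<Omega> p" and weak: "\<And>j. has_weak_deriv \<Omega> (mi_suc j (\<lambda>_. 0)) u (w j)"
  shows "\<exists>v g. has_weak_gradient \<Omega> v g \<and> (AE x in lborel. x \<in> \<Omega> \<longrightarrow> u x = v x) \<and> (\<forall>j. AE x in lborel. x \<in> \<Omega> \<longrightarrow> w j x = g j x)"
proof -
  obtain v where v: "v \<in> borel_measurable borel" "\<forall>x. x \<notin> \<Omega> \<longrightarrow> v x = 0" "AE x in lborel. x \<in> \<Omega> \<longrightarrow> u x = v x" "integrable lborel v"
    using Lp_on_representative[OF \<Omega> p u] by (elim exE conjE) (rule that)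
  have "\<forall>j. \<exists>v. v \<in> borel_measurable borel \<and> (\<forall>x. x \<notin> \<Omega> \<longrightarrow> v x = 0) \<and> (AE x in lborel. x \<in> \<Omega> \<longrightarrow> w j x = v x) \<and> integrable lborel v"
    by (rule allI, rule Lp_on_representative[OF \<Omega> p w])
  from choice[OF this] obtain g where g': "\<forall>j. g j \<in> borel_measurable borel \<and> (\<forall>x. x \<notin> \<Omega> \<longrightarrow> g j x = 0) \<and>
    (AE x in lborel. x \<in> \<Omega> \<longrightarrow> w j x = g j x) \<and> integrable lborel (g j)" ..
  have g: "g j \<in> borel_measurable borel" "x \<notin> \<Omega> \<Longrightarrow> g j x = 0"
    "AE x in lborel. x \<in> \<Omega> \<longrightarrow> w j x = g j x" "integrable lborel (g j)" for j x
    using spec[OF g', of j] by simp_all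
  have tr: "(\<integral>x. f x * \<phi> x \<partial>lebesgue_on \<Omega>) = (\<integral>x. h x * \<phi> x \<partial>lborel)"
    if f: "f \<in> Lp_on \<Omega> p" and h: "h \<in> borel_measurable borel" "\<And>x. x \<notin> \<Omega> \<Longrightarrow> h x = 0" "AE x in lborel. x \<in> \<Omega> \<longrightarrow> f x = h x"
      and \<phi>: "\<phi> \<in> test_functions \<Omega>" for f h \<phi>
  proof -
    have [measurable]: "\<phi> \<in> borel_measurable borel" by (rule test_functions_borel[OF \<phi>])
    then have m: "(\<lambda>x. h x * \<phi> x) \<in> borel_measurable borel" using h(1) by measurable
    have [measurable]: "\<phi> \<in> borel_measurable (lebesgue_on \<Omega>)" "h \<in> borel_measurable (lebesgue_on \<Omega>)"
      using h(1) test_functions_borel[OF \<phi>] by (auto intro!: measurable_restrict_space1 measurable_completion)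
    note [measurable] = Lp_onD(1)[OF f]
    have "AE x in lebesgue_on \<Omega>. f x = h x" unfolding AE_lebesgue_on[OF \<Omega>(1)] by (rule h(3))
    then have "AE x in lebesgue_on \<Omega>. f x * \<phi> x = h x * \<phi> x" by eventually_elim simp
    then have "(\<integral>x. f x * \<phi> x \<partial>lebesgue_on \<Omega>) = (\<integral>x. h x * \<phi> x \<partial>lebesgue_on \<Omega>)"
      by (intro integral_cong_AE) measurable
    then show ?thesis using lebesgue_on_eq_lborel(2)[OF \<Omega>(1) m] h(2) by simp
  qed
  have "(\<integral>x. v x * partial_deriv j \<phi> x \<partial>lborel) = - (\<integral>x. g j x * \<phi> x \<partial>lborel)" if \<phi>: "\<phi> \<in> test_functions \<Omega>" for \<phi> j
  proof -
    have "(\<integral>x. u x * partial_deriv j \<phi> x \<partial>lebesgue_on \<Omega>) = - (\<integral>x. w j x * \<phi> x \<partial>lebesgue_on \<Omega>)"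
      using has_weak_derivD(3)[OF weak \<phi>, of j]
      by (simp add: multi_deriv_unit[OF test_functionsD(1)[OF \<phi>]]) (simp add: order_mi_def)
    then show ?thesis
      using tr[OF u v(1) _ v(3) test_functions_partial_deriv[OF \<phi>, of j]] v(2) tr[OF w g(1) g(2) g(3) \<phi>] by simp
  qed
  then have "has_weak_gradient \<Omega> v g" unfolding has_weak_gradient_def using v g by blast
  then show ?thesis using v(3) g(3) by blast
qed

text \<open>The Poincare inequality, carried over from Borel representatives to arbitrary members of \<open>L\<^sup>p(\<Omega>)\<close>.\<close>

lemma pint_poincare:
  fixes \<Omega> :: "(real^'d::finite) set"
  assumes \<Omega>: "open \<Omega>" "bounded \<Omega>" and p: "1 \<le> p" and P: "poincare_on p \<Omega> \<Omega>"
  shows "\<exists>C\<ge>0. \<forall>u w. u \<in> Lp_on \<Omega> p \<longrightarrow> (\<forall>j. w j \<in> Lp_on \<Omega> p) \<longrightarrow> (\<forall>j. has_weak_deriv \<Omega> (mi_suc j (\<lambda>_. 0)) u (w j)) \<longrightarrow>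
     (\<exists>c. pint \<Omega> p (\<lambda>x. u x - c) \<le> C * (\<Sum>j\<in>UNIV. pint \<Omega> p (w j)))"
proof -
  obtain C where C: "C \<ge> 0" "\<And>v g. has_weak_gradient \<Omega> v g \<Longrightarrow> \<exists>c. nn_pint p \<Omega> (\<lambda>x. v x - c) \<le> ennreal C * gradient_energy p g"
    using P unfolding poincare_on_def by blast
  have "\<exists>c. pint \<Omega> p (\<lambda>x. u x - c) \<le> C * (\<Sum>j\<in>UNIV. pint \<Omega> p (w j))"
    if u: "u \<in> Lp_on \<Omega> p" and w: "\<forall>j. w j \<in> Lp_on \<Omega> p" and weak: "\<forall>j. has_weak_deriv \<Omega> (mi_suc j (\<lambda>_. 0)) u (w j)" for u w
  proof -
    have w': "\<And>j. w j \<in> Lp_on \<Omega> p" and weak': "\<And>j. has_weak_deriv \<Omega> (mi_suc j (\<lambda>_. 0)) u (w j)" using w weak by auto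
    obtain v g where vg: "has_weak_gradient \<Omega> v g" and v: "AE x in lborel. x \<in> \<Omega> \<longrightarrow> u x = v x" and g: "\<And>j. AE x in lborel. x \<in> \<Omega> \<longrightarrow> w j x = g j x"
      using has_weak_gradient_representative[OF \<Omega> p u w' weak'] by blast
    obtain c where c: "nn_pint p \<Omega> (\<lambda>x. v x - c) \<le> ennreal C * gradient_energy p g" using C(2)[OF vg] by blast
    have uc: "(\<lambda>x. u x - c) \<in> Lp_on \<Omega> p"
      using Lp_on_add[OF p u smooth_Lp_on[OF \<Omega> p smooth_const, of "- c"]] by simp
    have "nn_pint p \<Omega> (\<lambda>x. v x - c) = ennreal (pint \<Omega> p (\<lambda>x. u x - c))"
      by (rule nn_pint_eq_pint[OF \<Omega>(1) uc]) (use v in eventually_elim, auto)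
    moreover have "gradient_energy p g = ennreal (\<Sum>j\<in>UNIV. pint \<Omega> p (w j))"
    proof -
      have "nn_pint p UNIV (g j) = nn_pint p \<Omega> (g j)" for j
        unfolding nn_pint_def using vg by (intro nn_integral_cong) (auto simp: has_weak_gradient_def indicator_def)
      also have "nn_pint p \<Omega> (g j) = ennreal (pint \<Omega> p (w j))" for j by (rule nn_pint_eq_pint[OF \<Omega>(1) w' g])
      finally show ?thesis unfolding gradient_energy_def by (simp add: sum_ennreal pint_nonneg)
    qed
    ultimately have "ennreal (pint \<Omega> p (\<lambda>x. u x - c)) \<le> ennreal (C * (\<Sum>j\<in>UNIV. pint \<Omega> p (w j)))"
      using c C(1) by (simp add: ennreal_mult sum_nonneg pint_nonneg)
    then have "pint \<Omega> p (\<lambda>x. u x - c) \<le> C * (\<Sum>j\<in>UNIV. pint \<Omega> p (w j))"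
      by (subst (asm) ennreal_le_iff) (auto intro!: mult_nonneg_nonneg sum_nonneg pint_nonneg C(1))
    then show ?thesis by blast
  qed
  then show ?thesis using C(1) by blast
qed

section \<open>Sobolev spaces\<close>

text \<open>The chosen representative agrees almost everywhere with one in \<open>L\<^sup>p\<close>, by uniqueness of weak derivatives.\<close>

lemma sobolev_weak_deriv:
  assumes \<Omega>: "open \<Omega>" and u: "u \<in> sobolev_space \<Omega> k p" and \<alpha>: "order_mi \<alpha> \<le> k"
  shows "has_weak_deriv \<Omega> \<alpha> u (weak_deriv \<Omega> \<alpha> u)" "weak_deriv \<Omega> \<alpha> u \<in> Lp_on \<Omega> p"
proof -
  obtain w where w: "w \<in> Lp_on \<Omega> p" "has_weak_deriv \<Omega> \<alpha> u w"
    using u \<alpha> unfolding sobolev_space_def by blast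
  show *: "has_weak_deriv \<Omega> \<alpha> u (weak_deriv \<Omega> \<alpha> u)"
    unfolding weak_deriv_def by (rule someI[of "has_weak_deriv \<Omega> \<alpha> u", OF w(2)])
  show "weak_deriv \<Omega> \<alpha> u \<in> Lp_on \<Omega> p"
    by (rule Lp_on_AE(1)[OF \<Omega> w(1) weak_deriv_unique[OF \<Omega> w(2) *]])
qed

lemma pint_weak_deriv:
  assumes \<Omega>: "open \<Omega>" and w: "w \<in> Lp_on \<Omega> p" "has_weak_deriv \<Omega> \<alpha> u w"
  shows "pint \<Omega> p (weak_deriv \<Omega> \<alpha> u) = pint \<Omega> p w"
proof -
  have *: "has_weak_deriv \<Omega> \<alpha> u (weak_deriv \<Omega> \<alpha> u)"
    unfolding weak_deriv_def by (rule someI[of "has_weak_deriv \<Omega> \<alpha> u", OF w(2)])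
  show ?thesis by (rule Lp_on_AE(2)[OF \<Omega> w(1) weak_deriv_unique[OF \<Omega> w(2) *]])
qed

lemma sobolev_spaceI:
  assumes "u \<in> Lp_on \<Omega> p" "\<And>\<alpha>. order_mi \<alpha> \<le> k \<Longrightarrow> w \<alpha> \<in> Lp_on \<Omega> p" "\<And>\<alpha>. order_mi \<alpha> \<le> k \<Longrightarrow> has_weak_deriv \<Omega> \<alpha> u (w \<alpha>)"
  shows "u \<in> sobolev_space \<Omega> k p"
  using assms unfolding sobolev_space_def by blast

lemma sobolev_Lp: "u \<in> sobolev_space \<Omega> k p \<Longrightarrow> u \<in> Lp_on \<Omega> p"
  by (simp add: sobolev_space_def)

lemma sobolev_add:
  assumes \<Omega>: "open \<Omega>" and p: "1 \<le> p" and u: "u \<in> sobolev_space \<Omega> k p" and v: "v \<in> sobolev_space \<Omega> k p"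
  shows "(\<lambda>x. u x + v x) \<in> sobolev_space \<Omega> k p"
  by (rule sobolev_spaceI[OF Lp_on_add[OF p sobolev_Lp[OF u] sobolev_Lp[OF v]]
        Lp_on_add[OF p sobolev_weak_deriv(2)[OF \<Omega> u] sobolev_weak_deriv(2)[OF \<Omega> v]]
        has_weak_deriv_add[OF \<Omega> sobolev_weak_deriv(1)[OF \<Omega> u] sobolev_weak_deriv(1)[OF \<Omega> v]]])

lemma sobolev_cmult:
  assumes \<Omega>: "open \<Omega>" and u: "u \<in> sobolev_space \<Omega> k p"
  shows "(\<lambda>x. c * u x) \<in> sobolev_space \<Omega> k p"
  by (rule sobolev_spaceI[OF Lp_on_cmult[OF sobolev_Lp[OF u]]
        Lp_on_cmult[OF sobolev_weak_deriv(2)[OF \<Omega> u]]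
        has_weak_deriv_cmult[OF sobolev_weak_deriv(1)[OF \<Omega> u]]])

lemma sobolev_diff:
  assumes \<Omega>: "open \<Omega>" and p: "1 \<le> p" and u: "u \<in> sobolev_space \<Omega> k p" and v: "v \<in> sobolev_space \<Omega> k p"
  shows "(\<lambda>x. u x - v x) \<in> sobolev_space \<Omega> k p"
  using sobolev_add[OF \<Omega> p u sobolev_cmult[OF \<Omega> v, of "-1"]] by simp

lemma sobolev_mono: "k \<le> m \<Longrightarrow> u \<in> sobolev_space \<Omega> m p \<Longrightarrow> u \<in> sobolev_space \<Omega> k p"
  by (auto simp: sobolev_space_def)

lemma has_weak_deriv_diff:
  assumes \<Omega>: "open \<Omega>" and u: "has_weak_deriv \<Omega> \<alpha> u w" and v: "has_weak_deriv \<Omega> \<alpha> v z"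
  shows "has_weak_deriv \<Omega> \<alpha> (\<lambda>x. u x - v x) (\<lambda>x. w x - z x)"
  using has_weak_deriv_add[OF \<Omega> u has_weak_deriv_cmult[OF v, of "-1"]] by simp

lemma smooth_sobolev:
  assumes "open \<Omega>" "bounded \<Omega>" "1 \<le> p" "smooth q"
  shows "q \<in> sobolev_space \<Omega> k p"
  by (rule sobolev_spaceI[OF smooth_Lp_on[OF assms] smooth_Lp_on[OF assms(1-3) smooth_multi_deriv[OF assms(4)]]
        has_weak_deriv_smooth[OF assms(1,4)]])

section \<open>Monomials and polynomials\<close>

definition monomial :: "('d::finite \<Rightarrow> nat) \<Rightarrow> real^'d \<Rightarrow> complex" where
  "monomial \<alpha> x = complex_of_real (\<Prod>j\<in>UNIV. (x $ j) ^ \<alpha> j)"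

lemma smooth_mono: "smooth (monomial \<alpha>)"
proof -
  have "smooth (\<lambda>x. \<Prod>j\<in>UNIV. complex_of_real (x $ j) ^ \<alpha> j)"
    by (intro smooth_prod smooth_power smooth_coord)
  then show ?thesis by (simp add: monomial_def[abs_def])
qed

text \<open>Reduces the partial derivatives of explicit functions to derivatives in one real variable.\<close>

lemma partial_deriv_along_line:
  assumes "\<phi> differentiable (at x)"
  shows "((\<lambda>t. \<phi> (x + t *\<^sub>R axis j 1)) has_vector_derivative partial_deriv j \<phi> x) (at 0)"
proof -
  have 1: "((\<lambda>t. x + t *\<^sub>R axis j 1) has_derivative (\<lambda>t. t *\<^sub>R axis j 1)) (at (0::real))"
    by (auto intro!: derivative_eq_intros)
  have 2: "(\<phi> has_derivative frechet_derivative \<phi> (at x)) (at (x + 0 *\<^sub>R axis j 1))"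
    using assms by (simp add: frechet_derivative_works)
  have "linear (frechet_derivative \<phi> (at x))" by (rule linear_frechet_derivative[OF assms])
  then have "frechet_derivative \<phi> (at x) (t *\<^sub>R axis j 1) = t *\<^sub>R partial_deriv j \<phi> x" for t
    by (simp add: linear_scale partial_deriv_def)
  with diff_chain_at[OF 1 2] show ?thesis by (simp add: has_vector_derivative_def o_def)
qed

lemma partial_deriv_mono:
  "partial_deriv j (monomial \<alpha>) = (\<lambda>x. of_nat (\<alpha> j) * monomial (\<alpha>(j := \<alpha> j - 1)) x)"
proof
  fix x :: "real^'a"
  let ?R = "\<Prod>i\<in>UNIV - {j}. (x $ i) ^ \<alpha> i"
  have split: "monomial \<beta> y = complex_of_real ((y $ j) ^ \<beta> j * (\<Prod>i\<in>UNIV - {j}. (y $ i) ^ \<beta> i))" for \<beta> and y :: "real^'a"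
    unfolding monomial_def by (subst prod.remove[of _ j]) simp_all
  have "monomial \<alpha> (x + t *\<^sub>R axis j 1) = complex_of_real ((x $ j + t) ^ \<alpha> j * ?R)" for t
  proof -
    have "(\<Prod>i\<in>UNIV - {j}. ((x + t *\<^sub>R axis j 1) $ i) ^ \<alpha> i) = ?R"
      by (rule prod.cong) (auto simp: axis_def)
    moreover have "(x + t *\<^sub>R axis j 1) $ j = x $ j + t" by (simp add: axis_def)
    ultimately show ?thesis unfolding split by simp
  qed
  moreover have "((\<lambda>t. complex_of_real ((x $ j + t) ^ \<alpha> j * ?R)) has_vector_derivative
      complex_of_real (real (\<alpha> j) * (x $ j) ^ (\<alpha> j - 1) * ?R)) (at 0)"
    by (rule has_vector_derivative_of_real) (auto intro!: derivative_eq_intros)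
  ultimately have "((\<lambda>t. monomial \<alpha> (x + t *\<^sub>R axis j 1)) has_vector_derivative
      complex_of_real (real (\<alpha> j) * (x $ j) ^ (\<alpha> j - 1) * ?R)) (at 0)" by simp
  from vector_derivative_unique_at[OF partial_deriv_along_line[OF smooth_differentiable[OF smooth_mono]] this]
  have "partial_deriv j (monomial \<alpha>) x = complex_of_real (real (\<alpha> j) * (x $ j) ^ (\<alpha> j - 1) * ?R)" .
  also have "\<dots> = of_nat (\<alpha> j) * monomial (\<alpha>(j := \<alpha> j - 1)) x"
  proof -
    have "(\<Prod>i\<in>UNIV - {j}. (x $ i) ^ (\<alpha>(j := \<alpha> j - 1)) i) = ?R"
      by (rule prod.cong) auto
    then show ?thesis unfolding split by simp
  qed
  finally show "partial_deriv j (monomial \<alpha>) x = of_nat (\<alpha> j) * monomial (\<alpha>(j := \<alpha> j - 1)) x" .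
qed

lemma partial_deriv_sum_cmult:
  assumes "\<And>i. i \<in> I \<Longrightarrow> smooth (\<phi> i)"
  shows "partial_deriv j (\<lambda>x. \<Sum>i\<in>I. c i * \<phi> i x) = (\<lambda>x. \<Sum>i\<in>I. c i * partial_deriv j (\<phi> i) x)"
  using assms
proof (induction I rule: infinite_finite_induct)
  case (insert i I)
  have 1: "smooth (\<lambda>x. c i * \<phi> i x)" "smooth (\<lambda>x. \<Sum>i\<in>I. c i * \<phi> i x)"
    using insert by (auto intro!: smooth_sum smooth_mult smooth_const)
  have "partial_deriv j (\<lambda>x. c i * \<phi> i x) = (\<lambda>x. c i * partial_deriv j (\<phi> i) x)"
    using insert.prems by (subst partial_deriv_mult) (auto simp: partial_deriv_const smooth_differentiable)
  then show ?case
    using insert partial_deriv_add[OF smooth_differentiable[OF 1(1)] smooth_differentiable[OF 1(2)], of j] by simp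
qed (simp_all add: partial_deriv_const)

lemma multi_deriv_sum_cmult:
  assumes "\<And>i. i \<in> I \<Longrightarrow> smooth (\<phi> i)"
  shows "multi_deriv \<alpha> (\<lambda>x. \<Sum>i\<in>I. c i * \<phi> i x) = (\<lambda>x. \<Sum>i\<in>I. c i * multi_deriv \<alpha> (\<phi> i) x)"
proof -
  have "foldr partial_deriv js (\<lambda>x. \<Sum>i\<in>I. c i * \<phi> i x) = (\<lambda>x. \<Sum>i\<in>I. c i * foldr partial_deriv js (\<phi> i) x)" for js
    by (induction js) (simp_all add: partial_deriv_sum_cmult smooth_foldr assms)
  then show ?thesis by (simp add: multi_deriv_eq_foldr)
qed

text \<open>The natural number \<open>N\<close> is a product of falling factorials; all that matters is when it vanishes.\<close>

lemma multi_deriv_mono: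
  "\<exists>N::nat. multi_deriv \<beta> (monomial \<alpha>) = (\<lambda>x. of_nat N * monomial (\<lambda>j. \<alpha> j - \<beta> j) x) \<and> (N > 0 \<longleftrightarrow> (\<forall>j. \<beta> j \<le> \<alpha> j))"
proof -
  have "\<exists>N::nat. foldr partial_deriv js (monomial \<alpha>) = (\<lambda>x. of_nat N * monomial (\<lambda>j. \<alpha> j - count (mset js) j) x) \<and>
      (N > 0 \<longleftrightarrow> (\<forall>j. count (mset js) j \<le> \<alpha> j))" for js
  proof (induction js)
    case Nil
    then show ?case by (intro exI[of _ 1]) simp
  next
    case (Cons i js)
    then obtain N where N: "foldr partial_deriv js (monomial \<alpha>) = (\<lambda>x. of_nat N * monomial (\<lambda>j. \<alpha> j - count (mset js) j) x)"
      "N > 0 \<longleftrightarrow> (\<forall>j. count (mset js) j \<le> \<alpha> j)" by blast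
    let ?\<beta> = "\<lambda>j. \<alpha> j - count (mset js) j"
    have upd: "?\<beta>(i := ?\<beta> i - 1) = (\<lambda>j. \<alpha> j - count (mset (i # js)) j)" by auto
    have "foldr partial_deriv (i # js) (monomial \<alpha>) = (\<lambda>x. of_nat (N * ?\<beta> i) * monomial (?\<beta>(i := ?\<beta> i - 1)) x)"
      by (simp add: N(1) partial_deriv_mult[OF differentiable_const smooth_differentiable[OF smooth_mono]] partial_deriv_const partial_deriv_mono mult.assoc)
    moreover have "N * ?\<beta> i > 0 \<longleftrightarrow> (\<forall>j. count (mset (i # js)) j \<le> \<alpha> j)"
    proof -
      have "N * ?\<beta> i > 0 \<longleftrightarrow> (\<forall>j. count (mset js) j \<le> \<alpha> j) \<and> count (mset js) i < \<alpha> i"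
        using N(2) by auto
      also have "\<dots> \<longleftrightarrow> (\<forall>j. count (mset (i # js)) j \<le> \<alpha> j)"
      proof (intro iffI conjI allI)
        fix j assume "(\<forall>j. count (mset js) j \<le> \<alpha> j) \<and> count (mset js) i < \<alpha> i"
        then show "count (mset (i # js)) j \<le> \<alpha> j" by (cases "i = j") auto
      next
        fix j assume *: "\<forall>j. count (mset (i # js)) j \<le> \<alpha> j"
        from spec[OF *, of j] show "count (mset js) j \<le> \<alpha> j" by (cases "i = j") auto
      next
        assume *: "\<forall>j. count (mset (i # js)) j \<le> \<alpha> j"
        from spec[OF *, of i] show "count (mset js) i < \<alpha> i" by simp
      qed
      finally show ?thesis .
    qed
    ultimately show ?case unfolding upd by (intro exI[of _ "N * ?\<beta> i"] conjI)
  qed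
  from this[of "mi_list \<beta>"] show ?thesis by (simp add: multi_deriv_eq_foldr count_mi_list)
qed

text \<open>The multi-index factorial \<open>\<alpha>!\<close>, introduced as the constant value of \<open>\<partial>\<^sup>\<alpha> x\<^sup>\<alpha>\<close>.\<close>

definition mi_fact :: "('d::finite \<Rightarrow> nat) \<Rightarrow> complex" where
  "mi_fact \<alpha> = multi_deriv \<alpha> (monomial \<alpha>) 0"

lemma multi_deriv_mono_same: "multi_deriv \<alpha> (monomial \<alpha>) = (\<lambda>x. mi_fact \<alpha>)" "mi_fact \<alpha> \<noteq> 0"
proof -
  obtain N where N: "multi_deriv \<alpha> (monomial \<alpha>) = (\<lambda>x. of_nat N * monomial (\<lambda>j. \<alpha> j - \<alpha> j) x)" "N > 0 \<longleftrightarrow> (\<forall>j. \<alpha> j \<le> \<alpha> j)"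
    using multi_deriv_mono[of \<alpha> \<alpha>] by blast
  then have *: "multi_deriv \<alpha> (monomial \<alpha>) = (\<lambda>x. of_nat N)" by (simp add: monomial_def)
  then show "multi_deriv \<alpha> (monomial \<alpha>) = (\<lambda>x. mi_fact \<alpha>)" "mi_fact \<alpha> \<noteq> 0" using N(2) by (simp_all add: mi_fact_def)
qed

lemma multi_deriv_mono_other:
  assumes "order_mi \<alpha> \<le> order_mi \<beta>" "\<alpha> \<noteq> \<beta>"
  shows "multi_deriv \<beta> (monomial \<alpha>) = (\<lambda>x. 0)"
proof -
  obtain N where N: "multi_deriv \<beta> (monomial \<alpha>) = (\<lambda>x. of_nat N * monomial (\<lambda>j. \<alpha> j - \<beta> j) x)" "N > 0 \<longleftrightarrow> (\<forall>j. \<beta> j \<le> \<alpha> j)"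
    using multi_deriv_mono[of \<beta> \<alpha>] by blast
  have "\<not> (\<forall>j. \<beta> j \<le> \<alpha> j)"
  proof
    assume le: "\<forall>j. \<beta> j \<le> \<alpha> j"
    from assms(2) le obtain i where "\<beta> i < \<alpha> i" by (metis ext le_neq_implies_less)
    then have "order_mi \<beta> < order_mi \<alpha>" unfolding order_mi_def using le by (intro sum_strict_mono_ex1) auto
    then show False using assms(1) by simp
  qed
  then have "N = 0" using N(2) by blast
  then show ?thesis using N(1) by simp
qed

definition poly_below :: "nat \<Rightarrow> (real^'d::finite \<Rightarrow> complex) set" where
  "poly_below k = {q. \<exists>c. q = (\<lambda>x. \<Sum>\<alpha> | order_mi \<alpha> < k. c \<alpha> * monomial \<alpha> x)}"

lemma finite_order_mi_less: "finite {\<alpha> :: 'd::finite \<Rightarrow> nat. order_mi \<alpha> < k}"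
  by (rule finite_subset[OF _ finite_order_mi_le[of k]]) auto

lemma poly_below_smooth: "q \<in> poly_below k \<Longrightarrow> smooth q"
  unfolding poly_below_def by (auto intro!: smooth_sum smooth_mult smooth_const smooth_mono)

lemma poly_below_deriv_zero:
  assumes "q \<in> poly_below k" "k \<le> order_mi \<gamma>"
  shows "multi_deriv \<gamma> q = (\<lambda>x. 0)"
proof -
  obtain c where q: "q = (\<lambda>x. \<Sum>\<alpha> | order_mi \<alpha> < k. c \<alpha> * monomial \<alpha> x)" using assms(1) unfolding poly_below_def by blast
  have "multi_deriv \<gamma> (monomial \<alpha>) = (\<lambda>x. 0)" if "order_mi \<alpha> < k" for \<alpha>
    using that assms(2) by (intro multi_deriv_mono_other) auto
  then show ?thesis unfolding q by (subst multi_deriv_sum_cmult) (auto simp: smooth_mono)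
qed

lemma poly_below_extend:
  assumes "q \<in> poly_below k"
  shows "(\<lambda>x. (\<Sum>\<alpha> | order_mi \<alpha> = k. c \<alpha> * monomial \<alpha> x) + q x) \<in> poly_below (Suc k)"
proof -
  obtain d where q: "q = (\<lambda>x. \<Sum>\<alpha> | order_mi \<alpha> < k. d \<alpha> * monomial \<alpha> x)" using assms unfolding poly_below_def by blast
  let ?e = "\<lambda>\<alpha>. if order_mi \<alpha> = k then c \<alpha> else d \<alpha>"
  have "(\<Sum>\<alpha> | order_mi \<alpha> < Suc k. ?e \<alpha> * monomial \<alpha> x) = (\<Sum>\<alpha> | order_mi \<alpha> = k. c \<alpha> * monomial \<alpha> x) + q x" for x
  proof -
    have "{\<alpha> :: 'a \<Rightarrow> nat. order_mi \<alpha> < Suc k} = {\<alpha>. order_mi \<alpha> = k} \<union> {\<alpha>. order_mi \<alpha> < k}" by auto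
    then have "(\<Sum>\<alpha> | order_mi \<alpha> < Suc k. ?e \<alpha> * monomial \<alpha> x) =
        (\<Sum>\<alpha> | order_mi \<alpha> = k. ?e \<alpha> * monomial \<alpha> x) + (\<Sum>\<alpha> | order_mi \<alpha> < k. ?e \<alpha> * monomial \<alpha> x)"
      by (simp only:) (rule sum.union_disjoint[OF finite_order_mi_eq finite_order_mi_less], auto)
    then show ?thesis unfolding q by simp
  qed
  then show ?thesis unfolding poly_below_def by (intro CollectI exI[of _ ?e]) (simp add: fun_eq_iff)
qed

section \<open>The Deny--Lions inequality\<close>

text \<open>Induction on \<open>k\<close>. In the step, the Poincare inequality provides constants \<open>c\<^sub>\<beta>\<close> that approximate the
derivatives \<open>\<partial>\<^sup>\<beta>u\<close> of order \<open>k\<close> by means of those of order \<open>k + 1\<close>. Subtracting the homogeneous polynomial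
with \<open>\<partial>\<^sup>\<beta>q\<^sub>1 = c\<^sub>\<beta>\<close> makes the seminorm of order \<open>k\<close> small, and the induction hypothesis takes care of the rest.
Starting at \<open>k = 0\<close>, where the only polynomial is zero, avoids a separate base case for the Poincare inequality.\<close>

lemma deny_lions:
  fixes \<Omega> :: "(real^'d::finite) set"
  assumes \<Omega>: "open \<Omega>" "bounded \<Omega>" and p: "1 \<le> p" and P: "poincare_on p \<Omega> \<Omega>"
  shows "\<exists>C\<ge>0. \<forall>u\<in>sobolev_space \<Omega> k p. \<exists>q\<in>poly_below k. \<forall>\<alpha>. order_mi \<alpha> \<le> k \<longrightarrow>
    pint \<Omega> p (weak_deriv \<Omega> \<alpha> (\<lambda>x. u x - q x)) \<le> C * (\<Sum>\<beta> | order_mi \<beta> = k. pint \<Omega> p (weak_deriv \<Omega> \<beta> u))"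
proof (induction k)
  case 0
  have "\<exists>q\<in>poly_below 0. \<forall>\<alpha>. order_mi \<alpha> \<le> 0 \<longrightarrow>
    pint \<Omega> p (weak_deriv \<Omega> \<alpha> (\<lambda>x. u x - q x)) \<le> 1 * (\<Sum>\<beta> | order_mi \<beta> = 0. pint \<Omega> p (weak_deriv \<Omega> \<beta> u))" for u
  proof (intro bexI[of _ "\<lambda>x. 0"] allI impI)
    fix \<alpha> :: "'d \<Rightarrow> nat" assume "order_mi \<alpha> \<le> 0"
    then show "pint \<Omega> p (weak_deriv \<Omega> \<alpha> (\<lambda>x. u x - 0)) \<le> 1 * (\<Sum>\<beta> | order_mi \<beta> = 0. pint \<Omega> p (weak_deriv \<Omega> \<beta> u))"
      using member_le_sum[of \<alpha> "{\<beta>. order_mi \<beta> = 0}" "\<lambda>\<beta>. pint \<Omega> p (weak_deriv \<Omega> \<beta> u)"]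
      by (simp add: pint_nonneg finite_order_mi_eq)
  qed (simp add: poly_below_def)
  then show ?case by (intro exI[of _ 1]) simp
next
  case (Suc k)
  then obtain C where C: "C \<ge> 0" "\<And>u. u \<in> sobolev_space \<Omega> k p \<Longrightarrow> \<exists>q\<in>poly_below k. \<forall>\<alpha>. order_mi \<alpha> \<le> k \<longrightarrow>
    pint \<Omega> p (weak_deriv \<Omega> \<alpha> (\<lambda>x. u x - q x)) \<le> C * (\<Sum>\<beta> | order_mi \<beta> = k. pint \<Omega> p (weak_deriv \<Omega> \<beta> u))" by blast
  from pint_poincare[OF \<Omega> p P] obtain D where D: "D \<ge> 0"
    "\<And>u w. u \<in> Lp_on \<Omega> p \<Longrightarrow> \<forall>j. w j \<in> Lp_on \<Omega> p \<Longrightarrow> \<forall>j. has_weak_deriv \<Omega> (mi_suc j (\<lambda>_. 0)) u (w j) \<Longrightarrow>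
     \<exists>c. pint \<Omega> p (\<lambda>x. u x - c) \<le> D * (\<Sum>j\<in>UNIV. pint \<Omega> p (w j))" by blast
  let ?I = "{\<beta> :: 'd \<Rightarrow> nat. order_mi \<beta> = k}"
  define E where "E = D * real CARD('d)"
  let ?C = "C * (real (card ?I) * E) + 1"
  have E: "E \<ge> 0" using D(1) by (simp add: E_def)
  have "\<exists>q\<in>poly_below (Suc k). \<forall>\<alpha>. order_mi \<alpha> \<le> Suc k \<longrightarrow>
    pint \<Omega> p (weak_deriv \<Omega> \<alpha> (\<lambda>x. u x - q x)) \<le> ?C * (\<Sum>\<beta> | order_mi \<beta> = Suc k. pint \<Omega> p (weak_deriv \<Omega> \<beta> u))"
    if u: "u \<in> sobolev_space \<Omega> (Suc k) p" for u
  proof -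
    define S where "S = (\<Sum>\<beta> | order_mi \<beta> = Suc k. pint \<Omega> p (weak_deriv \<Omega> \<beta> u))"
    have S_ge: "pint \<Omega> p (weak_deriv \<Omega> \<gamma> u) \<le> S" if "order_mi \<gamma> = Suc k" for \<gamma>
      unfolding S_def using that
      by (intro member_le_sum[of \<gamma> "{\<beta>. order_mi \<beta> = Suc k}" "\<lambda>\<beta>. pint \<Omega> p (weak_deriv \<Omega> \<beta> u)"])
         (auto simp: pint_nonneg finite_order_mi_eq)
    have S0: "S \<ge> 0" unfolding S_def by (intro sum_nonneg pint_nonneg)
    have "\<exists>c. pint \<Omega> p (\<lambda>x. weak_deriv \<Omega> \<beta> u x - c) \<le> E * S" if \<beta>: "order_mi \<beta> = k" for \<beta>
    proof -
      have "\<exists>c. pint \<Omega> p (\<lambda>x. weak_deriv \<Omega> \<beta> u x - c) \<le> D * (\<Sum>j\<in>UNIV. pint \<Omega> p (weak_deriv \<Omega> (mi_suc j \<beta>) u))"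
        using \<beta> by (intro D(2) allI sobolev_weak_deriv[OF \<Omega>(1) u] has_weak_deriv_step[OF sobolev_weak_deriv(1)[OF \<Omega>(1) u] sobolev_weak_deriv(1)[OF \<Omega>(1) u]]) auto
      then obtain c where c: "pint \<Omega> p (\<lambda>x. weak_deriv \<Omega> \<beta> u x - c) \<le> D * (\<Sum>j\<in>UNIV. pint \<Omega> p (weak_deriv \<Omega> (mi_suc j \<beta>) u))" by blast
      also have "\<dots> \<le> D * (real CARD('d) * S)"
        using \<beta> S_ge by (intro mult_left_mono D(1) sum_bounded_above) auto
      finally show ?thesis by (auto simp: E_def mult.assoc)
    qed
    then have "\<forall>\<beta>\<in>?I. \<exists>c. pint \<Omega> p (\<lambda>x. weak_deriv \<Omega> \<beta> u x - c) \<le> E * S" by simp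
    from bchoice[OF this] obtain c where c: "\<And>\<beta>. order_mi \<beta> = k \<Longrightarrow> pint \<Omega> p (\<lambda>x. weak_deriv \<Omega> \<beta> u x - c \<beta>) \<le> E * S" by auto
    \<comment> \<open>chosen so that \<open>\<partial>\<^sup>\<beta>q1 = c \<beta>\<close> for all \<open>\<beta>\<close> of order \<open>k\<close>\<close>
    let ?b = "\<lambda>\<alpha>. c \<alpha> / mi_fact \<alpha>"
    define q1 where "q1 = (\<lambda>x. \<Sum>\<alpha> | order_mi \<alpha> = k. ?b \<alpha> * monomial \<alpha> x)"
    have q1: "smooth q1" unfolding q1_def by (intro smooth_sum smooth_mult smooth_const smooth_mono)
    have q1_deriv: "multi_deriv \<beta> q1 = (\<lambda>x. c \<beta>)" if \<beta>: "order_mi \<beta> = k" for \<beta>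
    proof -
      have "multi_deriv \<beta> q1 = (\<lambda>x. \<Sum>\<alpha>\<in>?I. ?b \<alpha> * multi_deriv \<beta> (monomial \<alpha>) x)"
        unfolding q1_def by (rule multi_deriv_sum_cmult[OF smooth_mono])
      also have "\<dots> = (\<lambda>x. \<Sum>\<alpha>\<in>?I. if \<alpha> = \<beta> then c \<beta> else 0)"
        using \<beta> by (intro ext sum.cong) (auto simp: multi_deriv_mono_same multi_deriv_mono_other)
      also have "\<dots> = (\<lambda>x. c \<beta>)" using \<beta> by (simp add: sum.delta finite_order_mi_eq)
      finally show ?thesis .
    qed
    define u1 where "u1 = (\<lambda>x. u x - q1 x)"
    have u1S: "u1 \<in> sobolev_space \<Omega> k p"
      unfolding u1_def by (intro sobolev_diff \<Omega> p smooth_sobolev q1 sobolev_mono[OF _ u]) auto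
    have Lp_c: "(\<lambda>x. w x - d) \<in> Lp_on \<Omega> p" if "w \<in> Lp_on \<Omega> p" for w d
      using Lp_on_add[OF p that smooth_Lp_on[OF \<Omega> p smooth_const, of "- d"]] by simp
    have u1_deriv: "pint \<Omega> p (weak_deriv \<Omega> \<beta> u1) \<le> E * S" if \<beta>: "order_mi \<beta> = k" for \<beta>
    proof -
      have h: "has_weak_deriv \<Omega> \<beta> u1 (\<lambda>x. weak_deriv \<Omega> \<beta> u x - c \<beta>)"
        using has_weak_deriv_diff[OF \<Omega>(1) sobolev_weak_deriv(1)[OF \<Omega>(1) u, of \<beta>] has_weak_deriv_smooth[OF \<Omega>(1) q1, of \<beta>]] \<beta>
        by (simp add: u1_def q1_deriv)
      have "weak_deriv \<Omega> \<beta> u \<in> Lp_on \<Omega> p" using \<beta> by (intro sobolev_weak_deriv[OF \<Omega>(1) u]) simp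
      from pint_weak_deriv[OF \<Omega>(1) Lp_c[OF this] h] c[OF \<beta>] show ?thesis by simp
    qed
    obtain q2 where q2: "q2 \<in> poly_below k" "\<And>\<alpha>. order_mi \<alpha> \<le> k \<Longrightarrow>
      pint \<Omega> p (weak_deriv \<Omega> \<alpha> (\<lambda>x. u1 x - q2 x)) \<le> C * (\<Sum>\<beta> | order_mi \<beta> = k. pint \<Omega> p (weak_deriv \<Omega> \<beta> u1))"
      using C(2)[OF u1S] by blast
    let ?q = "\<lambda>x. q1 x + q2 x"
    have q: "?q \<in> poly_below (Suc k)" unfolding q1_def by (rule poly_below_extend[OF q2(1)])
    have uq: "(\<lambda>x. u1 x - q2 x) = (\<lambda>x. u x - ?q x)" by (simp add: u1_def algebra_simps)
    have "(\<Sum>\<beta> | order_mi \<beta> = k. pint \<Omega> p (weak_deriv \<Omega> \<beta> u1)) \<le> real (card ?I) * (E * S)"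
      using sum_bounded_above[of ?I "\<lambda>\<beta>. pint \<Omega> p (weak_deriv \<Omega> \<beta> u1)" "E * S"] u1_deriv by simp
    then have CS: "C * (\<Sum>\<beta> | order_mi \<beta> = k. pint \<Omega> p (weak_deriv \<Omega> \<beta> u1)) \<le> C * (real (card ?I) * E) * S"
      using C(1) by (simp add: mult_left_mono mult.assoc)
    have "pint \<Omega> p (weak_deriv \<Omega> \<alpha> (\<lambda>x. u x - ?q x)) \<le> ?C * S" if \<alpha>: "order_mi \<alpha> \<le> Suc k" for \<alpha>
    proof (cases "order_mi \<alpha> \<le> k")
      case True
      have "pint \<Omega> p (weak_deriv \<Omega> \<alpha> (\<lambda>x. u x - ?q x)) \<le> C * (real (card ?I) * E) * S"
        using q2(2)[OF True] CS unfolding uq by linarith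
      then show ?thesis using S0 by (simp add: distrib_right)
    next
      case False
      then have \<alpha>k: "order_mi \<alpha> = Suc k" using \<alpha> by simp
      have h: "has_weak_deriv \<Omega> \<alpha> (\<lambda>x. u x - ?q x) (weak_deriv \<Omega> \<alpha> u)"
        using has_weak_deriv_diff[OF \<Omega>(1) sobolev_weak_deriv(1)[OF \<Omega>(1) u \<alpha>] has_weak_deriv_smooth[OF \<Omega>(1) poly_below_smooth[OF q], of \<alpha>]]
        by (simp add: poly_below_deriv_zero[OF q] \<alpha>k)
      have "pint \<Omega> p (weak_deriv \<Omega> \<alpha> (\<lambda>x. u x - ?q x)) \<le> 1 * S"
        using pint_weak_deriv[OF \<Omega>(1) sobolev_weak_deriv(2)[OF \<Omega>(1) u \<alpha>] h] S_ge[OF \<alpha>k] by simp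
      also have "\<dots> \<le> ?C * S" using S0 C(1) E by (intro mult_right_mono) auto
      finally show ?thesis .
    qed
    then show ?thesis unfolding S_def[symmetric] by (intro bexI[OF _ q] allI impI)
  qed
  moreover have "?C \<ge> 0" using C(1) E by simp
  ultimately show ?case by (intro exI[of _ ?C] conjI ballI)
qed

section \<open>Finite-dimensional spaces and the triangle inequality\<close>

text \<open>A norm on a finite-dimensional coordinate space dominates the coordinates: \<open>G\<close> is continuous and
positive on the unit sphere for the maximum norm, which is compact. The coordinates outside the finite index
set \<open>I\<close> are set to zero, so that the sphere is a closed subset of a product of compact sets.\<close>

lemma coefficient_bound:
  fixes G :: "('i \<Rightarrow> complex) \<Rightarrow> real"
  assumes I: "finite I" and nonneg: "\<And>c. 0 \<le> G c"
    and sub: "\<And>c d. G (\<lambda>i. c i + d i) \<le> G c + G d"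
    and hom: "\<And>t c. G (\<lambda>i. t * c i) = cmod t * G c"
    and loc: "\<And>c d. (\<And>i. i \<in> I \<Longrightarrow> c i = d i) \<Longrightarrow> G c = G d"
    and definite: "\<And>c i. G c = 0 \<Longrightarrow> i \<in> I \<Longrightarrow> c i = 0"
  shows "\<exists>K\<ge>0. \<forall>c. \<forall>i\<in>I. cmod (c i) \<le> K * G c"
proof (cases "I = {}")
  case True
  then show ?thesis by (intro exI[of _ 0]) simp
next
  case False
  have G0: "G (\<lambda>i. 0) = 0" using hom[of 0 "\<lambda>_. 0"] by simp
  have upper: "G c \<le> (\<Sum>i\<in>I. cmod (c i) * G (\<lambda>j. if j = i then 1 else 0))" for c
  proof -
    have "G (\<lambda>j. \<Sum>i\<in>F. c i * (if j = i then 1 else 0)) \<le> (\<Sum>i\<in>F. cmod (c i) * G (\<lambda>j. if j = i then 1 else 0))" if "finite F" for F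
      using that
    proof induction
      case (insert i F)
      have "G (\<lambda>j. \<Sum>i\<in>insert i F. c i * (if j = i then 1 else 0)) = G (\<lambda>j. c i * (if j = i then 1 else 0) + (\<Sum>i\<in>F. c i * (if j = i then 1 else 0)))"
        using insert by (intro arg_cong[of _ _ G] ext) simp
      also have "\<dots> \<le> G (\<lambda>j. c i * (if j = i then 1 else 0)) + G (\<lambda>j. \<Sum>i\<in>F. c i * (if j = i then 1 else 0))"
        by (rule sub)
      also have "\<dots> \<le> cmod (c i) * G (\<lambda>j. if j = i then 1 else 0) + (\<Sum>i\<in>F. cmod (c i) * G (\<lambda>j. if j = i then 1 else 0))"
        using insert.IH by (simp only: hom add_left_mono)
      finally show ?case using insert by simp
    qed (simp add: G0)
    from this[OF I] show ?thesis
      using loc[of "\<lambda>j. \<Sum>i\<in>I. c i * (if j = i then 1 else 0)" c] I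
      by (simp add: if_distrib[of "\<lambda>x. _ * x"] cong: if_cong)
  qed
  have diff: "\<bar>G c - G d\<bar> \<le> G (\<lambda>i. c i - d i)" for c d
  proof -
    have "G c \<le> G (\<lambda>i. c i - d i) + G d" using sub[of "\<lambda>i. c i - d i" d] by simp
    moreover have "G d \<le> G (\<lambda>i. d i - c i) + G c" using sub[of "\<lambda>i. d i - c i" c] by simp
    moreover have "G (\<lambda>i. d i - c i) = G (\<lambda>i. c i - d i)" using hom[of "-1" "\<lambda>i. c i - d i"] by simp
    ultimately show ?thesis by linarith
  qed
  define B where "B = PiE UNIV (\<lambda>i. if i \<in> I then cball 0 1 else {0 :: complex})"
  define S where "S = B \<inter> (\<Union>i\<in>I. {c. cmod (c i) = 1})"
  have "compact B"
  proof -
    have "compactin (product_topology (\<lambda>i. euclidean) UNIV) B"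
      unfolding B_def compactin_PiE by (simp add: compact_eq_bounded_closed)
    then show ?thesis by (simp add: euclidean_product_topology)
  qed
  moreover have "closed (\<Union>i\<in>I. {c :: 'i \<Rightarrow> complex. cmod (c i) = 1})"
    using I by (intro closed_UN ballI closed_Collect_eq continuous_on_norm continuous_on_const continuous_on_product_coordinates)
  ultimately have cS: "compact S" unfolding S_def by (rule compact_Int_closed)
  obtain i0 where i0: "i0 \<in> I" using False by blast
  have "(\<lambda>j. if j = i0 then 1 else 0) \<in> S" using i0 by (auto simp: S_def B_def)
  then have neS: "S \<noteq> {}" by blast
  have contG: "continuous_on S G"
    unfolding continuous_on_def
  proof
    fix x assume "x \<in> S"
    let ?b = "\<lambda>c. \<Sum>i\<in>I. cmod (c i - x i) * G (\<lambda>j. if j = i then 1 else 0)"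
    have "continuous_on S ?b"
      by (intro continuous_intros continuous_on_product_then_coordinatewise[OF continuous_on_id])
    then have "(?b \<longlongrightarrow> ?b x) (at x within S)" using \<open>x \<in> S\<close> by (simp only: continuous_on_def)
    then have b: "(?b \<longlongrightarrow> 0) (at x within S)" by simp
    have "((\<lambda>c. G c - G x) \<longlongrightarrow> 0) (at x within S)"
    proof (rule Lim_null_comparison[OF _ b], rule always_eventually, rule allI)
      fix c
      show "norm (G c - G x) \<le> ?b c" using diff[of c x] upper[of "\<lambda>i. c i - x i"] by simp
    qed
    then show "(G \<longlongrightarrow> G x) (at x within S)" by (simp add: LIM_zero_iff)
  qed
  obtain x where x: "x \<in> S" "\<And>y. y \<in> S \<Longrightarrow> G x \<le> G y"
    using continuous_attains_inf[OF cS neS contG] by blast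
  have "G x \<noteq> 0"
  proof
    assume "G x = 0"
    from x(1) obtain i where "i \<in> I" "cmod (x i) = 1" by (auto simp: S_def)
    then show False using definite[OF \<open>G x = 0\<close>, of i] by simp
  qed
  then have m: "G x > 0" using nonneg[of x] by simp
  have "cmod (c i) \<le> 1 / G x * G c" if i: "i \<in> I" for c i
  proof -
    define M where "M = Max ((\<lambda>i. cmod (c i)) ` I)"
    have le: "cmod (c j) \<le> M" if "j \<in> I" for j unfolding M_def using I that by simp
    show ?thesis
    proof (cases "M > 0")
      case False
      then have "cmod (c i) \<le> 0" using le[OF i] by linarith
      moreover have "0 \<le> 1 / G x * G c" using m nonneg[of c] by simp
      ultimately show ?thesis by linarith
    next
      case M: True
      \<comment> \<open>scale the coefficients to the unit sphere\<close>
      let ?d = "\<lambda>j. if j \<in> I then of_real (1 / M) * c j else 0"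
      have "M \<in> (\<lambda>i. cmod (c i)) ` I" unfolding M_def using I False by (intro Max_in) auto
      then obtain j where j: "j \<in> I" "cmod (c j) = M" by auto
      have "?d \<in> B" unfolding B_def using le M by (auto simp: norm_mult norm_divide)
      moreover have "cmod (?d j) = 1" using j M by (simp add: norm_mult norm_divide)
      ultimately have "?d \<in> S" using j(1) by (auto simp: S_def)
      then have "G x \<le> G ?d" by (rule x(2))
      also have "\<dots> = G (\<lambda>j. of_real (1 / M) * c j)" by (rule loc) simp
      also have "\<dots> = 1 / M * G c" unfolding hom using M by (simp add: norm_divide)
      finally have "M \<le> 1 / G x * G c" using M m by (simp add: field_simps)
      then show ?thesis using le[OF i] by linarith
    qed
  qed
  then show ?thesis using m by (intro exI[of _ "1 / G x"]) simp
qed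

text \<open>Minkowski's inequality in the abstract: for a convex, \<open>p\<close>-homogeneous \<open>\<Phi>\<close> the set \<open>\<Phi> \<le> 1\<close> is convex, and
\<open>u + v\<close> is \<open>a + b\<close> times a convex combination of \<open>u / a\<close> and \<open>v / b\<close>. Taking \<open>a\<close> and \<open>b\<close> slightly larger than
the \<open>p\<close>-th roots avoids dividing by zero.\<close>

lemma powr_root_subadditive:
  fixes \<Phi> :: "('x \<Rightarrow> complex) \<Rightarrow> real"
  assumes p: "1 \<le> p"
    and cl: "\<And>u v. u \<in> W \<Longrightarrow> v \<in> W \<Longrightarrow> (\<lambda>x. u x + v x) \<in> W" "\<And>c u. u \<in> W \<Longrightarrow> (\<lambda>x. c * u x) \<in> W"
    and nonneg: "\<And>u. u \<in> W \<Longrightarrow> 0 \<le> \<Phi> u"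
    and hom: "\<And>c u. u \<in> W \<Longrightarrow> \<Phi> (\<lambda>x. c * u x) = cmod c powr p * \<Phi> u"
    and conv: "\<And>t u v. u \<in> W \<Longrightarrow> v \<in> W \<Longrightarrow> 0 \<le> t \<Longrightarrow> t \<le> 1 \<Longrightarrow>
       \<Phi> (\<lambda>x. of_real (1 - t) * u x + of_real t * v x) \<le> (1 - t) * \<Phi> u + t * \<Phi> v"
    and u: "u \<in> W" and v: "v \<in> W"
  shows "\<Phi> (\<lambda>x. u x + v x) powr (1 / p) \<le> \<Phi> u powr (1 / p) + \<Phi> v powr (1 / p)"
proof (rule field_le_epsilon)
  fix \<epsilon> :: real assume \<epsilon>: "\<epsilon> > 0"
  define a where "a = \<Phi> u powr (1 / p) + \<epsilon> / 2"
  define b where "b = \<Phi> v powr (1 / p) + \<epsilon> / 2"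
  have ab: "a > 0" "b > 0" using \<epsilon> by (simp_all add: a_def b_def add_nonneg_pos)
  have unit: "\<Phi> (\<lambda>x. of_real (1 / r) * w x) \<le> 1" if w: "w \<in> W" and r: "r > 0" "\<Phi> w powr (1 / p) \<le> r" for w r
  proof -
    have "\<Phi> w = (\<Phi> w powr (1 / p)) powr p" using nonneg[OF w] p by (simp add: powr_powr)
    also have "\<dots> \<le> r powr p" using r(2) p by (intro powr_mono2) auto
    finally have "(1 / r) powr p * \<Phi> w \<le> (1 / r) powr p * r powr p" by (intro mult_left_mono) auto
    also have "\<dots> = 1" using r(1) by (simp flip: powr_mult)
    finally show ?thesis using r(1) by (simp only: hom[OF w] norm_of_real abs_of_pos zero_less_divide_1_iff)
  qed
  define t where "t = b / (a + b)"
  have t: "0 \<le> t" "t \<le> 1" "(a + b) * (1 - t) = a" "(a + b) * t = b" using ab by (auto simp: t_def field_simps)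
  let ?u = "\<lambda>x. of_real (1 / a) * u x" and ?v = "\<lambda>x. of_real (1 / b) * v x"
  let ?w = "\<lambda>x. of_real (1 - t) * ?u x + of_real t * ?v x"
  have wW: "?w \<in> W" by (intro cl u v)
  have "\<Phi> ?w \<le> (1 - t) * \<Phi> ?u + t * \<Phi> ?v" by (intro conv cl u v t)
  also have "\<dots> \<le> (1 - t) * 1 + t * 1"
    using t ab \<epsilon> by (intro add_mono mult_left_mono unit u v) (auto simp: a_def b_def)
  finally have w1: "\<Phi> ?w \<le> 1" by simp
  have "(\<lambda>x. u x + v x) = (\<lambda>x. of_real (a + b) * ?w x)"
  proof
    fix x
    have "of_real (a + b) * ?w x = of_real ((a + b) * (1 - t)) * (of_real (1 / a) * u x) + of_real ((a + b) * t) * (of_real (1 / b) * v x)"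
      by (simp only: distrib_left of_real_mult mult.assoc)
    also have "\<dots> = u x + v x" unfolding t(3,4) using ab by (simp add: mult.assoc[symmetric] flip: of_real_mult)
    finally show "u x + v x = of_real (a + b) * ?w x" by simp
  qed
  then have "\<Phi> (\<lambda>x. u x + v x) = \<Phi> (\<lambda>x. of_real (a + b) * ?w x)" by simp
  also have "\<dots> = cmod (of_real (a + b)) powr p * \<Phi> ?w" by (rule hom[OF wW])
  also have "\<dots> = (a + b) powr p * \<Phi> ?w" using ab by (simp only: norm_of_real abs_of_pos add_pos_pos)
  also have "\<dots> \<le> (a + b) powr p * 1" using w1 by (intro mult_left_mono) auto
  finally have "\<Phi> (\<lambda>x. u x + v x) powr (1 / p) \<le> ((a + b) powr p) powr (1 / p)"
    using p nonneg[OF cl(1)[OF u v]] by (intro powr_mono2) auto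
  also have "\<dots> = a + b" using ab p by (simp add: powr_powr)
  finally show "\<Phi> (\<lambda>x. u x + v x) powr (1 / p) \<le> \<Phi> u powr (1 / p) + \<Phi> v powr (1 / p) + \<epsilon>"
    by (simp add: a_def b_def)
qed

section \<open>Norms on Sobolev spaces\<close>

lemma pint_weak_deriv_cmult:
  assumes "open \<Omega>" "u \<in> sobolev_space \<Omega> k p" "order_mi \<alpha> \<le> k"
  shows "pint \<Omega> p (weak_deriv \<Omega> \<alpha> (\<lambda>x. c * u x)) = cmod c powr p * pint \<Omega> p (weak_deriv \<Omega> \<alpha> u)"
  using pint_weak_deriv[OF assms(1) Lp_on_cmult[OF sobolev_weak_deriv(2)[OF assms]] has_weak_deriv_cmult[OF sobolev_weak_deriv(1)[OF assms]]]
  by (simp add: pint_cmult)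

lemma pint_weak_deriv_convex:
  assumes \<Omega>: "open \<Omega>" and p: "1 \<le> p" and u: "u \<in> sobolev_space \<Omega> k p" and v: "v \<in> sobolev_space \<Omega> k p" and \<alpha>: "order_mi \<alpha> \<le> k"
    and t: "0 \<le> t" "t \<le> 1"
  shows "pint \<Omega> p (weak_deriv \<Omega> \<alpha> (\<lambda>x. of_real (1 - t) * u x + of_real t * v x))
    \<le> (1 - t) * pint \<Omega> p (weak_deriv \<Omega> \<alpha> u) + t * pint \<Omega> p (weak_deriv \<Omega> \<alpha> v)"
proof -
  note u' = sobolev_weak_deriv[OF \<Omega> u \<alpha>] and v' = sobolev_weak_deriv[OF \<Omega> v \<alpha>]
  show ?thesis
    using pint_weak_deriv[OF \<Omega> Lp_on_add[OF p Lp_on_cmult[OF u'(2)] Lp_on_cmult[OF v'(2)]]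
        has_weak_deriv_add[OF \<Omega> has_weak_deriv_cmult[OF u'(1)] has_weak_deriv_cmult[OF v'(1)]], of "of_real (1 - t)" "of_real t"]
      pint_convex[OF p u'(2) v'(2) t] by simp
qed

lemma sobolev_norm_pint:
  "sobolev_norm \<Omega> k p u = (\<Sum>\<alpha> | order_mi \<alpha> \<le> k. pint \<Omega> p (weak_deriv \<Omega> \<alpha> u)) powr (1 / p)"
  by (simp add: sobolev_norm_def pint_def)

lemma sobolev_norm_nonneg: "0 \<le> sobolev_norm \<Omega> k p u"
  by (simp add: sobolev_norm_pint)

lemma modified_norm_pint:
  assumes "1 \<le> p"
  shows "modified_norm \<Omega> k p l f u = ((\<Sum>i=1..l. f i u powr p) + (\<Sum>\<alpha> | order_mi \<alpha> = k. pint \<Omega> p (weak_deriv \<Omega> \<alpha> u))) powr (1 / p)"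
  using assms by (simp add: modified_norm_def sobolev_seminorm_def pint_def[symmetric] powr_powr sum_nonneg pint_nonneg)

text \<open>Covers both norms at once: the standard one with no seminorms and all multi-indices of order at most \<open>k\<close>,
the modified one with the given seminorms and the multi-indices of order \<open>k\<close>.\<close>

lemma sum_seminorms_root_triangle:
  assumes \<Omega>: "open \<Omega>" and p: "1 \<le> p" and J: "\<And>\<alpha>. \<alpha> \<in> J \<Longrightarrow> order_mi \<alpha> \<le> k"
    and f: "\<And>i. i \<in> I \<Longrightarrow> seminorm_on \<Omega> (sobolev_space \<Omega> k p) (f i)"
    and u: "u \<in> sobolev_space \<Omega> k p" and v: "v \<in> sobolev_space \<Omega> k p"
  defines "\<Phi> \<equiv> \<lambda>u. (\<Sum>i\<in>I. f i u powr p) + (\<Sum>\<alpha>\<in>J. pint \<Omega> p (weak_deriv \<Omega> \<alpha> u))"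
  shows "\<Phi> (\<lambda>x. u x + v x) powr (1 / p) \<le> \<Phi> u powr (1 / p) + \<Phi> v powr (1 / p)"
    and "\<Phi> (\<lambda>x. c * u x) powr (1 / p) = cmod c * \<Phi> u powr (1 / p)"
proof -
  let ?W = "sobolev_space \<Omega> k p"
  have f0: "0 \<le> f i w" if "i \<in> I" "w \<in> ?W" for i w using f that by (auto simp: seminorm_on_def)
  have fc: "f i (\<lambda>x. c * w x) = cmod c * f i w" if "i \<in> I" "w \<in> ?W" for i w c using f that by (auto simp: seminorm_on_def)
  have fa: "f i (\<lambda>x. w x + z x) \<le> f i w + f i z" if "i \<in> I" "w \<in> ?W" "z \<in> ?W" for i w z using f that by (auto simp: seminorm_on_def)
  have hom: "\<Phi> (\<lambda>x. c * w x) = cmod c powr p * \<Phi> w" if w: "w \<in> ?W" for c w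
    unfolding \<Phi>_def using w
    by (simp add: fc f0 powr_mult pint_weak_deriv_cmult[OF \<Omega> w J] distrib_left sum_distrib_left)
  have nonneg: "0 \<le> \<Phi> w" for w
    unfolding \<Phi>_def by (intro add_nonneg_nonneg sum_nonneg pint_nonneg) auto
  have conv: "\<Phi> (\<lambda>x. of_real (1 - t) * w x + of_real t * z x) \<le> (1 - t) * \<Phi> w + t * \<Phi> z"
    if w: "w \<in> ?W" and z: "z \<in> ?W" and t: "0 \<le> t" "t \<le> 1" for t w z
  proof -
    let ?y = "\<lambda>x. of_real (1 - t) * w x + of_real t * z x"
    have "f i ?y powr p \<le> (1 - t) * f i w powr p + t * f i z powr p" if i: "i \<in> I" for i
    proof -
      have "f i ?y \<le> f i (\<lambda>x. of_real (1 - t) * w x) + f i (\<lambda>x. of_real t * z x)"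
        by (intro fa i sobolev_cmult \<Omega> w z)
      also have "\<dots> = (1 - t) * f i w + t * f i z"
        using t by (simp only: fc[OF i] w z norm_of_real abs_of_nonneg diff_ge_0_iff_ge)
      finally have "f i ?y powr p \<le> ((1 - t) * f i w + t * f i z) powr p"
        using p by (intro powr_mono2 f0[OF i] sobolev_add sobolev_cmult \<Omega> w z) auto
      also have "\<dots> \<le> (1 - t) * f i w powr p + t * f i z powr p"
        by (intro powr_convex_combination p f0[OF i] w z t)
      finally show ?thesis .
    qed
    then have "\<Phi> ?y \<le> (\<Sum>i\<in>I. (1 - t) * f i w powr p + t * f i z powr p) +
        (\<Sum>\<alpha>\<in>J. (1 - t) * pint \<Omega> p (weak_deriv \<Omega> \<alpha> w) + t * pint \<Omega> p (weak_deriv \<Omega> \<alpha> z))"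
      unfolding \<Phi>_def by (intro add_mono sum_mono pint_weak_deriv_convex[OF \<Omega> p w z J t])
    also have "\<dots> = (1 - t) * \<Phi> w + t * \<Phi> z"
      unfolding \<Phi>_def by (simp add: sum.distrib sum_distrib_left distrib_left)
    finally show ?thesis .
  qed
  show "\<Phi> (\<lambda>x. u x + v x) powr (1 / p) \<le> \<Phi> u powr (1 / p) + \<Phi> v powr (1 / p)"
    by (rule powr_root_subadditive[OF p sobolev_add[OF \<Omega> p] sobolev_cmult[OF \<Omega>] nonneg hom conv u v])
  show "\<Phi> (\<lambda>x. c * u x) powr (1 / p) = cmod c * \<Phi> u powr (1 / p)"
    using p nonneg[of u] by (simp add: hom[OF u] powr_mult powr_powr)
qed

lemma sobolev_norm_triangle:
  assumes "open \<Omega>" "1 \<le> p" "u \<in> sobolev_space \<Omega> k p" "v \<in> sobolev_space \<Omega> k p"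
  shows "sobolev_norm \<Omega> k p (\<lambda>x. u x + v x) \<le> sobolev_norm \<Omega> k p u + sobolev_norm \<Omega> k p v"
    and "sobolev_norm \<Omega> k p (\<lambda>x. c * u x) = cmod c * sobolev_norm \<Omega> k p u"
  using sum_seminorms_root_triangle[OF assms(1,2) _ _ assms(3,4), of "{\<alpha>. order_mi \<alpha> \<le> k}" "{}"]
  by (simp_all add: sobolev_norm_pint)

lemma has_weak_deriv_AE_cong:
  assumes \<Omega>: "open \<Omega>" and u: "u \<in> borel_measurable (lebesgue_on \<Omega>)" and eq: "ae_eq_on \<Omega> u v" and h: "has_weak_deriv \<Omega> \<alpha> u w"
    and v: "locally_integrable_on \<Omega> v"
  shows "has_weak_deriv \<Omega> \<alpha> v w"
  unfolding has_weak_deriv_def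
proof (intro conjI ballI v has_weak_derivD(2)[OF h])
  fix \<phi> assume \<phi>: "\<phi> \<in> test_functions \<Omega>"
  note \<psi> = test_functions_multi_deriv[OF \<phi>, of \<alpha>]
  have "(\<integral>x. v x * multi_deriv \<alpha> \<phi> x \<partial>lebesgue_on \<Omega>) = (\<integral>x. u x * multi_deriv \<alpha> \<phi> x \<partial>lebesgue_on \<Omega>)"
  proof (rule integral_cong_AE)
    show "(\<lambda>x. v x * multi_deriv \<alpha> \<phi> x) \<in> borel_measurable (lebesgue_on \<Omega>)"
      by (rule borel_measurable_integrable[OF locally_integrable_times_test(2)[OF \<Omega> v \<psi>]])
    show "(\<lambda>x. u x * multi_deriv \<alpha> \<phi> x) \<in> borel_measurable (lebesgue_on \<Omega>)"
      by (rule borel_measurable_integrable[OF locally_integrable_times_test(2)[OF \<Omega> has_weak_derivD(1)[OF h] \<psi>]])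
    show "AE x in lebesgue_on \<Omega>. v x * multi_deriv \<alpha> \<phi> x = u x * multi_deriv \<alpha> \<phi> x"
      using eq unfolding ae_eq_on_def by eventually_elim simp
  qed
  then show "(\<integral>x. v x * multi_deriv \<alpha> \<phi> x \<partial>lebesgue_on \<Omega>) = (- 1) ^ order_mi \<alpha> * (\<integral>x. w x * \<phi> x \<partial>lebesgue_on \<Omega>)"
    using has_weak_derivD(3)[OF h \<phi>] by simp
qed

lemma sobolev_locally_integrable:
  assumes "u \<in> sobolev_space \<Omega> k p" shows "locally_integrable_on \<Omega> u"
proof -
  have "order_mi (\<lambda>_. 0) \<le> k" by (simp add: order_mi_def)
  then obtain w where "has_weak_deriv \<Omega> (\<lambda>_. 0) u w" using assms unfolding sobolev_space_def by blast
  then show ?thesis by (rule has_weak_derivD(1))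
qed

lemma pint_weak_deriv_AE_cong:
  assumes \<Omega>: "open \<Omega>" and u: "u \<in> sobolev_space \<Omega> k p" and v: "v \<in> sobolev_space \<Omega> k p" and eq: "ae_eq_on \<Omega> u v" and \<alpha>: "order_mi \<alpha> \<le> k"
  shows "pint \<Omega> p (weak_deriv \<Omega> \<alpha> v) = pint \<Omega> p (weak_deriv \<Omega> \<alpha> u)"
  by (rule pint_weak_deriv[OF \<Omega> sobolev_weak_deriv(2)[OF \<Omega> u \<alpha>]
        has_weak_deriv_AE_cong[OF \<Omega> Lp_onD(1)[OF sobolev_Lp[OF u]] eq sobolev_weak_deriv(1)[OF \<Omega> u \<alpha>] sobolev_locally_integrable[OF v]]])

lemma sobolev_norm_eq_0:
  assumes \<Omega>: "open \<Omega>" and u: "u \<in> sobolev_space \<Omega> k p" and 0: "sobolev_norm \<Omega> k p u = 0"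
  shows "ae_eq_on \<Omega> u (\<lambda>_. 0)"
proof -
  have z: "order_mi (\<lambda>_. 0) \<le> k" by (simp add: order_mi_def)
  have "(\<Sum>\<alpha> | order_mi \<alpha> \<le> k. pint \<Omega> p (weak_deriv \<Omega> \<alpha> u)) = 0"
    using 0 by (simp add: sobolev_norm_pint)
  then have "pint \<Omega> p (weak_deriv \<Omega> (\<lambda>_. 0) u) = 0"
    using z by (subst (asm) sum_nonneg_eq_0_iff) (auto simp: pint_nonneg finite_order_mi_le)
  then have "pint \<Omega> p u = 0"
    using pint_weak_deriv[OF \<Omega> sobolev_Lp[OF u] has_weak_deriv_zero[OF sobolev_locally_integrable[OF u]]] by simp
  from pint_eq_0[OF sobolev_Lp[OF u] this] show ?thesis by (simp add: ae_eq_on_def)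
qed

text \<open>Take a nonzero coefficient of maximal order \<open>\<beta>\<close>. Then \<open>\<partial>\<^sup>\<beta>\<close> of the polynomial is the nonzero constant
\<open>c\<^sub>\<beta> \<beta>!\<close>, whereas the weak derivative of the zero function is zero.\<close>

lemma poly_ae_zero_imp_coeff_zero:
  fixes \<Omega> :: "(real^'d::finite) set"
  assumes \<Omega>: "open \<Omega>" "\<Omega> \<noteq> {}" and z: "ae_eq_on \<Omega> (\<lambda>x. \<Sum>\<alpha> | order_mi \<alpha> < k. c \<alpha> * monomial \<alpha> x) (\<lambda>_. 0)" and \<alpha>: "order_mi \<alpha> < k"
  shows "c \<alpha> = 0"
proof (rule ccontr)
  let ?q = "\<lambda>x. \<Sum>\<alpha> | order_mi \<alpha> < k. c \<alpha> * monomial \<alpha> x"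
  let ?N = "{\<alpha> :: 'd \<Rightarrow> nat. order_mi \<alpha> < k \<and> c \<alpha> \<noteq> 0}"
  assume "c \<alpha> \<noteq> 0"
  then have ne: "?N \<noteq> {}" using \<alpha> by blast
  have fin: "finite ?N" by (rule finite_subset[OF _ finite_order_mi_less[of k]]) auto
  have "Max (order_mi ` ?N) \<in> order_mi ` ?N" using fin ne by (intro Max_in) auto
  then obtain \<beta> where \<beta>: "\<beta> \<in> ?N" "order_mi \<beta> = Max (order_mi ` ?N)" by auto
  have top: "order_mi \<gamma> \<le> order_mi \<beta>" if "\<gamma> \<in> ?N" for \<gamma> unfolding \<beta>(2) using fin that by simp
  have sm: "smooth ?q" by (intro smooth_sum smooth_mult smooth_const smooth_mono)
  have "multi_deriv \<beta> ?q = (\<lambda>x. \<Sum>\<alpha> | order_mi \<alpha> < k. c \<alpha> * multi_deriv \<beta> (monomial \<alpha>) x)"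
    by (rule multi_deriv_sum_cmult[OF smooth_mono])
  also have "\<dots> = (\<lambda>x. \<Sum>\<alpha> | order_mi \<alpha> < k. if \<alpha> = \<beta> then c \<beta> * mi_fact \<beta> else 0)"
  proof (intro ext sum.cong refl)
    fix x \<gamma> assume "\<gamma> \<in> {\<alpha> :: 'd \<Rightarrow> nat. order_mi \<alpha> < k}"
    then show "c \<gamma> * multi_deriv \<beta> (monomial \<gamma>) x = (if \<gamma> = \<beta> then c \<beta> * mi_fact \<beta> else 0)"
      using top[of \<gamma>] by (cases "c \<gamma> = 0") (auto simp: multi_deriv_mono_same multi_deriv_mono_other)
  qed
  also have "\<dots> = (\<lambda>x. c \<beta> * mi_fact \<beta>)" using \<beta>(1) by (simp add: sum.delta finite_order_mi_less)
  finally have d: "multi_deriv \<beta> ?q = (\<lambda>x. c \<beta> * mi_fact \<beta>)" .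
  have h1: "has_weak_deriv \<Omega> \<beta> ?q (\<lambda>x. c \<beta> * mi_fact \<beta>)" using has_weak_deriv_smooth[OF \<Omega>(1) sm, of \<beta>] unfolding d .
  have h2: "has_weak_deriv \<Omega> \<beta> ?q (\<lambda>x. 0)"
    unfolding has_weak_deriv_def
  proof (intro conjI ballI smooth_locally_integrable sm smooth_const)
    fix \<phi> assume "\<phi> \<in> test_functions \<Omega>"
    have "AE x in lebesgue_on \<Omega>. ?q x * multi_deriv \<beta> \<phi> x = 0"
      using z unfolding ae_eq_on_def by eventually_elim simp
    then have "(\<integral>x. ?q x * multi_deriv \<beta> \<phi> x \<partial>lebesgue_on \<Omega>) = 0" by (rule integral_eq_zero_AE)
    then show "(\<integral>x. ?q x * multi_deriv \<beta> \<phi> x \<partial>lebesgue_on \<Omega>) = (- 1) ^ order_mi \<beta> * (\<integral>x. 0 * \<phi> x \<partial>lebesgue_on \<Omega>)" by simp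
  qed
  have "AE x in lborel. x \<in> \<Omega> \<longrightarrow> c \<beta> * mi_fact \<beta> = 0"
    using weak_deriv_unique[OF \<Omega>(1) h1 h2] unfolding AE_lebesgue_on[OF \<Omega>(1)] .
  then have "AE x in lborel. x \<notin> \<Omega>"
    by eventually_elim (use \<beta>(1) multi_deriv_mono_same(2)[of \<beta>] in auto)
  then have "\<Omega> \<in> null_sets lborel" using \<Omega>(1) by (subst AE_iff_null_sets) auto
  then show False using emeasure_open_pos[OF \<Omega>] by (simp add: null_setsD1)
qed

section \<open>Equivalence of the norms\<close>

lemma poly_funs_eq_poly_below: "1 \<le> k \<Longrightarrow> poly_funs (k - 1) = (poly_below k :: (real^'d::finite \<Rightarrow> complex) set)"
proof -
  assume "1 \<le> k"
  then have "{\<alpha> :: 'd \<Rightarrow> nat. order_mi \<alpha> \<le> k - 1} = {\<alpha>. order_mi \<alpha> < k}" by auto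
  then show ?thesis unfolding poly_funs_def poly_below_def monomial_def by simp
qed

text \<open>On coefficient vectors of polynomials the sum of the seminorms is a norm, so it bounds the coefficients
and with them the Sobolev norm. For empty \<open>\<Omega>\<close> the coefficients are not determined, but all norms vanish.\<close>

lemma poly_norm_bound:
  fixes \<Omega> :: "(real^'d::finite) set"
  assumes \<Omega>: "open \<Omega>" "bounded \<Omega>" and p: "1 \<le> p"
    and f: "\<And>i. i \<in> I \<Longrightarrow> seminorm_on \<Omega> (sobolev_space \<Omega> k p) (f i)"
    and definite: "\<And>q. q \<in> poly_below k \<Longrightarrow> (\<Sum>i\<in>I. f i q) = 0 \<Longrightarrow> ae_eq_on \<Omega> q (\<lambda>_. 0)"
  shows "\<exists>B\<ge>0. \<forall>q\<in>poly_below k. sobolev_norm \<Omega> k p q \<le> B * (\<Sum>i\<in>I. f i q)"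
proof (cases "\<Omega> = {}")
  case True
  have "pint \<Omega> p u = 0" for u
    unfolding pint_def integral_restrict_space[OF open_sets_lebesgue[OF \<Omega>(1)]] by (simp add: True)
  then show ?thesis by (intro exI[of _ 0]) (simp add: sobolev_norm_pint)
next
  case False
  let ?W = "sobolev_space \<Omega> k p"
  let ?J = "{\<alpha> :: 'd \<Rightarrow> nat. order_mi \<alpha> < k}"
  define Q where "Q c = (\<lambda>x. \<Sum>\<alpha>\<in>?J. c \<alpha> * monomial \<alpha> x)" for c :: "('d \<Rightarrow> nat) \<Rightarrow> complex"
  define G where "G c = (\<Sum>i\<in>I. f i (Q c))" for c
  have QP: "Q c \<in> poly_below k" for c unfolding Q_def poly_below_def by blast
  have QW: "Q c \<in> ?W" for c by (rule smooth_sobolev[OF \<Omega> p poly_below_smooth[OF QP]])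
  have f0: "0 \<le> f i w" if "i \<in> I" "w \<in> ?W" for i w using f that by (auto simp: seminorm_on_def)
  have fc: "f i (\<lambda>x. c * w x) = cmod c * f i w" if "i \<in> I" "w \<in> ?W" for i w c using f that by (auto simp: seminorm_on_def)
  have fa: "f i (\<lambda>x. w x + z x) \<le> f i w + f i z" if "i \<in> I" "w \<in> ?W" "z \<in> ?W" for i w z using f that by (auto simp: seminorm_on_def)
  have "\<exists>K\<ge>0. \<forall>c. \<forall>\<alpha>\<in>?J. cmod (c \<alpha>) \<le> K * G c"
  proof (rule coefficient_bound[OF finite_order_mi_less])
    show "0 \<le> G c" for c unfolding G_def by (intro sum_nonneg f0 QW)
    show "G (\<lambda>i. c i + d i) \<le> G c + G d" for c d
    proof -
      have "Q (\<lambda>i. c i + d i) = (\<lambda>x. Q c x + Q d x)" by (simp add: Q_def distrib_right sum.distrib)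
      then show ?thesis unfolding G_def by (simp add: sum.distrib[symmetric] sum_mono fa QW)
    qed
    show "G (\<lambda>i. t * c i) = cmod t * G c" for t c
    proof -
      have "Q (\<lambda>i. t * c i) = (\<lambda>x. t * Q c x)" by (simp add: Q_def sum_distrib_left mult.assoc)
      then show ?thesis unfolding G_def by (simp add: sum_distrib_left fc QW)
    qed
    show "G c = G d" if "\<And>i. i \<in> ?J \<Longrightarrow> c i = d i" for c d
    proof -
      have "Q c = Q d" unfolding Q_def using that by (intro ext sum.cong) auto
      then show ?thesis by (simp add: G_def)
    qed
    show "c \<alpha> = 0" if "G c = 0" "\<alpha> \<in> ?J" for c \<alpha>
    proof -
      have "ae_eq_on \<Omega> (Q c) (\<lambda>_. 0)" using definite[OF QP] that(1) unfolding G_def by blast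
      then show ?thesis using poly_ae_zero_imp_coeff_zero[OF \<Omega>(1) False, of c k \<alpha>] that(2) unfolding Q_def by blast
    qed
  qed
  then obtain K where K: "K \<ge> 0" "\<And>c \<alpha>. \<alpha> \<in> ?J \<Longrightarrow> cmod (c \<alpha>) \<le> K * G c" by blast
  let ?N = "sobolev_norm \<Omega> k p"
  let ?m = "\<lambda>\<alpha>. ?N (monomial \<alpha>)"
  have mW: "monomial \<alpha> \<in> ?W" for \<alpha> by (rule smooth_sobolev[OF \<Omega> p smooth_mono])
  have upper: "?N (Q c) \<le> (\<Sum>\<alpha>\<in>?J. cmod (c \<alpha>) * ?m \<alpha>)" for c
  proof -
    have "(\<lambda>x. \<Sum>\<alpha>\<in>F. c \<alpha> * monomial \<alpha> x) \<in> ?W \<and> ?N (\<lambda>x. \<Sum>\<alpha>\<in>F. c \<alpha> * monomial \<alpha> x) \<le> (\<Sum>\<alpha>\<in>F. cmod (c \<alpha>) * ?m \<alpha>)" if "finite F" for F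
      using that
    proof induction
      case empty
      have "(\<lambda>x. 0 * monomial (\<lambda>_. 0) x) \<in> ?W" by (rule sobolev_cmult[OF \<Omega>(1) mW])
      moreover have "?N (\<lambda>x. 0 * monomial (\<lambda>_. 0) x) = 0"
        using sobolev_norm_triangle(2)[OF \<Omega>(1) p mW mW, of 0 "\<lambda>_. 0"] by simp
      ultimately show ?case by simp
    next
      case (insert \<alpha> F)
      have 1: "(\<lambda>x. c \<alpha> * monomial \<alpha> x) \<in> ?W" by (rule sobolev_cmult[OF \<Omega>(1) mW])
      have 2: "(\<lambda>x. \<Sum>\<alpha>\<in>F. c \<alpha> * monomial \<alpha> x) \<in> ?W" using insert by blast
      have "?N (\<lambda>x. c \<alpha> * monomial \<alpha> x + (\<Sum>\<alpha>\<in>F. c \<alpha> * monomial \<alpha> x)) \<le> ?N (\<lambda>x. c \<alpha> * monomial \<alpha> x) + ?N (\<lambda>x. \<Sum>\<alpha>\<in>F. c \<alpha> * monomial \<alpha> x)"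
        by (rule sobolev_norm_triangle(1)[OF \<Omega>(1) p 1 2])
      also have "\<dots> \<le> cmod (c \<alpha>) * ?m \<alpha> + (\<Sum>\<alpha>\<in>F. cmod (c \<alpha>) * ?m \<alpha>)"
        using insert.IH sobolev_norm_triangle(2)[OF \<Omega>(1) p mW mW, of "c \<alpha>" \<alpha>] by simp
      finally show ?case using sobolev_add[OF \<Omega>(1) p 1 2] insert by simp
    qed
    then show ?thesis unfolding Q_def using finite_order_mi_less by blast
  qed
  let ?B = "K * (\<Sum>\<alpha>\<in>?J. ?m \<alpha>)"
  have "?N q \<le> ?B * (\<Sum>i\<in>I. f i q)" if "q \<in> poly_below k" for q
  proof -
    obtain c where q: "q = Q c" using \<open>q \<in> poly_below k\<close> unfolding poly_below_def Q_def by blast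
    have "?N q \<le> (\<Sum>\<alpha>\<in>?J. cmod (c \<alpha>) * ?m \<alpha>)" unfolding q by (rule upper)
    also have "\<dots> \<le> (\<Sum>\<alpha>\<in>?J. (K * G c) * ?m \<alpha>)"
      by (intro sum_mono mult_right_mono K(2) sobolev_norm_nonneg)
    also have "\<dots> = ?B * (\<Sum>i\<in>I. f i q)" by (simp add: sum_distrib_left[symmetric] G_def q)
    finally show ?thesis .
  qed
  moreover have "?B \<ge> 0" using K(1) by (intro mult_nonneg_nonneg sum_nonneg sobolev_norm_nonneg)
  ultimately show ?thesis by blast
qed

lemma sobolev_norm_powr:
  "1 \<le> p \<Longrightarrow> sobolev_norm \<Omega> k p u powr p = (\<Sum>\<alpha> | order_mi \<alpha> \<le> k. pint \<Omega> p (weak_deriv \<Omega> \<alpha> u))"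
  by (simp add: sobolev_norm_pint powr_powr sum_nonneg pint_nonneg)

text \<open>With \<open>q\<close> from the Deny--Lions inequality, \<open>?N\<close> the standard and \<open>?M\<close> the modified norm, the constant of the
lower bound collects \<open>?N (u - q) \<le> A * ?M u\<close> and \<open>f\<^sub>i(q) \<le> (1 + C\<^sub>i A) * ?M u\<close>. Definiteness of the modified
norm is a by-product of this bound.\<close>

theorem theorem5p1:
  fixes \<Omega> :: "(real^'d::finite) set" and k l :: nat and p :: real
    and f :: "nat \<Rightarrow> (real^'d \<Rightarrow> complex) \<Rightarrow> real"
  assumes "1 \<le> k" and "1 \<le> l" and "1 \<le> p"
    and "open \<Omega>" and "connected \<Omega>" and "bounded \<Omega>" and "lipschitz_boundary \<Omega>"
    and "\<And>i. i \<in> {1..l} \<Longrightarrow> seminorm_on \<Omega> (sobolev_space \<Omega> k p) (f i)"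
    and "\<And>i. i \<in> {1..l} \<Longrightarrow>
           \<exists>C\<ge>0. \<forall>v\<in>sobolev_space \<Omega> k p. f i v \<le> C * sobolev_norm \<Omega> k p v"
    and "\<And>v. v \<in> poly_funs (k - 1) \<Longrightarrow> (\<Sum>i=1..l. f i v powr p) = 0 \<Longrightarrow> ae_eq_on \<Omega> v (\<lambda>_. 0)"
  shows "norm_on \<Omega> (sobolev_space \<Omega> k p) (modified_norm \<Omega> k p l f) \<and>
         equivalent_on (sobolev_space \<Omega> k p) (modified_norm \<Omega> k p l f) (sobolev_norm \<Omega> k p)"
proof -
  let ?W = "sobolev_space \<Omega> k p" and ?N = "sobolev_norm \<Omega> k p" and ?M = "modified_norm \<Omega> k p l f"
  note p = assms(3) and \<Omega> = assms(4,6)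
  note f = assms(8)
  let ?S = "\<lambda>u. \<Sum>\<alpha> | order_mi \<alpha> = k. pint \<Omega> p (weak_deriv \<Omega> \<alpha> u)"
  let ?F = "\<lambda>u. \<Sum>i=1..l. f i u powr p"
  have M: "?M u = (?F u + ?S u) powr (1 / p)" for u by (rule modified_norm_pint[OF p])
  have M0: "0 \<le> ?M u" for u by (simp add: M)
  have S0: "0 \<le> ?S u" for u by (intro sum_nonneg pint_nonneg)
  have F0: "0 \<le> ?F u" for u by (intro sum_nonneg) simp
  have f0: "0 \<le> f i w" if "i \<in> {1..l}" "w \<in> ?W" for i w using f[OF that(1)] that(2) by (auto simp: seminorm_on_def)
  have fc: "f i (\<lambda>x. c * w x) = cmod c * f i w" if "i \<in> {1..l}" "w \<in> ?W" for i w c using f[OF that(1)] that(2) by (auto simp: seminorm_on_def)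
  have fa: "f i (\<lambda>x. w x + z x) \<le> f i w + f i z" if "i \<in> {1..l}" "w \<in> ?W" "z \<in> ?W" for i w z using f[OF that(1)] that(2,3) by (auto simp: seminorm_on_def)
  have semi: "seminorm_on \<Omega> ?W ?M"
    unfolding seminorm_on_def
  proof (intro conjI ballI allI impI)
    fix u v assume u: "u \<in> ?W" and v: "v \<in> ?W" and eq: "ae_eq_on \<Omega> u v"
    have "f i u = f i v" if "i \<in> {1..l}" for i using f[OF that] u v eq by (auto simp: seminorm_on_def)
    moreover have "?S v = ?S u" by (intro sum.cong refl pint_weak_deriv_AE_cong[OF \<Omega>(1) u v eq]) simp
    ultimately show "?M u = ?M v" unfolding M by simp
  next
    fix c u assume u: "u \<in> ?W"
    show "?M (\<lambda>x. c * u x) = cmod c * ?M u" unfolding M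
      by (rule sum_seminorms_root_triangle(2)[OF \<Omega>(1) p _ f u u]) auto
  next
    fix u v assume u: "u \<in> ?W" and v: "v \<in> ?W"
    show "?M (\<lambda>x. u x + v x) \<le> ?M u + ?M v" unfolding M
      by (rule sum_seminorms_root_triangle(1)[OF \<Omega>(1) p _ f u v]) auto
  qed (rule M0)
  have "\<forall>i\<in>{1..l}. \<exists>C\<ge>0. \<forall>v\<in>?W. f i v \<le> C * ?N v" using assms(9) by blast
  from bchoice[OF this] obtain C where C: "\<And>i. i \<in> {1..l} \<Longrightarrow> C i \<ge> 0" "\<And>i v. i \<in> {1..l} \<Longrightarrow> v \<in> ?W \<Longrightarrow> f i v \<le> C i * ?N v" by blast
  have fM: "f i u \<le> ?M u" if i: "i \<in> {1..l}" and u: "u \<in> ?W" for i u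
  proof -
    have "f i u powr p \<le> ?F u" using i by (intro member_le_sum[of i "{1..l}" "\<lambda>i. f i u powr p"]) auto
    then have "(f i u powr p) powr (1 / p) \<le> ?M u" unfolding M using S0[of u] p by (intro powr_mono2) auto
    then show ?thesis using f0[OF i u] p by (simp add: powr_powr)
  qed
  have SM: "?S u powr (1 / p) \<le> ?M u" for u unfolding M using F0[of u] S0[of u] p by (intro powr_mono2) auto
  let ?U = "(\<Sum>i=1..l. C i powr p) + 1"
  have U: "?U > 0" by (intro add_nonneg_pos sum_nonneg) auto
  have upper: "?M u \<le> ?U powr (1 / p) * ?N u" if u: "u \<in> ?W" for u
  proof -
    have "f i u powr p \<le> C i powr p * ?N u powr p" if i: "i \<in> {1..l}" for i
    proof -
      have "f i u powr p \<le> (C i * ?N u) powr p" using C(2)[OF i u] f0[OF i u] p by (intro powr_mono2) auto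
      then show ?thesis using C(1)[OF i] sobolev_norm_nonneg by (simp add: powr_mult)
    qed
    moreover have "?S u \<le> ?N u powr p"
      unfolding sobolev_norm_powr[OF p] by (intro sum_mono2 finite_order_mi_le pint_nonneg) auto
    ultimately have "?F u + ?S u \<le> (\<Sum>i=1..l. C i powr p * ?N u powr p) + ?N u powr p"
      by (intro add_mono sum_mono)
    also have "\<dots> = ?U * ?N u powr p" by (simp add: distrib_right sum_distrib_right)
    finally have "?M u \<le> (?U * ?N u powr p) powr (1 / p)"
      unfolding M using p F0[of u] S0[of u] by (intro powr_mono2) auto
    also have "\<dots> = ?U powr (1 / p) * ?N u"
      using U p sobolev_norm_nonneg[of \<Omega> k p u] by (simp add: powr_mult powr_powr)
    finally show ?thesis .
  qed
  obtain D where D: "D \<ge> 0" and deny: "\<And>u. u \<in> ?W \<Longrightarrow> \<exists>q\<in>poly_below k. \<forall>\<alpha>. order_mi \<alpha> \<le> k \<longrightarrow>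
    pint \<Omega> p (weak_deriv \<Omega> \<alpha> (\<lambda>x. u x - q x)) \<le> D * ?S u"
    using deny_lions[OF \<Omega> p poincare_lipschitz[OF p \<Omega>(1) assms(5) \<Omega>(2) assms(7)], of k] by blast
  have "\<exists>B\<ge>0. \<forall>q\<in>poly_below k. ?N q \<le> B * (\<Sum>i\<in>{1..l}. f i q)"
  proof (rule poly_norm_bound[OF \<Omega> p f])
    fix q :: "real^'d \<Rightarrow> complex" assume q: "q \<in> poly_below k" and z: "(\<Sum>i=1..l. f i q) = 0"
    have qW: "q \<in> ?W" by (rule smooth_sobolev[OF \<Omega> p poly_below_smooth[OF q]])
    have "f i q = 0" if "i \<in> {1..l}" for i
      using z that by (subst (asm) sum_nonneg_eq_0_iff) (auto intro: f0[OF _ qW])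
    then have "(\<Sum>i=1..l. f i q powr p) = 0" by simp
    then show "ae_eq_on \<Omega> q (\<lambda>_. 0)" using assms(10) q poly_funs_eq_poly_below[OF assms(1)] by blast
  qed
  then obtain B where B: "B \<ge> 0" "\<And>q. q \<in> poly_below k \<Longrightarrow> ?N q \<le> B * (\<Sum>i=1..l. f i q)" by blast
  define A where "A = (real (card {\<alpha> :: 'd \<Rightarrow> nat. order_mi \<alpha> \<le> k}) * D) powr (1 / p)"
  have A0: "A \<ge> 0" by (simp add: A_def)
  let ?L = "A + B * (\<Sum>i=1..l. 1 + C i * A)"
  have L0: "?L \<ge> 0" using A0 B(1) C(1) by (intro add_nonneg_nonneg mult_nonneg_nonneg sum_nonneg) auto
  have lower: "?N u \<le> ?L * ?M u" if u: "u \<in> ?W" for u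
  proof -
    obtain q where q: "q \<in> poly_below k" and est: "\<And>\<alpha>. order_mi \<alpha> \<le> k \<Longrightarrow> pint \<Omega> p (weak_deriv \<Omega> \<alpha> (\<lambda>x. u x - q x)) \<le> D * ?S u"
      using deny[OF u] by blast
    let ?r = "\<lambda>x. u x - q x"
    have qW: "q \<in> ?W" by (rule smooth_sobolev[OF \<Omega> p poly_below_smooth[OF q]])
    have rW: "?r \<in> ?W" by (rule sobolev_diff[OF \<Omega>(1) p u qW])
    have "(\<Sum>\<alpha> | order_mi \<alpha> \<le> k. pint \<Omega> p (weak_deriv \<Omega> \<alpha> ?r)) \<le> real (card {\<alpha> :: 'd \<Rightarrow> nat. order_mi \<alpha> \<le> k}) * (D * ?S u)"
      using est by (intro sum_bounded_above) simp
    then have "?N ?r \<le> (real (card {\<alpha> :: 'd \<Rightarrow> nat. order_mi \<alpha> \<le> k}) * D * ?S u) powr (1 / p)"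
      unfolding sobolev_norm_pint using p by (intro powr_mono2) (auto simp: mult.assoc intro!: sum_nonneg pint_nonneg)
    also have "\<dots> = A * ?S u powr (1 / p)" unfolding A_def using D S0[of u] by (simp add: powr_mult)
    also have "\<dots> \<le> A * ?M u" by (intro mult_left_mono SM A0)
    finally have r: "?N ?r \<le> A * ?M u" .
    have fq: "f i q \<le> (1 + C i * A) * ?M u" if i: "i \<in> {1..l}" for i
    proof -
      have "f i q = f i (\<lambda>x. u x + (- 1) * ?r x)" by simp
      also have "\<dots> \<le> f i u + f i (\<lambda>x. (- 1) * ?r x)" by (rule fa[OF i u sobolev_cmult[OF \<Omega>(1) rW]])
      also have "\<dots> = f i u + f i ?r" by (subst fc[OF i rW]) simp
      also have "\<dots> \<le> ?M u + C i * (A * ?M u)"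
        by (intro add_mono fM i u order_trans[OF C(2)[OF i rW] mult_left_mono[OF r C(1)[OF i]]])
      also have "\<dots> = (1 + C i * A) * ?M u" by (simp add: distrib_right mult.assoc)
      finally show ?thesis .
    qed
    have "?N q \<le> B * (\<Sum>i=1..l. f i q)" by (rule B(2)[OF q])
    also have "\<dots> \<le> B * (\<Sum>i=1..l. (1 + C i * A) * ?M u)" by (intro mult_left_mono sum_mono fq B(1))
    finally have qn: "?N q \<le> B * (\<Sum>i=1..l. 1 + C i * A) * ?M u" by (simp only: sum_distrib_right mult.assoc)
    have "?N u = ?N (\<lambda>x. ?r x + q x)" by simp
    also have "\<dots> \<le> ?N ?r + ?N q" by (rule sobolev_norm_triangle(1)[OF \<Omega>(1) p rW qW])
    also have "\<dots> \<le> A * ?M u + B * (\<Sum>i=1..l. 1 + C i * A) * ?M u" by (intro add_mono r qn)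
    finally show ?thesis by (simp only: distrib_right)
  qed
  have "equivalent_on ?W ?M ?N"
    unfolding equivalent_on_def
  proof (intro exI conjI ballI)
    show "1 / (?L + 1) > 0" "?U powr (1 / p) > 0" using L0 U by auto
    fix u assume u: "u \<in> ?W"
    show "?M u \<le> ?U powr (1 / p) * ?N u" by (rule upper[OF u])
    have "?N u \<le> (?L + 1) * ?M u" using lower[OF u] M0[of u] by (simp add: distrib_right)
    then show "1 / (?L + 1) * ?N u \<le> ?M u" using L0 by (simp add: field_simps)
  qed
  moreover have "norm_on \<Omega> ?W ?M"
    unfolding norm_on_def
  proof (intro conjI ballI impI semi)
    fix u assume u: "u \<in> ?W" and "?M u = 0"
    then have "?N u = 0" using lower[OF u] sobolev_norm_nonneg[of \<Omega> k p u] by simp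
    then show "ae_eq_on \<Omega> u (\<lambda>_. 0)" by (rule sobolev_norm_eq_0[OF \<Omega>(1) u])
  qed
  ultimately show ?thesis by blast
qed

end
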